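(* Let $F(X)\in\mathbb{Z}[X]$ be a monic irreducible polynomial, $\alpha$ a complex root of $F$, $K=\mathbb{Q}(\alpha)$, and $p$ a rational prime with $p$-adic valuation $\nu_p$. Suppose that $\overline{F}(X)=\prod_{i=1}^r\overline{\phi_i}(X)^{l_i}$ modulo $p$, where $\overline{\phi_1},\dots,\overline{\phi_r}\in\mathbb{F}_p[X]$ are distinct monic irreducible polynomials and $l_i\ge 1$, and let $\phi_i(X)\in\mathbb{Z}[X]$ be monic lifts of $\overline{\phi_i}(X)$. For each $i$ let $F(X)=\sum_{j=0}^{L_i}a_{i,j}(X)\phi_i(X)^{L_i-j}$ be the $\phi_i$-adic expansion of $F$, and set $s_{F,i}=\max\{j\in\{0,\dots,L_i\}:\nu_p(a_{i,j}(X))=0\}$, $\lambda_i=\nu_p(a_{i,L_i}(X))/(L_i-s_{F,i})$, $m_i=\deg\phi_i$, and $d_i=\gcd(\nu_p(a_{i,L_i}(X)),\,L_i-s_{F,i})$. Suppose that for each $i=1,\dots,r$, either (i) $l_i=1$, or (ii) $l_i\ge 2$, $F$ satisfies the $L_{\phi_i,\lambda_i}$ property, and the residual polynomial $F_{\phi_i}(Y)$ is irreducible in $\mathbb{F}_{\phi_i}[Y]$. Then there are exactly $r$ valuations $w_1,\dots,w_r$ of $K$ extending $\nu_p$, and they can be indexed so that for each $i=1,\dots,r$ the ramification index of $w_i$ is $e(w_i)=l_i/d_i$ and its residue degree is $f(w_i)=m_id_i$.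
   Context: $\nu_p$ is extended to $\mathbb{Z}_p[X]$ (which contains $\mathbb{Z}[X]$) by letting $\nu_p$ of a polynomial be the minimum of $\nu_p$ of its coefficients; $\overline{P}$ denotes reduction modulo $p$. For a monic $\phi\in\mathbb{Z}_p[X]$ with $\overline{\phi}$ irreducible, $\mathbb{F}_\phi=\mathbb{Z}_p[X]/(p,\phi)$ and $\mathrm{red}:\mathbb{Z}_p[X]\to\mathbb{F}_\phi$ is the canonical projection. The $\phi$-adic expansion of a monic $F\in\mathbb{Z}_p[X]$ is the unique expression $F=\sum_{i=0}^{l}a_i\phi^{l-i}$ with $a_i\in\mathbb{Z}_p[X]$, $\deg a_i<\deg\phi$; put $s=\max\{i:\nu_p(a_i)=0\}$. When $\overline{\phi}\mid\overline{F}$ (so $s<l$), $\lambda_F=\nu_p(a_l)/(l-s)$, and $F$ satisfies the $L_{\phi,\lambda}$ property if $\lambda=\lambda_F$ and $\nu_p(a_{i+s})/i\ge\lambda$ for all $i=1,\dots,l-s$. In that case let $d=\gcd(\nu_p(a_l),l-s)$, $e=(l-s)/d$, $h=\nu_p(a_l)/d$, $t_i=\mathrm{red}(a_{ie+s}/p^{ih})$ for $i=0,\dots,d$, and the residual polynomial is $F_\phi(Y)=\sum_{i=0}^d t_iY^{d-i}\in\mathbb{F}_\phi[Y]$ (of degree $d$). *)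

theory Defs
  imports
    "HOL-Algebra.Algebra"
    "HOL-Algebra.Algebraic_Closure_Type"
    "HOL-Library.Extended_Real"
    "HOL-Library.FuncSet"
    "Berlekamp_Zassenhaus.Finite_Field"
    "HOL-Computational_Algebra.Polynomial"
begin

text \<open>
  \<open>HOL-Algebra\<close> reuses several names for its own notions (\<open>degree\<close>, \<open>lead_coeff\<close>, \<open>irreducible\<close>);
  below, the type-based notions are meant whenever polynomials of type \<open>int poly\<close> are involved and
  are qualified by \<open>Polynomial\<close> or \<open>Factorial_Ring\<close>.
\<close>

section \<open>The $p$-adic valuation\<close>

definition int_val :: "nat \<Rightarrow> int \<Rightarrow> enat" where
  "int_val p c = (if c = 0 then \<infinity> else enat (multiplicity (int p) c))"

definition rat_val :: "nat \<Rightarrow> rat \<Rightarrow> ereal" where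
  "rat_val p q = (if q = 0 then \<infinity> else
     (case quotient_of q of (m, n) \<Rightarrow>
        ereal (real (multiplicity (int p) m) - real (multiplicity (int p) n))))"

definition poly_val :: "nat \<Rightarrow> int poly \<Rightarrow> enat" where
  "poly_val p f = (INF i. int_val p (Polynomial.coeff f i))"

section \<open>The $\phi$-adic expansion, the $L_{\phi,\lambda}$ property, the residual polynomial\<close>

text \<open>
  As all polynomials involved have integer coefficients, we work over \<open>\<int>\<close> instead of the $p$-adic
  integers: the expansion of an integer polynomial at a monic integer polynomial has integer
  coefficients, and $\mathbb{Z}[X]/(p,\phi) = \mathbb{Z}_p[X]/(p,\phi)$.

  The condition \<open>a 0 \<noteq> 0\<close> makes \<open>L\<close> unique. The sequence \<open>a\<close> is determined on \<open>{0..L}\<close> only, and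
  the definitions below use only these values.
\<close>

definition phi_adic_expansion :: "int poly \<Rightarrow> int poly \<Rightarrow> nat \<Rightarrow> (nat \<Rightarrow> int poly) \<Rightarrow> bool" where
  "phi_adic_expansion \<phi> F L a \<longleftrightarrow>
     F = (\<Sum>j\<in>{0..L}. a j * \<phi> ^ (L - j)) \<and>
     (\<forall>j\<in>{0..L}. Polynomial.degree (a j) < Polynomial.degree \<phi>) \<and>
     a 0 \<noteq> 0"

definition exp_s :: "nat \<Rightarrow> nat \<Rightarrow> (nat \<Rightarrow> int poly) \<Rightarrow> nat" where
  "exp_s p L a = Max {j\<in>{0..L}. poly_val p (a j) = 0}"

definition exp_lambda :: "nat \<Rightarrow> nat \<Rightarrow> (nat \<Rightarrow> int poly) \<Rightarrow> ereal" where
  "exp_lambda p L a = ereal_of_enat (poly_val p (a L)) / ereal (real (L - exp_s p L a))"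

definition L_property :: "nat \<Rightarrow> nat \<Rightarrow> (nat \<Rightarrow> int poly) \<Rightarrow> ereal \<Rightarrow> bool" where
  "L_property p L a lam \<longleftrightarrow>
     lam = exp_lambda p L a \<and>
     (\<forall>i\<in>{1..L - exp_s p L a}.
        ereal_of_enat (poly_val p (a (i + exp_s p L a))) / ereal (real i) \<ge> lam)"

text \<open>
  \<open>a L = 0\<close> (infinite valuation) is treated with the convention $\gcd(\infty, n) = n$.
  For irreducible \<open>F\<close> this means \<open>F = \<phi>\<close>; then \<open>L - exp_s p L a = 1\<close>, so that any convention
  gives the value 1.
\<close>

definition exp_d :: "nat \<Rightarrow> nat \<Rightarrow> (nat \<Rightarrow> int poly) \<Rightarrow> nat" where
  "exp_d p L a = (case poly_val p (a L) of
       enat v \<Rightarrow> gcd v (L - exp_s p L a)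
     | \<infinity> \<Rightarrow> L - exp_s p L a)"

definition exp_e :: "nat \<Rightarrow> nat \<Rightarrow> (nat \<Rightarrow> int poly) \<Rightarrow> nat" where
  "exp_e p L a = (L - exp_s p L a) div exp_d p L a"

definition exp_h :: "nat \<Rightarrow> nat \<Rightarrow> (nat \<Rightarrow> int poly) \<Rightarrow> nat" where
  "exp_h p L a = the_enat (poly_val p (a L)) div exp_d p L a"

definition phi_ideal :: "nat \<Rightarrow> int poly \<Rightarrow> int poly set" where
  "phi_ideal p \<phi> = Idl\<^bsub>ring_of_type_algebra\<^esub> {[:int p:], \<phi>}"

definition phi_field :: "nat \<Rightarrow> int poly \<Rightarrow> int poly set ring" where
  "phi_field p \<phi> = ring_of_type_algebra Quot phi_ideal p \<phi>"

definition phi_red :: "nat \<Rightarrow> int poly \<Rightarrow> int poly \<Rightarrow> int poly set" where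
  "phi_red p \<phi> f = phi_ideal p \<phi> +>\<^bsub>ring_of_type_algebra\<^esub> f"

text \<open>
  Polynomials over a \<open>HOL-Algebra\<close> ring are lists of coefficients, leading coefficient first, so
  the list $[t_0,\dots,t_d]$ is $\sum_i t_i Y^{d-i}$. The division by $p^{ih}$ is exact if \<open>F\<close>
  has the $L_{\phi,\lambda}$ property.
\<close>

definition residual_poly :: "nat \<Rightarrow> int poly \<Rightarrow> nat \<Rightarrow> (nat \<Rightarrow> int poly) \<Rightarrow> int poly set list" where
  "residual_poly p \<phi> L a = ring.normalize (phi_field p \<phi>)
     (map (\<lambda>i. phi_red p \<phi>
             (a (i * exp_e p L a + exp_s p L a) div [:int p ^ (i * exp_h p L a):]))
        [0..<Suc (exp_d p L a)])"

section \<open>Valuations of number fields\<close>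

definition adjoin_root :: "complex \<Rightarrow> complex set" where
  "adjoin_root \<alpha> = generate_field ring_of_type_algebra {\<alpha>}"

text \<open>
  Valuations of a subfield \<open>K\<close> of the complex numbers are additive and real-valued; they are fixed
  to \<open>undefined\<close> outside \<open>K\<close>, so that they can be counted. Extending $\nu_p$ means that the
  restriction to \<open>\<rat>\<close> is equal (and not only equivalent) to $\nu_p$.
\<close>

definition valuations_on :: "complex set \<Rightarrow> (complex \<Rightarrow> ereal) set" where
  "valuations_on K = {w \<in> extensional K.
     (\<forall>x\<in>K. w x \<noteq> -\<infinity> \<and> (w x = \<infinity> \<longleftrightarrow> x = 0)) \<and>
     (\<forall>x\<in>K. \<forall>y\<in>K. w (x * y) = w x + w y) \<and>
     (\<forall>x\<in>K. \<forall>y\<in>K. w (x + y) \<ge> min (w x) (w y))}"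

definition valuations_extending :: "nat \<Rightarrow> complex set \<Rightarrow> (complex \<Rightarrow> ereal) set" where
  "valuations_extending p K = {w \<in> valuations_on K. \<forall>q::rat. w (of_rat q) = rat_val p q}"

definition val_group :: "complex set \<Rightarrow> (complex \<Rightarrow> ereal) \<Rightarrow> real monoid" where
  "val_group K w = \<lparr>carrier = (\<lambda>x. real_of_ereal (w x)) ` (K - {0}), monoid.mult = (+), one = 0\<rparr>"

text \<open>Both the ramification index and the residue degree are 0 if infinite.\<close>

definition ramification_index :: "complex set \<Rightarrow> (complex \<Rightarrow> ereal) \<Rightarrow> nat" where
  "ramification_index K w = card (rcosets\<^bsub>val_group K w\<^esub> carrier (val_group \<rat> w))"

definition val_ring :: "complex set \<Rightarrow> (complex \<Rightarrow> ereal) \<Rightarrow> complex ring" where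
  "val_ring K w = ring_of_type_algebra \<lparr>carrier := {x\<in>K. w x \<ge> 0}\<rparr>"

definition val_ideal :: "complex set \<Rightarrow> (complex \<Rightarrow> ereal) \<Rightarrow> complex set" where
  "val_ideal K w = {x\<in>K. w x > 0}"

definition val_residue_field :: "complex set \<Rightarrow> (complex \<Rightarrow> ereal) \<Rightarrow> complex set ring" where
  "val_residue_field K w = val_ring K w Quot val_ideal K w"

text \<open>The image in the residue field of \<open>w\<close> of the residue field of the restriction of \<open>w\<close> to \<open>\<rat>\<close>.\<close>

definition val_base_residue_field :: "complex set \<Rightarrow> (complex \<Rightarrow> ereal) \<Rightarrow> complex set set" where
  "val_base_residue_field K w =
     (\<lambda>x. val_ideal K w +>\<^bsub>val_ring K w\<^esub> x) ` carrier (val_ring \<rat> w)"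

definition residue_degree :: "complex set \<Rightarrow> (complex \<Rightarrow> ereal) \<Rightarrow> nat" where
  "residue_degree K w =
     (let k = val_residue_field K w; k0 = val_base_residue_field K w in
      if ring.finite_dimension k k0 (carrier k) then ring.dim k k0 (carrier k) else 0)"

end

theory Submission
  imports Defs
begin

text \<open>
  Every valuation \<open>w\<close> extending $\nu_p$ makes \<open>\<phi>\<^sub>i(\<alpha>)\<close> topologically nilpotent for exactly one \<open>i\<close>, and by Chevalley's
  theorem every \<open>i\<close> occurs. If $l_i \ge 2$, the $\phi_i$-adic expansion evaluated at \<open>\<alpha>\<close> and the $L_{\phi_i,\lambda_i}$ property force
  $w(\phi_i(\alpha)) = \lambda_i = h/e$, so that the ramification index is at least $e = l_i/d_i$, and the residue of
  $\phi_i(\alpha)^e/p^h$ is a root of the irreducible residual polynomial, so that the residue degree is at least $m_i d_i$.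
  Since $\sum_i l_i m_i = [K:\mathbb{Q}]$, the fundamental inequality $\sum_w e(w) f(w) \le [K:\mathbb{Q}]$ leaves room for only one
  \<open>w\<close> for each \<open>i\<close> and turns all these estimates into equalities.
\<close>

section \<open>Valuations extending the $p$-adic valuation\<close>

text \<open>The obstacle is that neither the number of valuations nor e(w) and f(w) are known to be
  finite at the start. The fundamental inequality is therefore formulated for an arbitrary finite
  set of valuations and, at each of them, for arbitrary finite families: elements with values
  incongruent modulo \<int>, and elements whose residues are independent over the prime field. The
  products of these elements, counted over all valuations, are bounded in number by the rank of K
  over \<rat>, because weak approximation concentrates each family at its own valuation. Finiteness
  of all quantities is then a consequence. For l_i = 1 the families are 1 and the powers of \<alpha>
  below m_i, and d_i = 1. The residual polynomial has coefficients in the quotient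
  Z[X]/(p,\<phi>_i), whereas its root lies in the residue field of w. The two are connected by
  evaluation at \<alpha> followed by reduction, whose kernel is exactly (p,\<phi>_i). Valuations are
  normalized by w(p) = 1, so that distinct ones are inequivalent, as approximation requires.\<close>

locale complex_subring =
  fixes K :: "complex set"
  assumes one_mem [simp]: "1 \<in> K"
    and add_mem [simp]: "\<And>x y. x \<in> K \<Longrightarrow> y \<in> K \<Longrightarrow> x + y \<in> K"
    and uminus_mem [simp]: "\<And>x. x \<in> K \<Longrightarrow> - x \<in> K"
    and mult_mem [simp]: "\<And>x y. x \<in> K \<Longrightarrow> y \<in> K \<Longrightarrow> x * y \<in> K"
begin

lemma zero_mem [simp]: "0 \<in> K"
  using add_mem[OF one_mem uminus_mem[OF one_mem]] by simp

lemma diff_mem [simp]: "x \<in> K \<Longrightarrow> y \<in> K \<Longrightarrow> x - y \<in> K"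
  using add_mem[of x "- y"] by simp

lemma power_mem [simp]: "x \<in> K \<Longrightarrow> x ^ n \<in> K"
  by (induction n) auto

lemma sum_mem: "(\<And>i. i \<in> I \<Longrightarrow> f i \<in> K) \<Longrightarrow> sum f I \<in> K"
  by (induction I rule: infinite_finite_induct) auto

lemma of_nat_mem [simp]: "of_nat n \<in> K"
  by (induction n) auto

lemma of_int_mem [simp]: "of_int n \<in> K"
  by (cases n) (auto simp del: of_nat_Suc)

lemma poly_mem: "x \<in> K \<Longrightarrow> poly (of_int_poly g) x \<in> K"
  by (induction g) auto

end

locale complex_subfield = complex_subring +
  assumes inverse_mem [simp]: "\<And>x. x \<in> K \<Longrightarrow> inverse x \<in> K"
begin

lemma divide_mem [simp]: "x \<in> K \<Longrightarrow> y \<in> K \<Longrightarrow> x / y \<in> K"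
  by (simp add: divide_inverse)

lemma power_int_mem [simp]: "x \<in> K \<Longrightarrow> x powi n \<in> K"
  by (simp add: power_int_def)

lemma of_rat_mem [simp]: "of_rat q \<in> K"
proof -
  obtain m n where "quotient_of q = (m, n)" by (cases "quotient_of q")
  hence "q = of_int m / of_int n" by (rule quotient_of_div)
  thus ?thesis by (simp add: of_rat_divide)
qed

end

lemma rat_val_of_int: "rat_val p (of_int c) = (if c = 0 then \<infinity> else ereal (real (multiplicity (int p) c)))"
  by (simp add: rat_val_def)

locale ext_valuation = complex_subfield +
  fixes p :: nat and w :: "complex \<Rightarrow> ereal"
  assumes prime_p: "Factorial_Ring.prime p"
    and w_ext: "w \<in> valuations_extending p K"
begin

lemma p_pos: "0 < p"
  using prime_p by (rule prime_gt_0_nat)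

lemma prime_int_p: "Factorial_Ring.prime (int p)"
  using prime_p by simp

lemma w_eq_PInf: "x \<in> K \<Longrightarrow> w x = \<infinity> \<longleftrightarrow> x = 0"
  using w_ext by (simp add: valuations_extending_def valuations_on_def)

lemma w_not_MInf: "x \<in> K \<Longrightarrow> w x \<noteq> -\<infinity>"
  using w_ext by (simp add: valuations_extending_def valuations_on_def)

lemma w_0 [simp]: "w 0 = \<infinity>"
  by (simp add: w_eq_PInf)

lemma w_mult: "x \<in> K \<Longrightarrow> y \<in> K \<Longrightarrow> w (x * y) = w x + w y"
  using w_ext by (simp add: valuations_extending_def valuations_on_def)

lemma w_add_ge:
  assumes "x \<in> K" "y \<in> K" "c \<le> w x" "c \<le> w y"
  shows "c \<le> w (x + y)"
proof -
  have "min (w x) (w y) \<le> w (x + y)"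
    using w_ext assms(1,2) unfolding valuations_extending_def valuations_on_def by blast
  thus ?thesis using assms(3,4) by (rule order_trans[OF min.boundedI, rotated -1])
qed

lemma w_add_gt:
  assumes "x \<in> K" "y \<in> K" "c < w x" "c < w y"
  shows "c < w (x + y)"
proof (rule less_le_trans)
  show "c < min (w x) (w y)" using assms by simp
  show "min (w x) (w y) \<le> w (x + y)" using assms(1,2) by (intro w_add_ge) simp_all
qed

lemma w_of_int: "w (of_int c) = (if c = 0 then \<infinity> else ereal (real (multiplicity (int p) c)))"
proof -
  have "w (of_rat (of_int c)) = rat_val p (of_int c)"
    using w_ext unfolding valuations_extending_def by blast
  thus ?thesis unfolding rat_val_of_int by simp
qed

lemma w_of_int_nonneg: "0 \<le> w (of_int c)"
  by (simp add: w_of_int)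

lemma w_of_int_pos_iff: "0 < w (of_int c) \<longleftrightarrow> int p dvd c"
  using prime_multiplicity_gt_zero_iff[of "int p" c] prime_int_p
  by (cases "c = 0") (auto simp: w_of_int prime_imp_prime_elem)

lemma w_1 [simp]: "w 1 = 0"
  using w_of_int[of 1] by simp

lemma w_p: "w (of_nat p) = 1"
  using w_of_int[of "int p"] p_pos prime_int_p by simp

text \<open>Real form of \<open>w\<close> for subtraction and division. At 0 it takes the value 0
  instead of infinity, whence the hypotheses \<open>x \<noteq> 0\<close> below.\<close>

definition v :: "complex \<Rightarrow> real" where "v x = real_of_ereal (w x)"

lemma w_eq_v: "x \<in> K \<Longrightarrow> x \<noteq> 0 \<Longrightarrow> w x = ereal (v x)"
  unfolding v_def using w_eq_PInf[of x] w_not_MInf[of x] by (cases "w x") auto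

lemma v_mult: "x \<in> K \<Longrightarrow> y \<in> K \<Longrightarrow> x \<noteq> 0 \<Longrightarrow> y \<noteq> 0 \<Longrightarrow> v (x * y) = v x + v y"
  using w_mult[of x y] w_eq_v[of x] w_eq_v[of y] w_eq_v[of "x * y"] by simp

lemma v_1 [simp]: "v 1 = 0"
  by (simp add: v_def)

lemma v_p [simp]: "v (of_nat p) = 1"
  by (simp add: v_def w_p)

lemma v_power: "x \<in> K \<Longrightarrow> x \<noteq> 0 \<Longrightarrow> v (x ^ n) = real n * v x"
  by (induction n) (auto simp: v_mult algebra_simps)

lemma v_inverse: "x \<in> K \<Longrightarrow> x \<noteq> 0 \<Longrightarrow> v (inverse x) = - v x"
  using v_mult[of x "inverse x"] by simp

lemma v_divide: "x \<in> K \<Longrightarrow> y \<in> K \<Longrightarrow> x \<noteq> 0 \<Longrightarrow> y \<noteq> 0 \<Longrightarrow> v (x / y) = v x - v y"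
  by (simp add: divide_inverse v_mult v_inverse)

lemma w_uminus: "x \<in> K \<Longrightarrow> w (- x) = w x"
proof -
  assume x: "x \<in> K"
  have "w (- 1) = 0" using w_of_int[of "-1"] by simp
  thus ?thesis using w_mult[of "-1" x] x by simp
qed

lemma w_diff_gt: "x \<in> K \<Longrightarrow> y \<in> K \<Longrightarrow> c < w x \<Longrightarrow> c < w y \<Longrightarrow> c < w (x - y)"
  using w_add_gt[of x "- y" c] by (simp add: w_uminus)

text \<open>Otherwise x = (x + y) - y would be a difference of two elements of value greater than
  w(x).\<close>

lemma w_add_eq: 
  assumes "x \<in> K" "y \<in> K" "w x < w y"
  shows "w (x + y) = w x"
proof (rule antisym)
  show "w x \<le> w (x + y)" using assms by (intro w_add_ge) auto
  show "w (x + y) \<le> w x"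
  proof (rule ccontr)
    assume "\<not> w (x + y) \<le> w x"
    hence "w x < w ((x + y) - y)" using assms by (intro w_diff_gt) auto
    thus False by simp
  qed
qed

lemma w_sum_ge:
  assumes "\<And>i. i \<in> I \<Longrightarrow> f i \<in> K" "\<And>i. i \<in> I \<Longrightarrow> c \<le> w (f i)"
  shows "c \<le> w (sum f I)"
  using assms
  by (induction I rule: infinite_finite_induct) (auto intro!: w_add_ge sum_mem)

lemma w_sum_gt:
  assumes "\<And>i. i \<in> I \<Longrightarrow> f i \<in> K" "\<And>i. i \<in> I \<Longrightarrow> c < w (f i)" "c < \<infinity>"
  shows "c < w (sum f I)"
  using assms
  by (induction I rule: infinite_finite_induct) (auto intro!: w_add_gt sum_mem)

text \<open>A nonzero term of least value is strictly below the sum of all the others, so it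
  determines the value of the sum. Distinctness is asked only for nonzero terms, since all zero
  terms share the value infinity.\<close>

lemma w_sum_le_of_distinct:
  assumes I: "finite I" and f: "\<And>i. i \<in> I \<Longrightarrow> f i \<in> K"
    and dist: "\<And>i j. i \<in> I \<Longrightarrow> j \<in> I \<Longrightarrow> i \<noteq> j \<Longrightarrow> f i \<noteq> 0 \<Longrightarrow> w (f i) \<noteq> w (f j)"
    and i: "i \<in> I"
  shows "w (sum f I) \<le> w (f i)"
proof -
  have "\<exists>m\<in>I. \<forall>j\<in>I. w (f m) \<le> w (f j)"
    using ex_is_arg_min_if_finite[of I "\<lambda>j. w (f j)"] I i
    by (force simp: is_arg_min_def not_less)
  then obtain m where m: "m \<in> I" "\<And>j. j \<in> I \<Longrightarrow> w (f m) \<le> w (f j)" by blast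
  show ?thesis
  proof (cases "f m = 0")
    case True
    hence "w (f i) = \<infinity>" using m(2)[OF i] by simp
    thus ?thesis by simp
  next
    case False
    have "w (f m) < w (sum f (I - {m}))"
      using False m f dist w_eq_PInf[of "f m"]
      by (intro w_sum_gt) (auto simp: order.strict_iff_order)
    hence "w (f m + sum f (I - {m})) = w (f m)"
      using m(1) f by (intro w_add_eq) (auto intro!: sum_mem)
    also have "f m + sum f (I - {m}) = sum f I"
      using I m(1) by (simp add: sum.remove)
    finally show ?thesis using m(2)[OF i] by simp
  qed
qed

end

section \<open>Weak approximation and the fundamental inequality\<close>

context ext_valuation begin

lemma of_nat_p_nonzero: "of_nat p \<noteq> (0 :: complex)"
  using p_pos by simp

lemma v_powi: "x \<in> K \<Longrightarrow> x \<noteq> 0 \<Longrightarrow> v (x powi n) = real_of_int n * v x"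
  by (simp add: power_int_def v_power v_inverse)

lemma one_plus_nonzero_pos:
  assumes "y \<in> K" "y \<noteq> 0" "v y > 0"
  shows "1 + y \<noteq> 0" "v (1 + y) = 0"
proof -
  have "w (1 + y) = w 1"
    using assms by (intro w_add_eq) (auto simp: w_eq_v)
  thus "1 + y \<noteq> 0" "v (1 + y) = 0" by (auto simp: v_def)
qed

lemma one_plus_nonzero_neg:
  assumes "y \<in> K" "y \<noteq> 0" "v y < 0"
  shows "1 + y \<noteq> 0" "v (1 + y) = v y"
proof -
  have "w (y + 1) = w y"
    using assms by (intro w_add_eq) (auto simp: w_eq_v)
  hence *: "w (1 + y) = w y" by (simp add: add.commute)
  thus "v (1 + y) = v y" by (simp add: v_def)
  show "1 + y \<noteq> 0" using * w_eq_v[of y] assms by auto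
qed

end

section \<open>Separation of valuations and simultaneous approximation\<close>

abbreviation rv :: "(complex \<Rightarrow> ereal) \<Rightarrow> complex \<Rightarrow> real" where "rv \<equiv> ext_valuation.v"

locale prime_subfield = complex_subfield +
  fixes p :: nat
  assumes prime_p': "Factorial_Ring.prime p"
begin

lemma ext_val: "w \<in> valuations_extending p K \<Longrightarrow> ext_valuation K p w"
  by unfold_locales (use prime_p' in auto)

text \<open>A rational a/k between the two values of x turns into the element x^k / p^a, of value k
  v(x) - a. The common normalization v(p) = 1 makes the same fraction serve both valuations.\<close>

lemma separating_aux:
  assumes w: "w \<in> valuations_extending p K" and u: "u \<in> valuations_extending p K"
    and x: "x \<in> K" "x \<noteq> 0" "rv w x < rv u x"
  shows "\<exists>y\<in>K. y \<noteq> 0 \<and> rv w y < 0 \<and> rv u y > 0"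
proof -
  interpret w: ext_valuation K p w by (rule ext_val[OF w])
  interpret u: ext_valuation K p u by (rule ext_val[OF u])
  obtain q where q: "rv w x < of_rat q" "of_rat q < rv u x"
    using of_rat_dense[OF x(3)] by blast
  obtain a k where ak: "q = Rat.Fract a k" "k > 0" by (cases q) auto
  have q': "(of_rat q :: real) = of_int a / of_int k"
    using ak by (simp add: of_rat_rat)
  have pn: "of_nat p powi a \<noteq> (0 :: complex)" using w.of_nat_p_nonzero by simp
  define y where "y = x powi k / of_nat p powi a"
  have y: "y \<in> K" "y \<noteq> 0" using x pn by (auto simp: y_def)
  have "rv w y = k * rv w x - a"
    using x pn w.of_nat_p_nonzero unfolding y_def by (simp add: w.v_divide w.v_powi)
  moreover have "rv u y = k * rv u x - a"
    using x pn u.of_nat_p_nonzero unfolding y_def by (simp add: u.v_divide u.v_powi)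
  ultimately have "rv w y < 0" "rv u y > 0"
    using q ak(2) unfolding q' by (auto simp: field_simps)
  with y show ?thesis by blast
qed

text \<open>Both functions are \<open>undefined\<close> outside K, so they differ at some x in K; if
  w takes the larger value there, the inverse of x takes its place.\<close>

lemma separating:
  assumes w: "w \<in> valuations_extending p K" and u: "u \<in> valuations_extending p K" and "w \<noteq> u"
  shows "\<exists>y\<in>K. y \<noteq> 0 \<and> rv w y < 0 \<and> rv u y > 0"
proof -
  interpret w: ext_valuation K p w by (rule ext_val[OF w])
  interpret u: ext_valuation K p u by (rule ext_val[OF u])
  have "w \<in> extensional K" "u \<in> extensional K"
    using w u by (auto simp: valuations_extending_def valuations_on_def)
  then obtain x where x: "x \<in> K" "w x \<noteq> u x" using \<open>w \<noteq> u\<close> extensionalityI by blast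
  hence x0: "x \<noteq> 0" by auto
  have ne: "rv w x \<noteq> rv u x" using x x0 w.w_eq_v u.w_eq_v by auto
  show ?thesis
  proof (cases "rv w x < rv u x")
    case True
    thus ?thesis using separating_aux[OF w u x(1) x0] by blast
  next
    case False
    hence "rv w (inverse x) < rv u (inverse x)"
      using ne x x0 by (simp add: w.v_inverse u.v_inverse)
    thus ?thesis using separating_aux[OF w u, of "inverse x"] x x0 by simp
  qed
qed

lemma eventually_all_positive:
  fixes a b :: "'b \<Rightarrow> real"
  assumes "finite U" "\<And>u. u \<in> U \<Longrightarrow> a u > 0"
  shows "\<exists>k>0. \<forall>u\<in>U. real k * a u > b u"
proof -
  have "eventually (\<lambda>k. real k * a u > b u) sequentially" if u: "u \<in> U" for u
  proof -
    obtain n where "real n * a u > b u" using reals_Archimedean3 assms(2)[OF u] by blast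
    hence "\<forall>k\<ge>n. real k * a u > b u"
      using assms(2)[OF u] by (auto intro: less_le_trans mult_right_mono)
    thus ?thesis unfolding eventually_sequentially by blast
  qed
  hence "eventually (\<lambda>k. \<forall>u\<in>U. real k * a u > b u) sequentially"
    using assms(1) by (simp add: eventually_ball_finite)
  hence "eventually (\<lambda>k. k > 0 \<and> (\<forall>u\<in>U. real k * a u > b u)) sequentially"
    by (intro eventually_conj eventually_gt_at_top)
  thus ?thesis using eventually_happens'[OF sequentially_bot] by blast
qed

text \<open>Induction as in the Artin-Whaples approximation theorem: y separates w from U, and z
  separates w from u. According to the sign of the value of y at u, the new element is y itself, y^k
  z, or z times a factor that is neutral at w and u.\<close>

lemma separating_finite:
  assumes w: "w \<in> valuations_extending p K"
    and "finite U" "U \<subseteq> valuations_extending p K" "w \<notin> U"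
  shows "\<exists>y\<in>K. y \<noteq> 0 \<and> rv w y < 0 \<and> (\<forall>u\<in>U. rv u y > 0)"
  using assms(2-)
proof (induction U rule: finite_induct)
  case empty
  interpret w: ext_valuation K p w by (rule ext_val[OF w])
  have "rv w (inverse (of_nat p)) = -1" using w.of_nat_p_nonzero by (simp add: w.v_inverse)
  thus ?case using w.of_nat_p_nonzero
    by (intro bexI[of _ "inverse (of_nat p)"]) auto
next
  case (insert u U)
  interpret w: ext_valuation K p w by (rule ext_val[OF w])
  interpret u: ext_valuation K p u by (rule ext_val) (use insert in auto)
  have ext: "ext_valuation K p t" if "t \<in> U" for t
    by (rule ext_val) (use insert that in auto)
  obtain y where y: "y \<in> K" "y \<noteq> 0" "rv w y < 0" "\<And>t. t \<in> U \<Longrightarrow> rv t y > 0"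
    using insert by auto
  obtain z where z: "z \<in> K" "z \<noteq> 0" "rv w z < 0" "rv u z > 0"
    using separating[OF w u.w_ext] insert by auto
  obtain k where k: "k > 0" "\<And>t. t \<in> U \<Longrightarrow> real k * rv t y > - rv t z"
    using eventually_all_positive[OF \<open>finite U\<close>, of "\<lambda>t. rv t y" "\<lambda>t. - rv t z"] y(4) by auto
  have yk: "y ^ k \<in> K" "y ^ k \<noteq> 0" using y by auto
  consider "rv u y > 0" | "rv u y = 0" | "rv u y < 0" by linarith
  thus ?case
  proof cases
    case 1
    thus ?thesis using y by (intro bexI[of _ y]) auto
  next
    case 2
    have "rv t (y ^ k * z) = real k * rv t y + rv t z" if "ext_valuation K p t" for t
      using yk y z by (simp add: ext_valuation.v_mult[OF that] ext_valuation.v_power[OF that])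
    note * = this[OF w.ext_valuation_axioms] this[OF u.ext_valuation_axioms] this[OF ext]
    have "real k * rv w y < 0" using k(1) y(3) by (simp add: mult_pos_neg)
    hence "rv w (y ^ k * z) < 0" using z * by simp
    moreover have "rv t (y ^ k * z) > 0" if "t \<in> insert u U" for t
      using that * 2 z k(2)[of t] by auto
    ultimately show ?thesis using yk z by (intro bexI[of _ "y ^ k * z"]) auto
  next
    case 3
    \<comment> \<open>Where y has negative value, in particular at w and u, the quotient y^k / (1 +
      y^k) has value 0, so x has the value of z there. On U its value is k v(y), which outweighs a
      negative value of z by the choice of k.\<close>
    define x where "x = y ^ k / (1 + y ^ k) * z"
    have vk: "rv t (y ^ k) = real k * rv t y" if "ext_valuation K p t" for t
      using y by (simp add: ext_valuation.v_power[OF that])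
    have neg: "rv t x = rv t z" "1 + y ^ k \<noteq> 0" if t: "ext_valuation K p t" "rv t y < 0" for t
    proof -
      have "rv t (y ^ k) < 0" using vk[OF t(1)] t(2) k(1) by (simp add: mult_pos_neg)
      note n = ext_valuation.one_plus_nonzero_neg[OF t(1) yk this]
      show "1 + y ^ k \<noteq> 0" by (fact n)
      show "rv t x = rv t z"
        using n yk z unfolding x_def
        by (simp add: ext_valuation.v_mult[OF t(1)] ext_valuation.v_divide[OF t(1)])
    qed
    have pos: "rv t x > 0" if t: "t \<in> U" for t
    proof -
      have "rv t (y ^ k) > 0" using vk[OF ext[OF t]] y(4)[OF t] k(1) by simp
      note n = ext_valuation.one_plus_nonzero_pos[OF ext[OF t] yk this]
      show ?thesis
        using n yk z k(2)[OF t] unfolding x_def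
        by (simp add: ext_valuation.v_mult[OF ext[OF t]] ext_valuation.v_divide[OF ext[OF t]]
              vk[OF ext[OF t]])
    qed
    have "1 + y ^ k \<noteq> 0" using neg(2)[OF u.ext_valuation_axioms 3] .
    hence "x \<in> K" "x \<noteq> 0" using yk z by (auto simp: x_def)
    moreover have "rv w x < 0" using neg(1)[OF w.ext_valuation_axioms y(3)] z by simp
    moreover have "rv u x > 0" using neg(1)[OF u.ext_valuation_axioms 3] z by simp
    ultimately show ?thesis using pos by (intro bexI[of _ x]) auto
  qed
qed

text \<open>For large k, y^k / (1 + y^k) is close to 1 where y has negative value and close to 0
  where y has positive value.\<close>

lemma approximate_idempotent:
  assumes T: "finite T" "T \<subseteq> valuations_extending p K" and w: "w \<in> T"
  shows "\<exists>y\<in>K. w (y - 1) \<ge> ereal N \<and> (\<forall>u\<in>T - {w}. u y \<ge> ereal N)"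
proof -
  have w': "w \<in> valuations_extending p K" using T w by blast
  interpret w: ext_valuation K p w by (rule ext_val[OF w'])
  have ext: "ext_valuation K p t" if "t \<in> T" for t
    by (rule ext_val) (use T that in auto)
  obtain y where y: "y \<in> K" "y \<noteq> 0" "rv w y < 0" "\<And>u. u \<in> T - {w} \<Longrightarrow> rv u y > 0"
    using separating_finite[OF w', of "T - {w}"] T by auto
  \<comment> \<open>The sign changes at w because x - 1 = -1/(1 + y^k) is the small quantity there,
    with value -k v(y).\<close>
  define a where "a u = (if u = w then - rv w y else rv u y)" for u
  obtain k where k: "k > 0" "\<And>u. u \<in> T \<Longrightarrow> real k * a u > N"
  proof -
    have "a u > 0" if "u \<in> T" for u using y that by (auto simp: a_def)
    thus ?thesis using that eventually_all_positive[OF T(1), of a "\<lambda>_. N"] by blast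
  qed
  have yk: "y ^ k \<in> K" "y ^ k \<noteq> 0" using y by auto
  define x where "x = y ^ k / (1 + y ^ k)"
  have "rv w (y ^ k) < 0" using y k(1) by (simp add: w.v_power mult_pos_neg)
  note n = w.one_plus_nonzero_neg[OF yk this]
  have x: "x \<in> K" "x \<noteq> 0" using yk n by (auto simp: x_def)
  have "x - 1 = - inverse (1 + y ^ k)" using n by (simp add: x_def field_simps)
  hence "w (x - 1) = w (inverse (1 + y ^ k))" using yk by (simp add: w.w_uminus)
  also have "\<dots> = ereal (real k * a w)" 
    using n yk y by (simp add: w.w_eq_v w.v_inverse w.v_power a_def)
  finally have "w (x - 1) \<ge> ereal N" using k(2)[OF w] by simp
  moreover have "u x \<ge> ereal N" if u: "u \<in> T - {w}" for u
  proof -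
    interpret u: ext_valuation K p u using ext u by auto
    have vk: "rv u (y ^ k) = real k * a u" using y u by (auto simp: u.v_power a_def)
    hence "rv u (y ^ k) > 0" using y(4)[OF u] k(1) u by (simp add: a_def)
    note n = u.one_plus_nonzero_pos[OF yk this]
    have "u x = ereal (real k * a u)" using x n yk vk by (simp add: u.w_eq_v x_def u.v_divide)
    thus ?thesis using k(2)[of u] u by simp
  qed
  ultimately show ?thesis using x by blast
qed

end

definition rank_le :: "complex set \<Rightarrow> nat \<Rightarrow> bool" where
  "rank_le K n \<longleftrightarrow> (\<forall>x::nat \<Rightarrow> complex. (\<forall>i\<le>n. x i \<in> K) \<longrightarrow>
     (\<exists>c::nat \<Rightarrow> int. (\<exists>i\<le>n. c i \<noteq> 0) \<and> (\<Sum>i\<le>n. of_int (c i) * x i) = 0))"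

text \<open>A scaled form of linear independence over the valued field \<open>\<rat>\<close>; denominators and common powers
  of \<open>p\<close> are cleared from the coefficients.\<close>

definition free_family :: "nat \<Rightarrow> (complex \<Rightarrow> ereal) \<Rightarrow> 'i set \<Rightarrow> ('i \<Rightarrow> complex) \<Rightarrow> bool" where
  "free_family p w I z \<longleftrightarrow> (\<exists>B::real. \<forall>c::'i \<Rightarrow> int.
     (\<exists>k\<in>I. \<not> int p dvd c k) \<longrightarrow> w (\<Sum>k\<in>I. of_int (c k) * z k) \<le> ereal B)"

lemma rank_le_dependent:
  assumes K: "rank_le K n" and J: "finite J" "n < card J" and z: "\<And>j. j \<in> J \<Longrightarrow> z j \<in> K"
  shows "\<exists>c::'j \<Rightarrow> int. (\<exists>j\<in>J. c j \<noteq> 0) \<and> (\<Sum>j\<in>J. of_int (c j) * z j) = 0"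
proof -
  obtain J' where J': "J' \<subseteq> J" "card J' = Suc n" "finite J'"
    using obtain_subset_with_card_n[of "Suc n" J] J by auto
  obtain h where h: "bij_betw h {..n} J'"
    using J' by (metis bij_betw_iff_card card_atMost finite_atMost)
  have "\<forall>i\<le>n. z (h i) \<in> K" using h J'(1) z by (auto simp: bij_betw_def)
  then obtain c :: "nat \<Rightarrow> int"
    where c: "\<exists>i\<le>n. c i \<noteq> 0" "(\<Sum>i\<le>n. of_int (c i) * z (h i)) = 0"
    using K unfolding rank_le_def by metis
  define g where "g j = (if j \<in> J' then c (inv_into {..n} h j) else 0)" for j
  have g: "g (h i) = c i" if "i \<le> n" for i
    using that h by (auto simp: g_def bij_betw_def inv_into_f_f)
  have "(\<Sum>j\<in>J. of_int (g j) * z j) = (\<Sum>j\<in>J'. of_int (g j) * z j)"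
    using J J' by (intro sum.mono_neutral_right) (auto simp: g_def)
  also have "\<dots> = (\<Sum>i\<le>n. of_int (g (h i)) * z (h i))"
    using h by (subst sum.reindex_bij_betw[OF h, symmetric]) simp
  also have "\<dots> = 0" using c(2) g by simp
  finally have "(\<Sum>j\<in>J. of_int (g j) * z j) = 0" .
  moreover have "\<exists>j\<in>J. g j \<noteq> 0"
  proof -
    obtain i where i: "i \<le> n" "c i \<noteq> 0" using c(1) by blast
    hence "h i \<in> J" using bij_betwE[OF h] J'(1) by blast
    thus ?thesis using g[OF i(1)] i(2) by metis
  qed
  ultimately show ?thesis by blast
qed

text \<open>The exponent is the least multiplicity of p among the nonzero coefficients. Afterwards a
  coefficient prime to p occurs, which is the situation that \<open>free_family\<close> speaks
  of.\<close>

lemma factor_out_prime_power: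
  fixes c :: "'j \<Rightarrow> int"
  assumes p: "Factorial_Ring.prime (p::nat)" and c: "\<exists>j\<in>J. c j \<noteq> 0"
  shows "\<exists>\<mu> c'. (\<forall>j\<in>J. c j = int p ^ \<mu> * c' j) \<and> (\<exists>j\<in>J. \<not> int p dvd c' j)"
proof -
  let ?P = "\<lambda>m. \<exists>j\<in>J. c j \<noteq> 0 \<and> m = multiplicity (int p) (c j)"
  define \<mu> where "\<mu> = (LEAST m. ?P m)"
  have "\<exists>m. ?P m" using c by blast
  hence "?P \<mu>" unfolding \<mu>_def by (rule LeastI_ex)
  then obtain j where j: "j \<in> J" "c j \<noteq> 0" "\<mu> = multiplicity (int p) (c j)" by blast
  have dvd: "int p ^ \<mu> dvd c i" if "i \<in> J" for i
  proof (cases "c i = 0")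
    case False
    hence "\<mu> \<le> multiplicity (int p) (c i)" unfolding \<mu>_def using that by (intro Least_le) blast
    thus ?thesis by (rule multiplicity_dvd')
  qed auto
  define c' where "c' i = c i div int p ^ \<mu>" for i
  have eq: "\<forall>i\<in>J. c i = int p ^ \<mu> * c' i" using dvd by (simp add: c'_def)
  moreover have "\<not> int p dvd c' j"
  proof -
    have "\<not> is_unit (int p)" using p by (auto dest: prime_gt_1_nat)
    thus ?thesis using multiplicity_decompose[of "c j" "int p"] j by (simp add: c'_def)
  qed
  ultimately show ?thesis using j(1) by blast
qed

context prime_subfield
begin

text \<open>By approximation, the family of each \<open>w\<close> may be assumed to be \<open>w'\<close>-adically small for the other \<open>w'\<close>,
  so that a relation between all families would contradict the bound for one of them.\<close>

lemma sum_card_free_families_le: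
  assumes rank: "rank_le K n"
    and T: "finite T" "T \<subseteq> valuations_extending p K"
    and I: "\<And>w. w \<in> T \<Longrightarrow> finite (I w)"
    and z: "\<And>w k. w \<in> T \<Longrightarrow> k \<in> I w \<Longrightarrow> z w k \<in> K"
    and free: "\<And>w. w \<in> T \<Longrightarrow> free_family p w (I w) (z w)"
  shows "(\<Sum>w\<in>T. card (I w)) \<le> n"
proof (rule ccontr)
  assume "\<not> (\<Sum>w\<in>T. card (I w)) \<le> n"
  define J where "J = Sigma T I"
  have J: "finite J" "n < card J"
    using T I \<open>\<not> (\<Sum>w\<in>T. card (I w)) \<le> n\<close> by (auto simp: J_def)
  have ext: "ext_valuation K p w" if "w \<in> T" for w
    by (rule ext_val) (use T that in auto)
  have "\<forall>w\<in>T. \<exists>B::real. \<forall>c. (\<exists>k\<in>I w. \<not> int p dvd c k) \<longrightarrow>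
      w (\<Sum>k\<in>I w. of_int (c k) * z w k) \<le> ereal B"
    using free unfolding free_family_def by blast
  from bchoice[OF this] obtain B where B: "\<And>w c. w \<in> T \<Longrightarrow> \<exists>k\<in>I w. \<not> int p dvd c k \<Longrightarrow>
      w (\<Sum>k\<in>I w. of_int (c k) * z w k) \<le> ereal (B w)"
    by blast
  \<comment> \<open>N exceeds the bounds of all families, while M, defined next, limits the value
    lost when an error term is multiplied by a family member; approximation up to N + M therefore
    leaves errors of value at least N.\<close>
  define N where "N = 1 + (\<Sum>w\<in>T. \<bar>B w\<bar>)"
  have N: "B w < N" if "w \<in> T" for w
    using member_le_sum[of w T "\<lambda>w. \<bar>B w\<bar>"] that T(1) unfolding N_def by auto
  define M where "M = (\<Sum>u\<in>T. \<Sum>j\<in>J. \<bar>rv u (z (fst j) (snd j))\<bar>)"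
  have M: "ereal (- M) \<le> u (z w k)" if u: "u \<in> T" and wk: "w \<in> T" "k \<in> I w" for u w k
  proof (cases "z w k = 0")
    case True
    thus ?thesis using ext_valuation.w_0[OF ext[OF u]] by simp
  next
    case False
    have "\<bar>rv u (z w k)\<bar> \<le> (\<Sum>j\<in>J. \<bar>rv u (z (fst j) (snd j))\<bar>)"
      using member_le_sum[of "(w,k)" J "\<lambda>j. \<bar>rv u (z (fst j) (snd j))\<bar>"] J(1) wk
      by (auto simp: J_def)
    also have "\<dots> \<le> M" unfolding M_def
      using member_le_sum[of u T "\<lambda>u. \<Sum>j\<in>J. \<bar>rv u (z (fst j) (snd j))\<bar>"] T(1) u
      by (auto intro: sum_nonneg)
    finally show ?thesis using ext_valuation.w_eq_v[OF ext[OF u] z[OF wk] False] by simp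
  qed
  obtain \<eta> where \<eta>: "\<And>w. w \<in> T \<Longrightarrow> \<eta> w \<in> K" "\<And>w. w \<in> T \<Longrightarrow> w (\<eta> w - 1) \<ge> ereal (N + M)"
      "\<And>w u. w \<in> T \<Longrightarrow> u \<in> T \<Longrightarrow> u \<noteq> w \<Longrightarrow> u (\<eta> w) \<ge> ereal (N + M)"
  proof -
    have "\<forall>w\<in>T. \<exists>y\<in>K. ereal (N + M) \<le> w (y - 1) \<and> (\<forall>u\<in>T - {w}. ereal (N + M) \<le> u y)"
      using approximate_idempotent[OF T] by blast
    from bchoice[OF this[unfolded Bex_def]] show ?thesis using that by blast
  qed
  define y where "y j = \<eta> (fst j) * z (fst j) (snd j)" for j
  have y: "y j \<in> K" if "j \<in> J" for j
    using that \<eta>(1) z by (auto simp: y_def J_def)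
  obtain c0 :: "_ \<Rightarrow> int" where c0: "\<exists>j\<in>J. c0 j \<noteq> 0" "(\<Sum>j\<in>J. of_int (c0 j) * y j) = 0"
    using rank_le_dependent[OF rank J, of y] y by blast
  obtain \<mu> c where c: "\<And>j. j \<in> J \<Longrightarrow> c0 j = int p ^ \<mu> * c j" "\<exists>j\<in>J. \<not> int p dvd c j"
    using factor_out_prime_power[OF prime_p' c0(1)] by blast
  have "of_nat p ^ \<mu> * (\<Sum>j\<in>J. of_int (c j) * y j) = (\<Sum>j\<in>J. of_int (c0 j) * y j)"
    by (simp add: sum_distrib_left c(1) mult.assoc)
  hence sum0: "(\<Sum>j\<in>J. of_int (c j) * y j) = 0"
    using c0(2) prime_gt_0_nat[OF prime_p'] by simp
  obtain w k where wk: "w \<in> T" "k \<in> I w" "\<not> int p dvd c (w, k)"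
    using c(2) by (auto simp: J_def)
  interpret w: ext_valuation K p w by (rule ext[OF wk(1)])
  \<comment> \<open>The terms with the idempotents replaced by their limits at w, namely 1 on the
    family of w and 0 on the others. Termwise the change has value at least N, but what remains is a
    combination of the family of w alone, of value at most B(w) < N.\<close>
  define d where "d j = (if fst j = w then z (fst j) (snd j) else 0)" for j
  have dK: "d j \<in> K" if "j \<in> J" for j using that z by (auto simp: d_def J_def)
  have "ereal N \<le> w (d j - y j)" if j: "j \<in> J" for j
  proof -
    obtain u l where ul: "j = (u, l)" "u \<in> T" "l \<in> I u" using j by (auto simp: J_def)
    have "\<exists>x\<in>K. d j - y j = - (x * z u l) \<and> ereal (N + M) \<le> w x"
    proof (cases "u = w")
      case True
      thus ?thesis using \<eta>(1,2)[OF ul(2)]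
        by (intro bexI[of _ "\<eta> u - 1"]) (auto simp: d_def y_def ul(1) algebra_simps)
    next
      case False
      thus ?thesis using \<eta>(1)[OF ul(2)] \<eta>(3)[OF ul(2) wk(1)]
        by (intro bexI[of _ "\<eta> u"]) (auto simp: d_def y_def ul(1))
    qed
    then obtain x where x: "x \<in> K" "d j - y j = - (x * z u l)" "ereal (N + M) \<le> w x" by blast
    have "ereal (N + M) + ereal (- M) \<le> w x + w (z u l)"
      using x(3) M[OF wk(1) ul(2,3)] by (rule add_mono)
    thus ?thesis using x z[OF ul(2,3)] by (simp add: w.w_uminus w.w_mult)
  qed
  hence "ereal N \<le> w (of_int (c j) * (d j - y j))" if "j \<in> J" for j
    using dK[OF that] y[OF that] add_mono[OF w.w_of_int_nonneg[of "c j"], of "ereal N" "w (d j - y j)"] that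
    by (simp add: w.w_mult)
  hence "ereal N \<le> w (\<Sum>j\<in>J. of_int (c j) * (d j - y j))"
    using dK y by (intro w.w_sum_ge) simp_all
  also have "(\<Sum>j\<in>J. of_int (c j) * (d j - y j)) = (\<Sum>j\<in>J. of_int (c j) * d j)"
    using sum0 by (simp add: algebra_simps sum_subtractf)
  also have "\<dots> = (\<Sum>j\<in>{w} \<times> I w. of_int (c j) * d j)"
    using J(1) wk(1) by (intro sum.mono_neutral_right) (auto simp: J_def d_def)
  also have "\<dots> = (\<Sum>l\<in>I w. of_int (c (w, l)) * z w l)"
    by (rule sum.reindex_bij_witness[of _ "Pair w" snd]) (auto simp: d_def)
  also have "w \<dots> \<le> ereal (B w)" using B[OF wk(1), of "\<lambda>l. c (w, l)"] wk by blast
  finally show False using N[OF wk(1)] by simp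
qed

end

section \<open>From valuation rings to valuations\<close>

text \<open>For divisibility in a valuation ring, a total preorder without antisymmetry.\<close>

lemma finite_total_preorder_min:
  assumes "finite S" "S \<noteq> {}"
    and total: "\<And>a b. a \<in> S \<Longrightarrow> b \<in> S \<Longrightarrow> R a b \<or> R b a"
    and trans: "\<And>a b c. a \<in> S \<Longrightarrow> b \<in> S \<Longrightarrow> c \<in> S \<Longrightarrow> R a b \<Longrightarrow> R b c \<Longrightarrow> R a c"
  shows "\<exists>m\<in>S. \<forall>a\<in>S. R m a"
  using assms(1,2) total trans
proof (induction S rule: finite_ne_induct)
  case (singleton x)
  thus ?case by blast
next
  case (insert x S)
  have "\<exists>m\<in>S. \<forall>a\<in>S. R m a"
    by (rule insert.IH) (use insert.prems in blast)+
  then obtain m where m: "m \<in> S" "\<And>a. a \<in> S \<Longrightarrow> R m a" by blast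
  have xx: "R x x" using insert.prems(1) by blast
  show ?case
  proof (cases "R m x")
    case True
    thus ?thesis using m by blast
  next
    case False
    hence xm: "R x m" using insert.prems(1) m(1) by blast
    have "R x a" if "a \<in> S" for a
      using insert.prems(2)[of x m a] xm m that by blast
    thus ?thesis using xx by blast
  qed
qed

text \<open>A valuation ring of K over the localization of the integers at p. The rank bound makes
  each element of K algebraic over \<rat>, so that modulo units some positive power of a nonzero
  element is a power of p; this is why the values can be taken rational.\<close>

locale valuation_subring = prime_subfield K p + V: complex_subring V
  for K V :: "complex set" and p :: nat +
  fixes n :: nat
  assumes V_subset: "V \<subseteq> K"
    and V_total: "\<And>x. x \<in> K \<Longrightarrow> x \<in> V \<or> inverse x \<in> V"
    and inverse_of_int_mem: "\<And>c. \<not> int p dvd c \<Longrightarrow> inverse (of_int c) \<in> V"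
    and inverse_p_not_mem: "inverse (of_nat p) \<notin> V"
    and rank: "rank_le K n"
begin

lemma p_nonzero: "of_nat p \<noteq> (0::complex)"
  using prime_gt_0_nat[OF prime_p'] by simp

definition U :: "complex set" where "U = {x \<in> V. x \<noteq> 0 \<and> inverse x \<in> V}"

lemma U_mult: "x \<in> U \<Longrightarrow> y \<in> U \<Longrightarrow> x * y \<in> U"
  by (auto simp: U_def)

lemma U_inverse: "x \<in> U \<Longrightarrow> inverse x \<in> U"
  by (auto simp: U_def)

lemma U_one: "1 \<in> U"
  by (auto simp: U_def)

lemma U_powi: "x \<in> U \<Longrightarrow> x powi m \<in> U"
proof -
  assume x: "x \<in> U"
  have "x ^ k \<in> U" for k by (induction k) (auto simp: U_one intro: U_mult x)
  thus ?thesis by (auto simp: power_int_def power_inverse intro: U_inverse)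
qed

lemma U_dvd: "x \<in> V \<Longrightarrow> y \<in> V \<Longrightarrow> x * y \<in> U \<Longrightarrow> x \<in> U"
proof -
  assume *: "x \<in> V" "y \<in> V" "x * y \<in> U"
  hence "x \<noteq> 0" "y \<noteq> 0" by (auto simp: U_def)
  hence "inverse x = inverse (x * y) * y" by simp
  also have "\<dots> \<in> V" using * by (intro V.mult_mem) (auto simp: U_def)
  finally show ?thesis using * \<open>x \<noteq> 0\<close> by (simp add: U_def)
qed

text \<open>V is local: if a/b lies in V, then a + b = b (1 + a/b) is a multiple of the nonunit b.
  Totality provides such an order of the two summands.\<close>

lemma nonunit_add:
  assumes "x \<in> V" "y \<in> V" "x \<notin> U" "y \<notin> U"
  shows "x + y \<notin> U"
proof -
  have *: "a + b \<notin> U" if ab: "a \<in> V" "b \<in> V" "a \<notin> U" "b \<notin> U" "b \<noteq> 0" "a / b \<in> V" for a b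
  proof
    assume "a + b \<in> U"
    hence "b * (1 + a / b) \<in> U" using ab by (simp add: field_simps)
    thus False using U_dvd[of b "1 + a / b"] ab by simp
  qed
  show ?thesis
  proof (cases "x = 0 \<or> y = 0")
    case False
    have "x \<in> K" "y \<in> K" using assms V_subset by auto
    hence "x / y \<in> V \<or> y / x \<in> V" using V_total[of "x / y"] by simp
    thus ?thesis using *[of x y] *[of y x] assms False by (auto simp: add.commute)
  qed (use assms in auto)
qed

lemma nonunit_sum:
  assumes "finite S" "\<And>i. i \<in> S \<Longrightarrow> f i \<in> V - U"
  shows "sum f S \<in> V - U"
  using assms
proof (induction S rule: finite_induct)
  case empty
  show ?case by (simp add: U_def)
next
  case (insert i S)
  thus ?case using nonunit_add[of "f i" "sum f S"] by simp
qed

lemma of_int_unit: "\<not> int p dvd c \<Longrightarrow> of_int c \<in> U"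
  using inverse_of_int_mem[of c] by (auto simp: U_def)

lemma p_not_unit: "of_nat p \<notin> U"
  using inverse_p_not_mem by (auto simp: U_def)

text \<open>p is not a unit and divides its positive powers, so it has infinite order modulo U and
  the normalization to value 1 is consistent.\<close>

lemma p_powi_unit: 
  assumes "of_nat p powi m \<in> U"
  shows "m = 0"
proof (rule ccontr)
  assume "m \<noteq> 0"
  have "\<bar>m\<bar> > 0" using \<open>m \<noteq> 0\<close> by simp
  then obtain k where k: "\<bar>m\<bar> = int (Suc k)" by (metis gr0_implies_Suc zero_less_imp_eq_int)
  have "of_nat p powi \<bar>m\<bar> \<in> U"
    using assms U_inverse[OF assms] by (auto simp: abs_if power_int_minus)
  hence "of_nat p * of_nat p ^ k \<in> U" using k by (simp del: of_nat_Suc)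
  hence "of_nat p \<in> U" by (rule U_dvd[rotated 2]) auto
  with p_not_unit show False by blast
qed

lemma of_int_decompose:
  assumes "c \<noteq> 0"
  shows "\<exists>u\<in>U. of_int c = of_nat p ^ multiplicity (int p) c * u"
proof -
  have nu: "\<not> is_unit (int p)" using prime_p' by (auto dest: prime_gt_1_nat)
  obtain d where d: "c = int p ^ multiplicity (int p) c * d" "\<not> int p dvd d"
    using multiplicity_decompose'[OF assms nu] by blast
  have "of_int c = (of_int (int p ^ multiplicity (int p) c * d) :: complex)"
    using d(1) by presburger
  thus ?thesis using of_int_unit[OF d(2)] by (intro bexI[of _ "of_int d"]) auto
qed

text \<open>In the value group, the quotient of the multiplicative group of K by U, the class of x^k
  equals that of p^m; then r = m/k is forced by giving p the value 1.\<close>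

definition has_val :: "complex \<Rightarrow> real \<Rightarrow> bool" where
  "has_val x r \<longleftrightarrow> (\<exists>k>0. \<exists>m. x powi k * of_nat p powi (- m) \<in> U \<and> r = of_int m / of_int k)"

lemma powi_mult_assoc: "(x powi a * of_nat p powi b) powi c = x powi (a * c) * of_nat p powi (b * c)" for x :: complex
  by (simp add: power_int_mult_distrib power_int_mult)

text \<open>Raising the two relations to the powers l and k gives the same power of x; the quotient
  is a power of p that is a unit, hence has exponent 0.\<close>

lemma has_val_unique:
  assumes "x \<noteq> 0" "has_val x r" "has_val x s"
  shows "r = s"
proof -
  obtain k m where k: "k > 0" "x powi k * of_nat p powi (- m) \<in> U" "r = of_int m / of_int k"
    using assms(2) by (auto simp: has_val_def)
  obtain l n where l: "l > 0" "x powi l * of_nat p powi (- n) \<in> U" "s = of_int n / of_int l"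
    using assms(3) by (auto simp: has_val_def)
  have "(x powi k * of_nat p powi (- m)) powi l * inverse ((x powi l * of_nat p powi (- n)) powi k) \<in> U"
    using U_mult[OF U_powi[OF k(2)] U_inverse[OF U_powi[OF l(2)]]] .
  also have "inverse ((x powi l * of_nat p powi (- n)) powi k) = (x powi l * of_nat p powi (- n)) powi (-k)"
    by (simp add: power_int_minus)
  also have "(x powi k * of_nat p powi (- m)) powi l * (x powi l * of_nat p powi (- n)) powi (-k)
      = (x powi (k * l) * x powi (l * - k)) * (of_nat p powi (- m * l) * of_nat p powi (- n * - k))"
    by (simp only: powi_mult_assoc mult_ac)
  also have "\<dots> = x powi (k * l + l * - k) * of_nat p powi (- m * l + - n * - k)"
    by (simp only: power_int_add[OF disjI1[OF assms(1)]] power_int_add[OF disjI1[OF p_nonzero]])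
  also have "\<dots> = of_nat p powi (n * k - m * l)" by simp
  finally have "n * k - m * l = 0" by (rule p_powi_unit)
  hence "of_int m * of_int l = (of_int n * of_int k :: real)" by (metis eq_iff_diff_eq_0 of_int_mult)
  thus ?thesis unfolding k(3) l(3) using k(1) l(1) by (simp add: field_simps)
qed

lemma has_val_mult:
  assumes "x \<noteq> 0" "y \<noteq> 0" "has_val x r" "has_val y s"
  shows "has_val (x * y) (r + s)"
proof -
  obtain k m where k: "k > 0" "x powi k * of_nat p powi (- m) \<in> U" "r = of_int m / of_int k"
    using assms(3) by (auto simp: has_val_def)
  obtain l n where l: "l > 0" "y powi l * of_nat p powi (- n) \<in> U" "s = of_int n / of_int l"
    using assms(4) by (auto simp: has_val_def)
  have "(x powi k * of_nat p powi (- m)) powi l * (y powi l * of_nat p powi (- n)) powi k \<in> U"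
    using U_mult[OF U_powi[OF k(2)] U_powi[OF l(2)]] .
  also have "(x powi k * of_nat p powi (- m)) powi l * (y powi l * of_nat p powi (- n)) powi k
      = (x powi (k * l) * y powi (k * l)) * (of_nat p powi (- m * l) * of_nat p powi (- n * k))"
    by (simp only: powi_mult_assoc mult_ac)
  also have "\<dots> = (x * y) powi (k * l) * of_nat p powi (- m * l + - n * k)"
    by (simp only: power_int_add[OF disjI1[OF p_nonzero]] power_int_mult_distrib)
  also have "- m * l + - n * k = - (m * l + n * k)" by simp
  finally have "(x * y) powi (k * l) * of_nat p powi (- (m * l + n * k)) \<in> U" .
  moreover have "r + s = of_int (m * l + n * k) / of_int (k * l)"
    using k l by (simp add: field_simps)
  moreover have "k * l > 0" using k l by simp
  ultimately show ?thesis unfolding has_val_def by blast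
qed

lemma has_val_unit: "x \<in> U \<Longrightarrow> has_val x 0"
  unfolding has_val_def by (intro exI[of _ 1] conjI exI[of _ 0]) auto

lemma has_val_p: "has_val (of_nat p) 1"
  unfolding has_val_def using p_nonzero
  by (intro exI[of _ 1] conjI exI[of _ 1]) (auto simp: U_one power_int_minus)

text \<open>For m \<ge> 0 the power x^k lies in V; if x did not, 1/x would, and x = x^k (1/x)^(k-1)
  is in V after all. Conversely, x in V with m < 0 would make p a divisor of a unit.\<close>

lemma has_val_nonneg_iff:
  assumes x: "x \<in> K" "x \<noteq> 0" "has_val x r"
  shows "0 \<le> r \<longleftrightarrow> x \<in> V"
proof -
  obtain k m where k: "k > 0" "x powi k * of_nat p powi (- m) \<in> U" "r = of_int m / of_int k"
    using assms(3) by (auto simp: has_val_def)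
  have r: "0 \<le> r \<longleftrightarrow> 0 \<le> m" unfolding k(3) using k(1) by (simp add: zero_le_divide_iff)
  obtain k' where k': "k = int (Suc k')" using k(1) by (intro that[of "nat (k - 1)"]) simp
  have unit: "x ^ Suc k' * of_nat p powi (- m) \<in> U" using k(2) unfolding k' by (simp only: power_int_of_nat)
  show ?thesis
  proof
    assume "0 \<le> r"
    hence m: "m = int (nat m)" using r by simp
    have "x ^ Suc k' = (x ^ Suc k' * of_nat p powi (- m)) * of_nat p ^ nat m"
      using p_nonzero by (subst m) (simp only: power_int_minus power_int_of_nat, simp)
    also have "\<dots> \<in> V" 
    proof (rule V.mult_mem)
      show "x ^ Suc k' * of_nat p powi (- m) \<in> V" using unit unfolding U_def by blast
    qed simp
    finally have xk: "x ^ Suc k' \<in> V" .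
    show "x \<in> V"
    proof (cases "x \<in> V")
      case False
      hence "inverse x \<in> V" using V_total x by blast
      hence "x ^ Suc k' * inverse x ^ k' \<in> V" by (rule V.mult_mem[OF xk V.power_mem])
      also have "x ^ Suc k' * inverse x ^ k' = x * (x * inverse x) ^ k'"
        by (simp only: power_Suc power_mult_distrib mult_ac)
      also have "\<dots> = x" using x by simp
      finally show ?thesis .
    qed
  next
    assume xV: "x \<in> V"
    show "0 \<le> r"
    proof (rule ccontr)
      assume "\<not> 0 \<le> r"
      hence "- m = int (Suc (nat (- m - 1)))" using r by simp
      then obtain j where j: "- m = int (Suc j)" by blast
      have "of_nat p * (x ^ Suc k' * of_nat p ^ j) \<in> U"
        using unit unfolding j by (simp only: power_int_of_nat) (simp add: mult_ac)
      moreover have "x ^ Suc k' * of_nat p ^ j \<in> V"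
        using xV by (intro V.mult_mem V.power_mem) simp_all
      ultimately have "of_nat p \<in> U" using U_dvd[of "of_nat p"] V.of_nat_mem by blast
      with p_not_unit show False by blast
    qed
  qed
qed

text \<open>In an algebraic equation for \<open>x\<close> over \<open>\<rat>\<close>, two terms must have the same value, because otherwise
  division by the term of least value exhibits a unit as a sum of nonunits.\<close>

lemma has_val_exists:
  assumes x: "x \<in> K" "x \<noteq> 0"
  shows "\<exists>r. has_val x r"
proof -
  obtain c :: "nat \<Rightarrow> int" where c: "\<exists>i\<le>n. c i \<noteq> 0" "(\<Sum>i\<le>n. of_int (c i) * x ^ i) = 0"
    using rank x unfolding rank_le_def by (metis power_mem)
  define S where "S = {i. i \<le> n \<and> c i \<noteq> 0}"
  define f where "f i = of_int (c i) * x ^ i" for i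
  have S: "finite S" "S \<noteq> {}" using c(1) by (auto simp: S_def)
  have f: "f i \<in> K" "i \<in> S \<Longrightarrow> f i \<noteq> 0" for i using x by (auto simp: f_def S_def)
  have "\<exists>m\<in>S. \<forall>i\<in>S. f i / f m \<in> V"
  proof (rule finite_total_preorder_min[OF S])
    fix a b assume "a \<in> S" "b \<in> S"
    have "f b / f a \<in> K" using f by simp
    from V_total[OF this] show "f b / f a \<in> V \<or> f a / f b \<in> V" by simp
  next
    fix a b d assume "a \<in> S" "b \<in> S" "d \<in> S" "f b / f a \<in> V" "f d / f b \<in> V"
    hence "(f d / f b) * (f b / f a) \<in> V" by (intro V.mult_mem)
    thus "f d / f a \<in> V" using f \<open>b \<in> S\<close> by simp
  qed
  then obtain m where m: "m \<in> S" "\<And>i. i \<in> S \<Longrightarrow> f i / f m \<in> V" by blast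
  have "sum f S = 0" using c(2) by (subst sum.mono_neutral_left[of "{..n}"]) (auto simp: S_def f_def)
  hence "f m + sum f (S - {m}) = 0" using S(1) m(1) by (simp add: sum.remove)
  hence "(\<Sum>i\<in>S - {m}. f i / f m) = - 1"
    using f(2)[OF m(1)] by (simp add: sum_divide_distrib[symmetric] field_simps add_eq_0_iff)
  moreover have "-1 \<in> U" by (simp add: U_def)
  ultimately have "\<exists>i\<in>S - {m}. f i / f m \<in> U"
    using nonunit_sum[of "S - {m}" "\<lambda>i. f i / f m"] S(1) m(2) by fastforce
  then obtain i where i: "i \<in> S" "i \<noteq> m" "f i / f m \<in> U" by blast
  obtain u where u: "u \<in> U" "of_int (c i) = of_nat p ^ multiplicity (int p) (c i) * u"
    using of_int_decompose[of "c i"] i(1) by (auto simp: S_def)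
  obtain u' where u': "u' \<in> U" "of_int (c m) = of_nat p ^ multiplicity (int p) (c m) * u'"
    using of_int_decompose[of "c m"] m(1) by (auto simp: S_def)
  \<comment> \<open>Differences of the exponents of x and of p in the two terms of equal value: x^k
    p^z is a unit with k \<noteq> 0, so the value is -z/k. \<open>has_val\<close> wants a positive
    exponent, hence the distinction by the sign of k.\<close>
  define k where "k = int i - int m"
  define z where "z = int (multiplicity (int p) (c i)) - int (multiplicity (int p) (c m))"
  have nz: "u \<noteq> 0" "u' \<noteq> 0" using u u' by (auto simp: U_def)
  have "f i / f m = x powi k * of_nat p powi z * (u * inverse u')"
    using x nz p_nonzero unfolding f_def u(2) u'(2) k_def z_def 
    by (simp add: power_int_diff field_simps)
  hence "(f i / f m) * (inverse u * u') = x powi k * of_nat p powi z * ((u * inverse u) * (u' * inverse u'))"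
    by (simp only: mult_ac)
  also have "\<dots> = x powi k * of_nat p powi z" using nz by simp
  finally have unit: "x powi k * of_nat p powi z \<in> U"
    using U_mult[OF i(3) U_mult[OF U_inverse[OF u(1)] u'(1)]] by (simp only:)
  show ?thesis
  proof (cases "k > 0")
    case True
    thus ?thesis using unit unfolding has_val_def by (intro exI[of _ "of_int (- z) / of_int k"] exI[of _ k] conjI exI[of _ "- z"]) auto
  next
    case False
    hence "- k > 0" using i(2) by (simp add: k_def)
    moreover have "x powi (- k) * of_nat p powi (- z) \<in> U"
      using U_inverse[OF unit] by (simp add: power_int_minus)
    ultimately show ?thesis unfolding has_val_def by blast
  qed
qed

definition val :: "complex \<Rightarrow> ereal" where
  "val = restrict (\<lambda>x. if x = 0 then \<infinity> else ereal (THE r. has_val x r)) K"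

lemma val_eq: "x \<in> K \<Longrightarrow> x \<noteq> 0 \<Longrightarrow> has_val x r \<Longrightarrow> val x = ereal r"
  by (auto simp: val_def intro!: the_equality has_val_unique)

lemma val_0: "val 0 = \<infinity>"
  by (simp add: val_def)

lemma has_val_of_int:
  assumes "c \<noteq> 0"
  shows "has_val (of_int c) (real (multiplicity (int p) c))"
proof -
  have pow: "has_val (of_nat p ^ k) (real k)" for k
  proof (induction k)
    case (Suc k)
    show ?case using has_val_mult[OF _ _ has_val_p Suc] p_nonzero by (simp add: add.commute)
  qed (simp add: has_val_unit U_one)
  obtain u where u: "u \<in> U" "of_int c = of_nat p ^ multiplicity (int p) c * u"
    using of_int_decompose[OF assms] by blast
  have "u \<noteq> 0" using u by (auto simp: U_def)
  from has_val_mult[OF _ this pow has_val_unit[OF u(1)]] show ?thesis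
    unfolding u(2) using p_nonzero by simp
qed

text \<open>The ultrametric inequality comes from V being closed under addition: if y/x lies in V,
  so does 1 + y/x, and x + y = x (1 + y/x). On \<rat> the value is computed from numerator and
  denominator.\<close>

lemma val_mem: "val \<in> valuations_extending p K"
proof -
  have ex: "\<exists>r. has_val x r \<and> val x = ereal r" if "x \<in> K" "x \<noteq> 0" for x
    using has_val_exists[OF that] val_eq[OF that] by blast
  have mult: "val (x * y) = val x + val y" if xy: "x \<in> K" "y \<in> K" for x y
  proof (cases "x = 0 \<or> y = 0")
    case True
    thus ?thesis using ex xy by (metis mult_zero_left mult_zero_right plus_ereal.simps(2,3) val_0)
  next
    case False
    then obtain r s where "has_val x r" "val x = ereal r" "has_val y s" "val y = ereal s"
      using ex xy by metis
    thus ?thesis using has_val_mult[of x y r s] val_eq[of "x * y" "r + s"] xy False by simp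
  qed
  have nonneg: "val x \<ge> 0 \<longleftrightarrow> x \<in> V" if "x \<in> K" "x \<noteq> 0" for x
    using ex[OF that] has_val_nonneg_iff[OF that] by auto
  have add: "val (x + y) \<ge> val x" if xy: "x \<in> K" "x \<noteq> 0" "y \<in> K" "y / x \<in> V" for x y
  proof -
    have "0 \<le> val (1 + y / x)"
      using nonneg[of "1 + y / x"] xy by (cases "1 + y / x = 0") (auto simp: val_0)
    hence "val x + 0 \<le> val x + val (1 + y / x)" by (intro add_mono) auto
    also have "\<dots> = val (x * (1 + y / x))" using xy by (intro mult[symmetric]) auto
    also have "x * (1 + y / x) = x + y" using xy by (simp add: field_simps)
    finally show ?thesis by simp
  qed
  have ultra: "val (x + y) \<ge> min (val x) (val y)" if xy: "x \<in> K" "y \<in> K" for x y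
  proof (cases "x = 0 \<or> y = 0")
    case False
    hence "y / x \<in> V \<or> x / y \<in> V" using V_total[of "y / x"] xy by auto
    thus ?thesis using add[of x y] add[of y x] xy False by (auto simp: add.commute min_le_iff_disj)
  qed (auto simp: val_0)
  have rat: "val (of_rat q) = rat_val p q" for q
  proof (cases "q = 0")
    case True
    thus ?thesis by (simp add: val_0 rat_val_def)
  next
    case False
    obtain m n where q: "quotient_of q = (m, n)" by (cases "quotient_of q")
    hence n: "n > 0" by (rule quotient_of_denom_pos)
    have q': "q = of_int m / of_int n" using q by (rule quotient_of_div)
    have m: "m \<noteq> 0" using False q' by auto
    have "val (of_int m) = ereal (multiplicity (int p) m)" "val (of_int n) = ereal (multiplicity (int p) n)"
      using m n by (auto intro!: val_eq has_val_of_int)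
    moreover have "val (of_int m) = val (of_rat q) + val (of_int n)"
      using n q' mult[of "of_rat q" "of_int n"] by (simp add: of_rat_divide)
    moreover obtain r where "val (of_rat q) = ereal r" using ex[of "of_rat q"] False by auto
    ultimately show ?thesis using False by (simp add: rat_val_def q)
  qed
  have "val x \<noteq> -\<infinity> \<and> (val x = \<infinity> \<longleftrightarrow> x = 0)" if "x \<in> K" for x
    using ex[OF that] by (cases "x = 0") (auto simp: val_0)
  moreover have "val \<in> extensional K" by (simp add: val_def)
  ultimately show ?thesis
    using mult ultra rat by (simp add: valuations_extending_def valuations_on_def)
qed

lemma val_pos:
  assumes "x \<in> K" "inverse x \<notin> V"
  shows "val x > 0"
proof (cases "x = 0")
  case False
  obtain r where r: "has_val (inverse x) r" using has_val_exists[of "inverse x"] assms(1) False by auto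
  obtain s where s: "has_val x s" using has_val_exists[OF assms(1) False] by blast
  have "r < 0" using has_val_nonneg_iff[OF _ _ r] assms False by auto
  moreover have "has_val 1 (s + r)" using has_val_mult[OF _ _ s r] False by simp
  hence "s + r = 0" using has_val_unique[OF _ _ has_val_unit[OF U_one]] by simp
  ultimately show ?thesis using val_eq[OF assms(1) False s] by simp
qed (simp add: val_0)

end

section \<open>Chevalley's extension theorem\<close>

text \<open>The ideal of A generated by s and t. Two generators are kept because both p and
  \<phi>_i(\<alpha>) have to become nonunits.\<close>

definition ideal2 :: "complex set \<Rightarrow> complex \<Rightarrow> complex \<Rightarrow> complex set" where
  "ideal2 A s t = {s * a + t * b | a b. a \<in> A \<and> b \<in> A}"

definition adjoin :: "complex set \<Rightarrow> complex \<Rightarrow> complex set" where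
  "adjoin A x = {poly q x | q. \<forall>i. Polynomial.coeff q i \<in> A}"

context complex_subring
begin

lemma ideal2_add: "x \<in> ideal2 K s t \<Longrightarrow> y \<in> ideal2 K s t \<Longrightarrow> x + y \<in> ideal2 K s t"
  unfolding ideal2_def mem_Collect_eq
proof (elim exE conjE)
  fix a b a' b' assume *: "x = s * a + t * b" "y = s * a' + t * b'" "a \<in> K" "b \<in> K" "a' \<in> K" "b' \<in> K"
  thus "\<exists>a b. x + y = s * a + t * b \<and> a \<in> K \<and> b \<in> K"
    by (intro exI[of _ "a + a'"] exI[of _ "b + b'"]) (simp add: algebra_simps)
qed

lemma ideal2_mult: "x \<in> ideal2 K s t \<Longrightarrow> y \<in> K \<Longrightarrow> y * x \<in> ideal2 K s t"
  unfolding ideal2_def mem_Collect_eq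
proof (elim exE conjE)
  fix a b assume *: "x = s * a + t * b" "a \<in> K" "b \<in> K" "y \<in> K"
  thus "\<exists>a b. y * x = s * a + t * b \<and> a \<in> K \<and> b \<in> K"
    by (intro exI[of _ "y * a"] exI[of _ "y * b"]) (simp add: algebra_simps)
qed

lemma ideal2_zero: "0 \<in> ideal2 K s t"
  unfolding ideal2_def by (intro CollectI exI[of _ 0]) simp

lemma ideal2_sum: "(\<And>i. i \<in> I \<Longrightarrow> f i \<in> ideal2 K s t) \<Longrightarrow> sum f I \<in> ideal2 K s t"
  by (induction I rule: infinite_finite_induct) (auto simp: ideal2_zero ideal2_add)

lemma ideal2_subset: "s \<in> K \<Longrightarrow> t \<in> K \<Longrightarrow> ideal2 K s t \<subseteq> K"
  by (auto simp: ideal2_def)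

lemma ideal2_generators: "s \<in> ideal2 K s t" "t \<in> ideal2 K s t"
  unfolding ideal2_def
  by (intro CollectI exI[of _ 1] exI[of _ 0], simp, intro CollectI exI[of _ 0] exI[of _ 1], simp)

lemma adjoin_subring: "complex_subring (adjoin K x)"
proof
  show "1 \<in> adjoin K x" unfolding adjoin_def
    by (intro CollectI exI[of _ 1]) (auto simp: coeff_1)
next
  fix a b assume "a \<in> adjoin K x" "b \<in> adjoin K x"
  then obtain q r where qr: "a = poly q x" "b = poly r x" "\<And>i. Polynomial.coeff q i \<in> K" "\<And>i. Polynomial.coeff r i \<in> K"
    by (auto simp: adjoin_def)
  show "a + b \<in> adjoin K x" using qr unfolding adjoin_def
    by (intro CollectI exI[of _ "q + r"]) simp
  show "- a \<in> adjoin K x" using qr unfolding adjoin_def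
    by (intro CollectI exI[of _ "- q"]) simp
  show "a * b \<in> adjoin K x" using qr unfolding adjoin_def
    by (intro CollectI exI[of _ "q * r"]) (auto simp: coeff_mult intro!: sum_mem)
qed

lemma adjoin_incl: "K \<subseteq> adjoin K x"
  unfolding adjoin_def by (intro subsetI CollectI exI[of _ "[:_:]"]) (auto simp: coeff_pCons split: nat.split)

lemma adjoin_mem: "x \<in> adjoin K x"
  unfolding adjoin_def by (intro CollectI exI[of _ "[:0, 1:]"]) (auto simp: coeff_pCons split: nat.split)

lemma adjoin_subset:
  assumes "complex_subring A" "K \<subseteq> A" "x \<in> A"
  shows "adjoin K x \<subseteq> A"
proof -
  interpret A: complex_subring A by fact
  show ?thesis using assms(2,3) unfolding adjoin_def poly_altdef
    by (auto intro!: A.sum_mem A.mult_mem A.power_mem)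
qed

text \<open>Collecting s q(x) + t r(x) by powers of x puts every coefficient into the ideal of the
  base ring, so that membership of 1 becomes an algebraic equation for x.\<close>

lemma ideal2_adjoin:
  assumes "y \<in> ideal2 (adjoin K x) s t"
  shows "\<exists>g. (\<forall>i. Polynomial.coeff g i \<in> ideal2 K s t) \<and> poly g x = y"
proof -
  obtain q r where qr: "y = s * poly q x + t * poly r x" "\<And>i. Polynomial.coeff q i \<in> K" "\<And>i. Polynomial.coeff r i \<in> K"
    using assms by (auto simp: ideal2_def adjoin_def)
  have "Polynomial.coeff (Polynomial.smult s q + Polynomial.smult t r) i \<in> ideal2 K s t" for i
    using qr unfolding ideal2_def by auto
  thus ?thesis using qr(1) by (intro exI[of _ "Polynomial.smult s q + Polynomial.smult t r"]) simp
qed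

end

text \<open>Maximality among the subrings in which \<open>s\<close> and \<open>t\<close> do not generate the unit ideal
  makes the ring local and a valuation ring (Chevalley's extension theorem).\<close>

locale maximal_proper_subring = complex_subfield K + V: complex_subring V
  for K V :: "complex set" +
  fixes s t :: complex
  assumes V_subset: "V \<subseteq> K" and st: "s \<in> V" "t \<in> V"
    and proper: "1 \<notin> ideal2 V s t"
    and maximal: "\<And>A. complex_subring A \<Longrightarrow> V \<subseteq> A \<Longrightarrow> A \<subseteq> K \<Longrightarrow> 1 \<notin> ideal2 A s t \<Longrightarrow> A = V"
begin

abbreviation J :: "complex set" where "J \<equiv> ideal2 V s t"

lemma J_V: "x \<in> J \<Longrightarrow> x \<in> V"
  using V.ideal2_subset[OF st] by blast

text \<open>Certifies that x cannot be adjoined to V: the ideal generated by s and t becomes the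
  unit ideal of V[x]. By maximality every element of K outside V has a witness.\<close>

definition witness :: "complex \<Rightarrow> complex poly \<Rightarrow> bool" where
  "witness x g \<longleftrightarrow> (\<forall>i. Polynomial.coeff g i \<in> J) \<and> poly g x = 1"

lemma witness_exists:
  assumes "x \<in> K" "x \<notin> V"
  shows "\<exists>g. witness x g"
proof -
  have "adjoin V x \<noteq> V" using V.adjoin_mem assms by blast
  moreover have "adjoin V x \<subseteq> K"
    using assms(1) V_subset by (intro V.adjoin_subset complex_subring_axioms) auto
  ultimately have "1 \<in> ideal2 (adjoin V x) s t"
    using maximal[OF V.adjoin_subring V.adjoin_incl] by blast
  thus ?thesis using V.ideal2_adjoin unfolding witness_def by blast
qed

text \<open>If the inverse of u = 1 - j were outside V, clearing denominators in its witness would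
  put u^N into J. As u is congruent to 1 modulo J, this would put 1 into J.\<close>

lemma one_minus_unit:
  assumes j: "j \<in> J"
  shows "1 - j \<noteq> 0" "inverse (1 - j) \<in> V"
proof -
  let ?u = "1 - j"
  show nz: "?u \<noteq> 0" using j proper by auto
  show "inverse ?u \<in> V"
  proof (rule ccontr)
    assume *: "inverse ?u \<notin> V"
    have "inverse ?u \<in> K" using J_V[OF j] V_subset by auto
    then obtain g where g: "witness (inverse ?u) g" using witness_exists * by blast
    define N where "N = Polynomial.degree g"
    have "?u ^ N = ?u ^ N * poly g (inverse ?u)" using g by (simp add: witness_def)
    also have "\<dots> = (\<Sum>i\<le>N. ?u ^ (N - i) * Polynomial.coeff g i)"
    proof -
      have "?u ^ N * (Polynomial.coeff g i * inverse ?u ^ i) = ?u ^ (N - i) * Polynomial.coeff g i" if "i \<le> N" for i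
        using nz that by (simp add: power_diff field_simps)
      thus ?thesis unfolding poly_altdef N_def[symmetric] sum_distrib_left by (intro sum.cong) auto
    qed
    also have "\<dots> \<in> J"
      using g J_V[OF j] by (intro V.ideal2_sum V.ideal2_mult) (auto simp: witness_def)
    finally have "?u ^ N \<in> J" .
    moreover have "1 - ?u ^ N \<in> J" for N
    proof (induction N)
      case (Suc N)
      have "1 - ?u ^ Suc N = (1 - ?u ^ N) + ?u ^ N * j" by (simp add: algebra_simps)
      also have "\<dots> \<in> J" using J_V[OF j] j by (intro V.ideal2_add[OF Suc] V.ideal2_mult) auto
      finally show ?case .
    qed (simp add: V.ideal2_zero)
    ultimately have "(1 - ?u ^ N) + ?u ^ N \<in> J" using V.ideal2_add by blast
    thus False using proper by simp
  qed
qed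

lemma inverse_coprime_mem:
  assumes j: "j \<in> J" and a: "a \<in> V" and b: "b \<in> V" and ab: "a * b = 1 - j"
  shows "inverse a \<in> V"
proof -
  have "1 - j \<noteq> 0" "inverse (1 - j) \<in> V" using one_minus_unit[OF j] by auto
  moreover have "inverse a = b * inverse (1 - j)"
    using ab \<open>1 - j \<noteq> 0\<close> by (metis ab divide_inverse inverse_unique mult.assoc mult.commute right_inverse)
  ultimately show ?thesis using b by simp
qed

text \<open>The equation for 1/x has the invertible coefficient 1 - h_0 as its constant term;
  multiplied by x^N it expresses x^N through lower powers of x with coefficients in J. Substituting
  this for the leading power in g lowers the degree.\<close>

lemma witness_reduce:
  assumes x: "x \<noteq> 0"
    and g: "witness x g" and h: "witness (inverse x) h"
    and deg: "Polynomial.degree h \<le> Polynomial.degree g"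
  shows "\<exists>g'. witness x g' \<and> Polynomial.degree g' < Polynomial.degree g"
proof -
  define N M where "N = Polynomial.degree g" and "M = Polynomial.degree h"
  have N: "N > 0"
  proof (rule ccontr)
    assume "\<not> N > 0"
    hence "poly g x = Polynomial.coeff g 0" by (simp add: N_def poly_altdef)
    thus False using g proper by (metis witness_def)
  qed
  define u where "u = 1 - Polynomial.coeff h 0"
  have u: "u \<noteq> 0" "inverse u \<in> V"
    using one_minus_unit[of "Polynomial.coeff h 0"] h by (auto simp: u_def witness_def)
  \<comment> \<open>R(x) = x^N although deg R < N. The index starts at 1, which keeps all exponents
    N - j below N, and \<open>M \<le> N\<close> makes the subtraction exact.\<close>
  define R where "R = (\<Sum>j\<in>{1..M}. Polynomial.monom (inverse u * Polynomial.coeff h j) (N - j))"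
  have R_coeff: "Polynomial.coeff R i \<in> J" for i
    unfolding R_def coeff_sum using h u
    by (intro V.ideal2_sum) (auto simp: witness_def V.ideal2_zero intro!: V.ideal2_mult)
  have R_deg: "Polynomial.coeff R i = 0" if "i \<ge> N" for i
    unfolding R_def coeff_sum using that N by (intro sum.neutral) auto
  have "1 = (\<Sum>j\<le>M. Polynomial.coeff h j * inverse x ^ j)"
    using h by (simp add: witness_def poly_altdef M_def)
  also have "\<dots> = Polynomial.coeff h 0 + (\<Sum>j\<in>{1..M}. Polynomial.coeff h j * inverse x ^ j)"
    by (simp add: sum.atMost_shift atMost_atLeast0 sum.atLeast_Suc_atMost)
  finally have *: "(\<Sum>j\<in>{1..M}. Polynomial.coeff h j * inverse x ^ j) = u"
    by (simp add: u_def algebra_simps)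
  have "poly R x = (\<Sum>j\<in>{1..M}. inverse u * x ^ N * (Polynomial.coeff h j * inverse x ^ j))"
    unfolding R_def poly_sum
  proof (intro sum.cong refl)
    fix j assume "j \<in> {1..M}"
    hence "j \<le> N" using deg by (simp add: N_def M_def)
    hence "x ^ (N - j) = x ^ N * inverse x ^ j" using x by (simp add: power_diff field_simps)
    thus "poly (Polynomial.monom (inverse u * Polynomial.coeff h j) (N - j)) x
        = inverse u * x ^ N * (Polynomial.coeff h j * inverse x ^ j)" by (simp add: poly_monom)
  qed
  also have "\<dots> = x ^ N" unfolding sum_distrib_left[symmetric] * using u by simp
  finally have R: "poly R x = x ^ N" .
  define l where "l = Polynomial.coeff g N"
  define g' where "g' = g - Polynomial.monom l N + Polynomial.smult l R"
  have l: "l \<in> J" using g by (simp add: l_def witness_def)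
  have "Polynomial.coeff g' i \<in> J" for i
  proof -
    have "Polynomial.coeff (g - Polynomial.monom l N) i \<in> J"
      using g by (auto simp: l_def witness_def V.ideal2_zero)
    thus ?thesis unfolding g'_def coeff_add coeff_smult
      using R_coeff[of i] J_V[OF l] by (intro V.ideal2_add V.ideal2_mult)
  qed
  moreover have "poly g' x = 1" using g R by (simp add: g'_def witness_def poly_monom)
  moreover have "Polynomial.degree g' < N"
  proof (rule degree_lessI)
    show "\<forall>k\<ge>N. Polynomial.coeff g' k = 0"
      using R_deg by (auto simp: g'_def l_def N_def coeff_eq_0)
    show "g' \<noteq> 0 \<or> 0 < N" using N by simp
  qed
  ultimately show ?thesis unfolding witness_def N_def by blast
qed

text \<open>Among all pairs of witnesses for x and 1/x, one with least sum of degrees exists;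
  \<open>witness_reduce\<close> would shorten the one of larger degree.\<close>

lemma total:
  assumes x: "x \<in> K"
  shows "x \<in> V \<or> inverse x \<in> V"
proof (rule ccontr)
  assume *: "\<not> (x \<in> V \<or> inverse x \<in> V)"
  hence x0: "x \<noteq> 0" by auto
  have "\<exists>n g h. witness x g \<and> witness (inverse x) h \<and> n = Polynomial.degree g + Polynomial.degree h"
    using witness_exists[of x] witness_exists[of "inverse x"] * x by auto
  from LeastI_ex[OF this] obtain g h where gh: "witness x g" "witness (inverse x) h"
    and least: "(LEAST n. \<exists>g h. witness x g \<and> witness (inverse x) h \<and> n = Polynomial.degree g + Polynomial.degree h)
      = Polynomial.degree g + Polynomial.degree h" by metis
  have min: "Polynomial.degree g + Polynomial.degree h \<le> Polynomial.degree g' + Polynomial.degree h'"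
    if "witness x g'" "witness (inverse x) h'" for g' h'
    unfolding least[symmetric] by (rule Least_le) (use that in blast)
  show False
  proof (cases "Polynomial.degree h \<le> Polynomial.degree g")
    case True
    from witness_reduce[OF x0 gh True] min[OF _ gh(2)] show False by force
  next
    case False
    have "\<exists>h'. witness (inverse x) h' \<and> Polynomial.degree h' < Polynomial.degree h"
      using witness_reduce[of "inverse x" h g] x0 gh False by simp
    with min[OF gh(1)] show False by force
  qed
qed

end

context complex_subfield
begin

text \<open>Zorn's lemma. The union of a chain stays proper because an equation 1 = s a + t b
  involves only two coefficients, which lie in a common member of the chain.\<close>

lemma maximal_proper_subring_exists:
  assumes A: "complex_subring A" "A \<subseteq> K" "s \<in> A" "t \<in> A" "1 \<notin> ideal2 A s t"
  shows "\<exists>V. A \<subseteq> V \<and> maximal_proper_subring K V s t"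
proof -
  define C where "C = {B. complex_subring B \<and> A \<subseteq> B \<and> B \<subseteq> K \<and> 1 \<notin> ideal2 B s t}"
  have "\<exists>M\<in>C. \<forall>N\<in>C. M \<subseteq> N \<longrightarrow> N = M"
  proof (rule subset_Zorn_nonempty)
    show "C \<noteq> {}" using A by (auto simp: C_def)
  next
    fix D assume D: "D \<noteq> {}" "subset.chain C D"
    have sub: "\<And>B. B \<in> D \<Longrightarrow> B \<in> C" using D(2) by (auto simp: subset.chain_def)
    have common: "\<exists>B\<in>D. x \<in> B \<and> y \<in> B" if xy: "x \<in> \<Union>D" "y \<in> \<Union>D" for x y
    proof -
      obtain B B' where "B \<in> D" "x \<in> B" "B' \<in> D" "y \<in> B'" using xy by blast
      moreover have "B \<subseteq> B' \<or> B' \<subseteq> B" using D(2) \<open>B \<in> D\<close> \<open>B' \<in> D\<close>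
        by (auto simp: subset_chain_def)
      ultimately show ?thesis by blast
    qed
    have ring: "complex_subring B" if "B \<in> D" for B using sub[OF that] by (simp add: C_def)
    have "complex_subring (\<Union>D)"
    proof
      obtain B where "B \<in> D" using D(1) by blast
      thus "1 \<in> \<Union>D" using complex_subring.one_mem[OF ring] by blast
    next
      fix x y assume "x \<in> \<Union>D" "y \<in> \<Union>D"
      then obtain B where B: "B \<in> D" "x \<in> B" "y \<in> B" using common by blast
      show "x + y \<in> \<Union>D" using B complex_subring.add_mem[OF ring] by blast
      show "x * y \<in> \<Union>D" using B complex_subring.mult_mem[OF ring] by blast
      show "- x \<in> \<Union>D" using B complex_subring.uminus_mem[OF ring] by blast
    qed
    moreover have "1 \<notin> ideal2 (\<Union>D) s t"
    proof
      assume "1 \<in> ideal2 (\<Union>D) s t"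
      then obtain a b where ab: "1 = s * a + t * b" "a \<in> \<Union>D" "b \<in> \<Union>D" unfolding ideal2_def by blast
      then obtain B where B: "B \<in> D" "a \<in> B" "b \<in> B" using common by blast
      hence "1 \<in> ideal2 B s t" using ab(1) unfolding ideal2_def by blast
      thus False using sub[OF B(1)] by (simp add: C_def)
    qed
    moreover have "A \<subseteq> \<Union>D" "\<Union>D \<subseteq> K" using D(1) sub by (auto simp: C_def)
    ultimately show "\<Union>D \<in> C" by (simp add: C_def)
  qed
  then obtain V where V: "V \<in> C" "\<And>N. N \<in> C \<Longrightarrow> V \<subseteq> N \<Longrightarrow> N = V" by blast
  have V': "complex_subring V" "A \<subseteq> V" "V \<subseteq> K" "1 \<notin> ideal2 V s t"
    using V(1) by (auto simp: C_def)
  have max: "N = V" if "complex_subring N" "V \<subseteq> N" "N \<subseteq> K" "1 \<notin> ideal2 N s t" for N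
    using that V'(2) by (intro V(2)) (auto simp: C_def)
  have "maximal_proper_subring K V s t"
    by (intro maximal_proper_subring.intro maximal_proper_subring_axioms.intro
        complex_subfield_axioms V' max) (use V' A in auto)
  thus ?thesis using V(1) by (auto simp: C_def)
qed

end

context prime_subfield
begin

text \<open>In a maximal ring V the proper ideal generated by p and t contains both, so neither is
  invertible in V. An integer c prime to p is: a c + b p = 1 shows that a c differs from 1 by an
  element of the ideal.\<close>

theorem extending_valuation_exists:
  assumes A: "complex_subring A" "A \<subseteq> K" "t \<in> A" and proper: "1 \<notin> ideal2 A (of_nat p) t"
    and rank: "rank_le K n"
  shows "\<exists>w\<in>valuations_extending p K. w t > 0"
proof -
  have "of_nat p \<in> A" using complex_subring.of_nat_mem[OF A(1)] .
  then obtain V where V: "A \<subseteq> V" "maximal_proper_subring K V (of_nat p) t"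
    using maximal_proper_subring_exists[OF A(1,2) _ A(3) proper] by blast
  interpret M: maximal_proper_subring K V "of_nat p" t by fact
  have inv: "inverse x \<notin> V" if "x \<in> M.J" "x \<noteq> 0" for x
    using M.V.ideal2_mult[OF that(1), of "inverse x"] M.proper that(2) by auto
  interpret valuation_subring K V p n
  proof
    show "V \<subseteq> K" by (rule M.V_subset)
    show "x \<in> V \<or> inverse x \<in> V" if "x \<in> K" for x using M.total[OF that] .
    show "inverse (of_nat p) \<notin> V"
      using inv[OF M.V.ideal2_generators(1)] prime_gt_0_nat[OF prime_p'] by simp
    show "rank_le K n" by fact
  next
    fix c :: int assume "\<not> int p dvd c"
    hence "coprime (int p) c" using prime_p' by (intro prime_imp_coprime) simp_all
    hence "gcd c (int p) = 1" by (simp add: coprime_iff_gcd_eq_1 gcd.commute)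
    then obtain a b where ab: "a * c + b * int p = 1" by (metis bezout_int)
    have "of_nat p * of_int b + t * 0 \<in> M.J"
      unfolding ideal2_def mem_Collect_eq using M.V.of_int_mem M.V.zero_mem by blast
    moreover have "of_int c * of_int a = (1::complex) - (of_nat p * of_int b + t * 0)"
      using arg_cong[OF ab, of "of_int :: int \<Rightarrow> complex"] by (simp add: algebra_simps)
    ultimately show "inverse (of_int c) \<in> V" by (rule M.inverse_coprime_mem[OF _ M.V.of_int_mem M.V.of_int_mem])
  qed
  have "val t > 0"
  proof (cases "t = 0")
    case True
    thus ?thesis by (simp add: val_0)
  next
    case False
    thus ?thesis using val_pos[of t] inv[OF M.V.ideal2_generators(2)] A by blast
  qed
  thus ?thesis using val_mem by blast
qed

end

section \<open>The field generated by a root\<close>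

lemma ring_of_type_algebra_uminus: "\<ominus>\<^bsub>ring_of_type_algebra\<^esub> x = - x" for x :: complex
proof -
  interpret C: field "ring_of_type_algebra :: complex ring" by (rule field_from_type_algebra)
  show ?thesis
    by (rule C.minus_equality) (simp_all add: ring_of_type_algebra_def)
qed

lemma ring_of_type_algebra_inverse: "x \<noteq> 0 \<Longrightarrow> inv\<^bsub>ring_of_type_algebra\<^esub> x = inverse x" for x :: complex
proof -
  interpret C: field "ring_of_type_algebra :: complex ring" by (rule field_from_type_algebra)
  assume "x \<noteq> 0"
  thus ?thesis
    by (intro C.comm_inv_char) (simp_all add: ring_of_type_algebra_def)
qed

lemma generate_field_complex_subfield: "complex_subfield (generate_field ring_of_type_algebra H)"
proof -
  let ?G = "generate_field (ring_of_type_algebra :: complex ring) H"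
  show ?thesis
  proof
    show "1 \<in> ?G" using generate_field.one[of ring_of_type_algebra H] by (simp add: ring_of_type_algebra_def)
    show "x + y \<in> ?G" if "x \<in> ?G" "y \<in> ?G" for x y
      using generate_field.eng_add[OF that] by (simp add: ring_of_type_algebra_def)
    show "x * y \<in> ?G" if "x \<in> ?G" "y \<in> ?G" for x y
      using generate_field.eng_mult[OF that] by (simp add: ring_of_type_algebra_def)
    show minus_mem: "- x \<in> ?G" if "x \<in> ?G" for x
      using generate_field.a_inv[OF that] by (simp add: ring_of_type_algebra_uminus)
    show "inverse x \<in> ?G" if x: "x \<in> ?G" for x
    proof (cases "x = 0")
      case False
      thus ?thesis using generate_field.m_inv[OF x] ring_of_type_algebra_inverse by (simp add: ring_of_type_algebra_def)
    qed (use x in simp)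
  qed
qed

lemma generate_field_least:
  assumes "complex_subfield S" "H \<subseteq> S"
  shows "generate_field ring_of_type_algebra H \<subseteq> S"
proof
  interpret S: complex_subfield S by fact
  fix x assume "x \<in> generate_field (ring_of_type_algebra :: complex ring) H"
  thus "x \<in> S"
  proof induction
    case one thus ?case by (simp add: ring_of_type_algebra_def)
  next
    case (incl h) thus ?case using assms(2) by blast
  next
    case (a_inv h) thus ?case by (simp add: ring_of_type_algebra_uminus)
  next
    case (m_inv h) 
    hence "h \<noteq> 0" by (simp add: ring_of_type_algebra_def)
    thus ?case using m_inv by (simp add: ring_of_type_algebra_inverse)
  next
    case (eng_add h1 h2) thus ?case by (simp add: ring_of_type_algebra_def)
  next
    case (eng_mult h1 h2) thus ?case by (simp add: ring_of_type_algebra_def)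
  qed
qed

lemma common_denominator:
  fixes u :: "'a \<Rightarrow> rat"
  assumes "finite I"
  shows "\<exists>D. D \<noteq> 0 \<and> (\<forall>i\<in>I. of_int D * u i \<in> \<int>)"
proof (intro exI conjI ballI)
  let ?n = "\<lambda>i. snd (quotient_of (u i))"
  have pos: "?n i > 0" for i by (rule quotient_of_denom_pos')
  show "(\<Prod>i\<in>I. ?n i) \<noteq> 0" using assms pos by (simp add: less_imp_neq[OF pos, symmetric])
  fix i assume i: "i \<in> I"
  have "u i = of_int (fst (quotient_of (u i))) / of_int (?n i)"
    by (rule quotient_of_div) simp
  hence "of_int (?n i) * u i = of_int (fst (quotient_of (u i)))"
    using pos[of i] by (simp add: field_simps)
  moreover have "(\<Prod>i\<in>I. ?n i) = (\<Prod>i\<in>I - {i}. ?n i) * ?n i"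
    using prod.remove[OF assms i, of ?n] by (simp add: mult.commute)
  ultimately have "of_int (\<Prod>i\<in>I. ?n i) * u i = of_int ((\<Prod>i\<in>I - {i}. ?n i) * fst (quotient_of (u i)))"
    by (simp only: of_int_mult mult.assoc)
  thus "of_int (\<Prod>i\<in>I. ?n i) * u i \<in> \<int>" by (simp only: Ints_of_int)
qed

section \<open>The rational vector space spanned by the powers of the root\<close>

definition rat_scale :: "rat \<Rightarrow> complex \<Rightarrow> complex" where
  "rat_scale q x = of_rat q * x"

interpretation Q: vector_space rat_scale
  by unfold_locales (auto simp: rat_scale_def algebra_simps of_rat_add of_rat_mult)

text \<open>\<open>rank_le\<close> speaks of indexed families, linear dependence of sets. A repeated
  element x_i = x_j already gives a relation; n + 1 different elements of the span are dependent,
  and a common denominator makes the coefficients integral.\<close>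

lemma rank_le_span:
  assumes B: "finite B" "card B \<le> n"
  shows "rank_le (Q.span B) n"
  unfolding rank_le_def
proof (intro allI impI)
  fix x :: "nat \<Rightarrow> complex" assume x: "\<forall>i\<le>n. x i \<in> Q.span B"
  show "\<exists>c::nat \<Rightarrow> int. (\<exists>i\<le>n. c i \<noteq> 0) \<and> (\<Sum>i\<le>n. of_int (c i) * x i) = 0"
  proof (cases "inj_on x {..n}")
    case False
    then obtain i j where ij: "i \<le> n" "j \<le> n" "i \<noteq> j" "x i = x j" by (auto simp: inj_on_def)
    define c where "c k = (if k = i then 1 else if k = j then -1 else 0 :: int)" for k
    have "(\<Sum>k\<le>n. of_int (c k) * x k) = (\<Sum>k\<in>{i,j}. of_int (c k) * x k)"
      using ij by (intro sum.mono_neutral_right) (auto simp: c_def)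
    also have "\<dots> = 0" using ij by (simp add: c_def)
    finally show ?thesis using ij(1) by (intro exI[of _ c]) (auto simp: c_def)
  next
    case True
    have "Q.dependent (x ` {..n})"
    proof (rule ccontr)
      assume "Q.independent (x ` {..n})"
      hence "card (x ` {..n}) \<le> card B"
        using Q.independent_span_bound[OF B(1)] x by auto
      thus False using B(2) True by (simp add: card_image)
    qed
    then obtain u where u: "\<exists>v\<in>x ` {..n}. u v \<noteq> 0" "(\<Sum>v\<in>x ` {..n}. of_rat (u v) * v) = 0"
      by (subst (asm) Q.dependent_finite) (auto simp: rat_scale_def)
    obtain D where D: "D \<noteq> 0" "\<And>i. i \<in> {..n} \<Longrightarrow> of_int D * u (x i) \<in> \<int>"
      using common_denominator[of "{..n}" "\<lambda>i. u (x i)"] by auto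
    define c where "c i = \<lfloor>of_int D * u (x i)\<rfloor>" for i
    have c: "of_int D * u (x i) = of_int (c i)" if "i \<le> n" for i
      using D(2)[of i] that by (simp add: c_def)
    have "of_int (c i) * x i = of_int D * (of_rat (u (x i)) * x i)" if "i \<le> n" for i
      using arg_cong[OF c[OF that], of "of_rat :: rat \<Rightarrow> complex"] by (simp add: of_rat_mult mult_ac)
    hence "(\<Sum>i\<le>n. of_int (c i) * x i) = of_int D * (\<Sum>i\<le>n. of_rat (u (x i)) * x i)"
      unfolding sum_distrib_left by (intro sum.cong) simp_all
    also have "\<dots> = 0" using u(2) True by (simp add: sum.reindex)
    finally have "(\<Sum>i\<le>n. of_int (c i) * x i) = 0" .
    moreover have "\<exists>i\<le>n. c i \<noteq> 0"
    proof -
      obtain i where i: "i \<le> n" "u (x i) \<noteq> 0" using u(1) by blast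
      have "c i \<noteq> 0" 
      proof
        assume "c i = 0"
        hence "of_int D * u (x i) = 0" using c[OF i(1)] by (simp only: of_int_0)
        thus False using i(2) D(1) by (simp only: mult_eq_0_iff of_int_eq_0_iff) simp
      qed
      thus ?thesis using i(1) by blast
    qed
    ultimately show ?thesis by blast
  qed
qed

locale integer_root =
  fixes F :: "int poly" and \<alpha> :: complex
  assumes monic: "Polynomial.lead_coeff F = 1"
    and irred: "Factorial_Ring.irreducible F"
    and root: "poly (of_int_poly F) \<alpha> = 0"
begin

abbreviation N :: nat where "N \<equiv> Polynomial.degree F"

lemma N_pos: "N > 0"
proof (rule ccontr)
  assume "\<not> N > 0"
  hence "F = 1" using monic by (metis degree_0_id gr0I one_pCons)
  thus False using root by simp
qed

text \<open>The ring \<rat>[\<alpha>]. It turns out to be a field, so it contains \<rat>(\<alpha>)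
  and bounds its rank by N.\<close>

definition S :: "complex set" where "S = Q.span ((\<lambda>i. \<alpha> ^ i) ` {..<N})"

lemma S_scale: "x \<in> S \<Longrightarrow> of_rat q * x \<in> S"
  unfolding S_def rat_scale_def[symmetric] by (rule Q.span_scale)

lemma S_scale_int: "x \<in> S \<Longrightarrow> of_int q * x \<in> S"
  using S_scale[of x "of_int q"] by simp

lemma S_sum: "(\<And>i. i \<in> I \<Longrightarrow> f i \<in> S) \<Longrightarrow> sum f I \<in> S"
  unfolding S_def by (rule Q.span_sum)

lemma power_N: "\<alpha> ^ N = - (\<Sum>i<N. of_int (Polynomial.coeff F i) * \<alpha> ^ i)"
proof -
  have "0 = (\<Sum>i\<le>N. of_int (Polynomial.coeff F i) * \<alpha> ^ i)"
    using root by (simp add: poly_altdef degree_map_poly)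
  also have "\<dots> = (\<Sum>i<N. of_int (Polynomial.coeff F i) * \<alpha> ^ i) + \<alpha> ^ N"
    using monic by (simp add: lessThan_Suc_atMost[symmetric])
  finally show ?thesis by (simp add: eq_neg_iff_add_eq_0 add.commute)
qed

lemma S_mult_root: "x \<in> S \<Longrightarrow> \<alpha> * x \<in> S"
  unfolding S_def
proof (induction rule: Q.span_induct_alt)
  case base
  show ?case using Q.span_zero by simp
next
  case (step c x y)
  then obtain i where i: "i < N" "x = \<alpha> ^ i" by blast
  have gen: "\<alpha> ^ j \<in> S" if "j < N" for j unfolding S_def using that by (intro Q.span_base) auto
  have "\<alpha> ^ Suc i \<in> S"
  proof (cases "Suc i < N")
    case False
    hence "Suc i = N" using i by simp
    have "(\<Sum>i<N. of_int (Polynomial.coeff F i) * \<alpha> ^ i) \<in> S" by (intro S_sum S_scale_int gen) auto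
    hence "\<alpha> ^ N \<in> S" unfolding power_N unfolding S_def by (rule Q.span_neg)
    thus ?thesis using \<open>Suc i = N\<close> by simp
  qed (rule gen)
  hence "of_rat c * \<alpha> ^ Suc i \<in> S" by (rule S_scale)
  hence "of_rat c * \<alpha> ^ Suc i + \<alpha> * y \<in> S" using step(2) unfolding S_def by (rule Q.span_add)
  moreover have "\<alpha> * (rat_scale c x + y) = of_rat c * \<alpha> ^ Suc i + \<alpha> * y"
    by (simp add: rat_scale_def i algebra_simps)
  ultimately show ?case by (simp only: S_def)
qed

lemma power_mem_S: "\<alpha> ^ k \<in> S"
proof (induction k)
  case 0
  show ?case unfolding S_def using N_pos by (intro Q.span_base) (force intro: image_eqI[of _ _ 0])
next
  case (Suc k)
  thus ?case using S_mult_root[of "\<alpha> ^ k"] by simp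
qed

lemma S_mult: "x \<in> S \<Longrightarrow> y \<in> S \<Longrightarrow> x * y \<in> S"
proof -
  assume y: "y \<in> S"
  have pow: "\<alpha> ^ i * y \<in> S" for i
    by (induction i) (use y S_mult_root in \<open>auto simp: mult.assoc\<close>)
  assume "x \<in> S"
  thus "x * y \<in> S" unfolding S_def
  proof (induction rule: Q.span_induct_alt)
    case base
    show ?case using Q.span_zero by simp
  next
    case (step c x z)
    then obtain i where i: "x = \<alpha> ^ i" by blast
    have "of_rat c * (\<alpha> ^ i * y) + z * y \<in> S"
      using step(2) S_scale[OF pow] unfolding S_def by (intro Q.span_add)
    moreover have "(rat_scale c x + z) * y = of_rat c * (\<alpha> ^ i * y) + z * y"
      by (simp add: rat_scale_def i algebra_simps)
    ultimately show ?case by (simp only: S_def)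
  qed
qed

lemma rank_le_S: "rank_le S N"
  unfolding S_def by (rule rank_le_span) (auto intro: order_trans[OF card_image_le])

text \<open>An integer relation between 1, x, ..., x^N inverts x: after division by the lowest power
  of x that occurs, it reads c_m + x y = 0 with c_m \<noteq> 0 and y a polynomial in x.\<close>

lemma S_subfield: "complex_subfield S"
proof -
  have ring: "complex_subring S"
  proof
    show "1 \<in> S" using power_mem_S[of 0] by simp
    show "x + y \<in> S" if "x \<in> S" "y \<in> S" for x y using that unfolding S_def by (rule Q.span_add)
    show "- x \<in> S" if "x \<in> S" for x using that unfolding S_def by (rule Q.span_neg)
  qed (rule S_mult)
  interpret S: complex_subring S by (rule ring)
  show ?thesis
  proof (rule complex_subfield.intro[OF ring], unfold_locales)
    fix x assume x: "x \<in> S"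
    show "inverse x \<in> S"
    proof (cases "x = 0")
      case False
      obtain c :: "nat \<Rightarrow> int" where c: "\<exists>i\<le>N. c i \<noteq> 0" "(\<Sum>i\<le>N. of_int (c i) * x ^ i) = 0"
      proof -
        have "\<forall>i\<le>N. x ^ i \<in> S" using x by simp
        thus ?thesis using rank_le_S that unfolding rank_le_def by blast
      qed
      define m where "m = (LEAST i. c i \<noteq> 0)"
      obtain k where k: "k \<le> N" "c k \<noteq> 0" using c(1) by blast
      have "c m \<noteq> 0" unfolding m_def using k(2) by (rule LeastI)
      moreover have "m \<le> k" unfolding m_def using k(2) by (rule Least_le)
      ultimately have m: "c m \<noteq> 0" "m \<le> N" using k(1) by simp_all
      have m': "c i = 0" if "i < m" for i using not_less_Least[of i "\<lambda>i. c i \<noteq> 0"] that unfolding m_def by blast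
      define y where "y = (\<Sum>i\<in>{m<..N}. of_int (c i) * x ^ (i - Suc m))"
      have y: "y \<in> S" unfolding y_def using x by (intro S_sum S_scale_int) simp
      have "0 = (\<Sum>i\<in>insert m {m<..N}. of_int (c i) * x ^ i)"
        unfolding c(2)[symmetric] using m m' by (intro sum.mono_neutral_right) (auto simp: not_less)
      also have "\<dots> = of_int (c m) * x ^ m + (\<Sum>i\<in>{m<..N}. of_int (c i) * x ^ i)" by simp
      also have "(\<Sum>i\<in>{m<..N}. of_int (c i) * x ^ i) = x ^ m * (x * y)"
        unfolding y_def sum_distrib_left
      proof (intro sum.cong refl)
        fix i assume "i \<in> {m<..N}"
        hence "x ^ i = x ^ m * (x * x ^ (i - Suc m))"
          by (simp flip: power_add power_Suc)
        thus "of_int (c i) * x ^ i = x ^ m * (x * (of_int (c i) * x ^ (i - Suc m)))" by simp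
      qed
      finally have "x ^ m * (of_int (c m) + x * y) = 0" by (simp add: algebra_simps)
      hence "x * y = - of_int (c m)" using False by (simp add: eq_neg_iff_add_eq_0 add.commute)
      hence "- (x * y / of_int (c m)) = 1" using m(1) by simp
      hence "inverse x = of_rat (- 1 / of_int (c m)) * y"
        using False m(1) by (intro inverse_unique) (simp add: of_rat_minus of_rat_divide)
      moreover have "of_rat (- 1 / of_int (c m)) * y \<in> S" by (rule S_scale[OF y])
      ultimately show ?thesis by simp
    qed (use x in simp)
  qed
qed

lemma adjoin_root_subfield: "complex_subfield (adjoin_root \<alpha>)"
  unfolding adjoin_root_def by (rule generate_field_complex_subfield)

lemma root_mem_adjoin_root: "\<alpha> \<in> adjoin_root \<alpha>"
  unfolding adjoin_root_def by (rule generate_field.incl) simp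

lemma rank_le_adjoin_root: "rank_le (adjoin_root \<alpha>) N"
proof -
  have "adjoin_root \<alpha> \<subseteq> S"
    unfolding adjoin_root_def using power_mem_S[of 1] by (intro generate_field_least S_subfield) auto
  thus ?thesis using rank_le_S unfolding rank_le_def by blast
qed

text \<open>Let h be a nonzero integer polynomial of least degree vanishing at \<alpha>. By
  pseudo-division h divides a nonzero integer multiple of every polynomial vanishing at \<alpha>, in
  particular of F and of g. Since F is prime in Z[X] and divides no nonzero constant, it divides h
  and then g.\<close>

lemma dvd_if_root:
  assumes g: "poly (of_int_poly g) \<alpha> = 0"
  shows "F dvd g"
proof (cases "g = 0")
  case False
  define P where "P h \<longleftrightarrow> h \<noteq> 0 \<and> poly (of_int_poly h) \<alpha> = 0" for h :: "int poly"
  have "\<exists>h. P h \<and> (\<forall>h'. P h' \<longrightarrow> Polynomial.degree h \<le> Polynomial.degree h')"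
    using False g ex_has_least_nat[of P g Polynomial.degree] by (auto simp: P_def)
  then obtain h where h: "P h" "\<And>h'. P h' \<Longrightarrow> Polynomial.degree h \<le> Polynomial.degree h'" by blast
  have h0: "h \<noteq> 0" "poly (of_int_poly h) \<alpha> = 0" using h(1) by (auto simp: P_def)
  have div: "\<exists>a q. a \<noteq> 0 \<and> Polynomial.smult a f = h * q"
    if f: "poly (of_int_poly f) \<alpha> = 0" for f :: "int poly"
  proof -
    obtain a q where aq: "a \<noteq> 0" "Polynomial.smult a f = h * q + pseudo_mod f h"
      using pseudo_mod(1)[OF h0(1), of f] by blast
    have "poly (of_int_poly (Polynomial.smult a f)) \<alpha> = poly (of_int_poly (h * q + pseudo_mod f h)) \<alpha>"
      by (simp only: aq(2))
    hence "poly (of_int_poly (pseudo_mod f h)) \<alpha> = 0"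
      using f h0(2) by (simp add: hom_distribs)
    hence "pseudo_mod f h = 0"
      using h(2)[of "pseudo_mod f h"] pseudo_mod(2)[OF h0(1), of f] unfolding P_def by linarith
    hence "Polynomial.smult a f = h * q" using aq(2) by simp
    thus ?thesis using aq(1) by blast
  qed
  have prime: "prime_elem F" using irred by (rule irreducible_imp_prime_elem)
  obtain a q where aq: "a \<noteq> 0" "Polynomial.smult a F = h * q" using div[OF root] by blast
  have "F dvd h * q" unfolding aq(2)[symmetric] by (rule dvd_smult) simp
  hence "F dvd h \<or> F dvd q" by (rule prime_elem_dvd_multD[OF prime])
  moreover have "\<not> F dvd q"
  proof
    assume "F dvd q"
    then obtain r where r: "q = F * r" by blast
    have "F * [:a:] = F * (h * r)" using aq(2) r by (simp add: mult_ac)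
    hence "[:a:] = h * r" using monic by (subst (asm) mult_cancel_left) auto
    hence "Polynomial.degree (h * r) = 0" "h * r \<noteq> 0" using aq(1) by (simp_all flip: \<open>[:a:] = h * r\<close>)
    hence "Polynomial.degree h = 0" by (simp add: degree_mult_eq)
    then obtain b where "h = [:b:]" by (rule degree_eq_zeroE)
    thus False using h0 by simp
  qed
  ultimately have Fh: "F dvd h" by blast
  obtain b r where br: "b \<noteq> 0" "Polynomial.smult b g = h * r" using div[OF g] by blast
  have "F dvd [:b:] * g" using Fh br(2) by (simp add: dvd_mult2)
  moreover have "\<not> F dvd [:b:]"
    using br(1) N_pos dvd_imp_degree_le[of F "[:b:]"] by auto
  ultimately show ?thesis using prime_elem_dvd_multD[OF prime] by blast
qed simp

end

section \<open>Reduction modulo $p$ and expansions\<close>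

locale mod_p =
  fixes p :: nat and ty :: "'p :: prime_card itself"
  assumes p_card: "p = CARD('p)"
begin

abbreviation red :: "int poly \<Rightarrow> 'p mod_ring poly" where
  "red \<equiv> of_int_poly"

lemma prime_p: "Factorial_Ring.prime p"
  unfolding p_card by (rule prime_card)

lemma prime_int_p: "Factorial_Ring.prime (int p)"
  using prime_p by simp

lemma of_int_mod_ring_eq_0_iff: "(of_int c :: 'p mod_ring) = 0 \<longleftrightarrow> int p dvd c"
  by (simp add: of_int_eq_0_iff_char_dvd semiring_char_mod_ring p_card)

lemma red_eq_0_iff: "red f = 0 \<longleftrightarrow> (\<forall>i. int p dvd Polynomial.coeff f i)"
  by (simp add: poly_eq_iff coeff_map_poly of_int_mod_ring_eq_0_iff)

lemma red_eq_0_imp: "red f = 0 \<Longrightarrow> \<exists>g. f = Polynomial.smult (int p) g"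
proof -
  assume "red f = 0"
  hence "[:int p:] dvd f" by (simp add: red_eq_0_iff const_poly_dvd_iff)
  then obtain g where "f = [:int p:] * g" ..
  thus ?thesis by (intro exI[of _ g]) simp
qed

lemma red_eq_iff: "red f = red g \<longleftrightarrow> (\<exists>q. f = g + Polynomial.smult (int p) q)"
proof
  assume *: "red f = red g"
  have "red (f - g) = 0" unfolding of_int_poly_hom.hom_minus * by (rule diff_self)
  from red_eq_0_imp[OF this] obtain q where "f - g = Polynomial.smult (int p) q" ..
  hence "f = g + Polynomial.smult (int p) q" by (simp only: diff_eq_eq add.commute)
  thus "\<exists>q. f = g + Polynomial.smult (int p) q" ..
next
  assume "\<exists>q. f = g + Polynomial.smult (int p) q"
  then obtain q where q: "f = g + Polynomial.smult (int p) q" by blast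
  have "(of_int (int p) :: 'p mod_ring) = 0" by (simp only: of_int_mod_ring_eq_0_iff) simp
  thus "red f = red g" unfolding q by (simp only: hom_distribs) simp
qed

lemma red_surj: "\<exists>f. red f = g"
proof -
  have "red (map_poly to_int_mod_ring g) = g"
    by (intro poly_eqI) (simp add: coeff_map_poly of_int_of_int_mod_ring)
  thus ?thesis by blast
qed

lemma degree_red_le: "Polynomial.degree (red f) \<le> Polynomial.degree f"
  by (rule degree_map_poly_le)

lemma degree_red_monic: "Polynomial.lead_coeff f = 1 \<Longrightarrow> Polynomial.degree (red f) = Polynomial.degree f"
  by (intro antisym degree_red_le le_degree) (simp add: coeff_map_poly)

lemma lead_coeff_red_monic: "Polynomial.lead_coeff f = 1 \<Longrightarrow> Polynomial.lead_coeff (red f) = 1"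
  by (simp add: degree_red_monic coeff_map_poly)

text \<open>A Bezout identity over the prime field, lifted to the integers with an error divisible
  by p. At a valuation for which \<phi>(\<alpha>) has positive value it makes g(\<alpha>) a
  unit.\<close>

lemma bezout_red:
  assumes irr: "Factorial_Ring.irreducible (red \<phi>)" and g: "\<not> red \<phi> dvd red g"
  shows "\<exists>u v q. u * g + v * \<phi> = 1 + Polynomial.smult (int p) q"
proof -
  have "coprime (red \<phi>) (red g)"
    using irr g by (intro prime_elem_imp_coprime irreducible_imp_prime_elem)
  hence "gcd (red g) (red \<phi>) = 1" by (simp add: coprime_iff_gcd_eq_1 gcd.commute)
  hence *: "fst (bezout_coefficients (red g) (red \<phi>)) * red g + snd (bezout_coefficients (red g) (red \<phi>)) * red \<phi> = 1"
    by (simp add: bezout_coefficients_fst_snd)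
  obtain u v where "red u = fst (bezout_coefficients (red g) (red \<phi>))" "red v = snd (bezout_coefficients (red g) (red \<phi>))"
    using red_surj by metis
  with * have "red (u * g + v * \<phi>) = red 1" by (simp add: hom_distribs)
  thus ?thesis unfolding red_eq_iff by blast
qed

lemma red_not_dvd_small:
  assumes "Polynomial.lead_coeff \<phi> = 1" "Polynomial.degree g < Polynomial.degree \<phi>" "red g \<noteq> 0"
  shows "\<not> red \<phi> dvd red g"
  using dvd_imp_degree_le[of "red \<phi>" "red g"] assms degree_red_le[of g] degree_red_monic[OF assms(1)] by auto

lemma int_val_prime_power_mult:
  "int_val p (int p ^ k * c) = enat k + int_val p c"
proof (cases "c = 0")
  case False
  have p: "prime_elem (int p)" using prime_int_p by (rule prime_imp_prime_elem)
  hence nz: "int p ^ k \<noteq> 0" by auto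
  have "multiplicity (int p) (int p ^ k * c) = multiplicity (int p) (int p ^ k) + multiplicity (int p) c"
    by (rule prime_elem_multiplicity_mult_distrib[OF p nz False])
  also have "multiplicity (int p) (int p ^ k) = k"
    using p by (intro multiplicity_same_power) (auto simp: prime_elem_def)
  finally show ?thesis using nz False by (simp add: int_val_def)
qed (simp add: int_val_def)

lemma poly_val_0 [simp]: "poly_val p 0 = \<infinity>"
  by (simp add: poly_val_def int_val_def)

lemma poly_val_decompose:
  assumes "f \<noteq> 0"
  obtains k g where "f = Polynomial.smult (int p ^ k) g" "red g \<noteq> 0" "poly_val p f = enat k"
proof -
  have "\<exists>i\<in>UNIV. Polynomial.coeff f i \<noteq> 0" using assms by (simp add: poly_eq_iff)
  from factor_out_prime_power[OF prime_p this] obtain k c where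
    c: "\<And>i. Polynomial.coeff f i = int p ^ k * c i" "\<exists>i. \<not> int p dvd c i" by auto
  have "[:int p ^ k:] dvd f" by (simp add: const_poly_dvd_iff c(1))
  then obtain g where "f = [:int p ^ k:] * g" ..
  hence g: "f = Polynomial.smult (int p ^ k) g" by simp
  have cg: "c i = Polynomial.coeff g i" for i
    using c(1)[of i] g prime_gt_0_nat[OF prime_p] by simp
  have val: "int_val p (Polynomial.coeff f i) = enat k + int_val p (c i)" for i
    unfolding c(1) by (rule int_val_prime_power_mult)
  obtain i where i: "\<not> int p dvd c i" using c(2) by blast
  have "int_val p (Polynomial.coeff f i) = enat k"
  proof -
    have "c i \<noteq> 0" using i by auto
    hence "int_val p (c i) = 0"
      using not_dvd_imp_multiplicity_0[OF i] by (simp add: int_val_def enat_0)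
    thus ?thesis unfolding val by simp
  qed
  hence "poly_val p f = enat k"
    unfolding poly_val_def
  proof (intro antisym INF_greatest)
    show "(INF j. int_val p (Polynomial.coeff f j)) \<le> enat k"
      using INF_lower[of i UNIV "\<lambda>j. int_val p (Polynomial.coeff f j)"]
        \<open>int_val p (Polynomial.coeff f i) = enat k\<close> by simp
    show "enat k \<le> int_val p (Polynomial.coeff f j)" for j unfolding val by (rule le_iff_add[THEN iffD2]) blast
  qed
  moreover have "red g \<noteq> 0" using i by (simp only: red_eq_0_iff cg not_all) (rule exI)
  ultimately show ?thesis using g by (intro that)
qed

lemma red_smult_prime_power:
  assumes "k > 0"
  shows "red (Polynomial.smult (int p ^ k) g) = 0"
  using dvd_power[OF disjI1[OF assms], of "int p"]
  by (simp only: red_eq_0_iff coeff_smult dvd_mult2 simp_thms)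

lemma poly_val_eq_0_iff: "poly_val p f = 0 \<longleftrightarrow> red f \<noteq> 0"
proof (cases "f = 0")
  case False
  obtain k g where kg: "f = Polynomial.smult (int p ^ k) g" "red g \<noteq> 0" "poly_val p f = enat k"
    using poly_val_decompose[OF False] .
  show ?thesis
  proof (cases "k = 0")
    case False
    thus ?thesis using red_smult_prime_power[of k g] kg by (simp add: enat_0_iff)
  qed (use kg in \<open>simp add: enat_0\<close>)
qed simp

lemma poly_val_ge_imp_dvd:
  assumes "enat k \<le> poly_val p f"
  shows "\<exists>g. f = Polynomial.smult (int p ^ k) g"
proof (cases "f = 0")
  case True
  thus ?thesis by (intro exI[of _ 0]) simp
next
  case False
  obtain k' g where kg: "f = Polynomial.smult (int p ^ k') g" "red g \<noteq> 0" "poly_val p f = enat k'"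
    using poly_val_decompose[OF False] .
  have "k' = k + (k' - k)" using assms kg(3) by simp
  hence "int p ^ k' = int p ^ k * int p ^ (k' - k)" by (metis power_add)
  hence "f = Polynomial.smult (int p ^ k) (Polynomial.smult (int p ^ (k' - k)) g)" using kg(1) by simp
  thus ?thesis ..
qed

end

text \<open>The hypothesis on \<open>b\<close> makes this an x-adic expansion with reduced digits:
  the first nonzero digit determines the exact power of x dividing the sum.\<close>

lemma power_dvd_expansion_iff:
  fixes x :: "'a :: idom" and b :: "nat \<Rightarrow> 'a"
  assumes x: "x \<noteq> 0" and small: "\<And>i. i \<le> n \<Longrightarrow> x dvd b i \<Longrightarrow> b i = 0"
  shows "x ^ k dvd (\<Sum>i\<le>n. b i * x ^ i) \<longleftrightarrow> (\<forall>i\<le>n. i < k \<longrightarrow> b i = 0)"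
proof
  assume "\<forall>i\<le>n. i < k \<longrightarrow> b i = 0"
  thus "x ^ k dvd (\<Sum>i\<le>n. b i * x ^ i)"
    by (intro dvd_sum) (metis atMost_iff dvd_0_right dvd_mult le_imp_power_dvd mult_zero_left not_less)
next
  assume dvd: "x ^ k dvd (\<Sum>i\<le>n. b i * x ^ i)"
  have "i \<le> n \<Longrightarrow> i < k \<Longrightarrow> b i = 0" for i
  proof (induction i rule: less_induct)
    case (less i)
    have "x ^ Suc i dvd (\<Sum>i\<le>n. b i * x ^ i)"
      using dvd less.prems(2) by (meson Suc_leI le_imp_power_dvd dvd_trans)
    also have "(\<Sum>i\<le>n. b i * x ^ i) = b i * x ^ i + (\<Sum>j\<in>{..n} - {i}. b j * x ^ j)"
      using less.prems(1) by (simp add: sum.remove)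
    finally have "x ^ Suc i dvd b i * x ^ i + (\<Sum>j\<in>{..n} - {i}. b j * x ^ j)" .
    moreover have "x ^ Suc i dvd (\<Sum>j\<in>{..n} - {i}. b j * x ^ j)"
    proof (intro dvd_sum)
      fix j assume j: "j \<in> {..n} - {i}"
      show "x ^ Suc i dvd b j * x ^ j"
      proof (cases "j < i")
        case True
        thus ?thesis using less j by simp
      next
        case False
        hence "Suc i \<le> j" using j by auto
        thus ?thesis by (intro dvd_mult le_imp_power_dvd)
      qed
    qed
    ultimately have "x ^ Suc i dvd b i * x ^ i" by (metis dvd_add_left_iff)
    hence "x ^ i * x dvd x ^ i * b i" by (simp add: mult.commute)
    hence "x dvd b i" using x by (simp only: dvd_mult_cancel_left) simp
    thus ?case using small less.prems(1) by blast
  qed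
  thus "\<forall>i\<le>n. i < k \<longrightarrow> b i = 0" by blast
qed

context mod_p
begin

text \<open>Modulo p the expansion of F becomes the expansion of its reduction, whose lowest nonzero
  digit sits at the multiplicity l. As the digits are numbered from the top, \<open>exp_s\<close> is
  L - l, so the side of the polygon has length L - s = l.\<close>

lemma expansion_exp_s:
  assumes \<phi>: "Polynomial.lead_coeff \<phi> = 1" "Factorial_Ring.irreducible (red \<phi>)"
    and exp: "phi_adic_expansion \<phi> F L a"
    and mult: "red \<phi> ^ l dvd red F" "\<not> red \<phi> ^ Suc l dvd red F"
  shows "l \<le> L" "exp_s p L a = L - l"
    "red (a (L - l)) \<noteq> 0" "\<And>j. j \<le> L \<Longrightarrow> L - l < j \<Longrightarrow> red (a j) = 0"
proof -
  have F: "F = (\<Sum>j\<in>{0..L}. a j * \<phi> ^ (L - j))"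
    and deg: "\<And>j. j \<le> L \<Longrightarrow> Polynomial.degree (a j) < Polynomial.degree \<phi>"
    using exp by (auto simp: phi_adic_expansion_def)
  have "F = (\<Sum>i\<le>L. a (L - i) * \<phi> ^ i)"
    unfolding F by (rule sum.reindex_bij_witness[of _ "\<lambda>i. L - i" "\<lambda>i. L - i"]) auto
  hence redF: "red F = (\<Sum>i\<le>L. red (a (L - i)) * red \<phi> ^ i)"
    by (simp add: hom_distribs)
  have nz: "red \<phi> \<noteq> 0" using \<phi>(2) by auto
  have small: "red (a (L - i)) = 0" if "i \<le> L" "red \<phi> dvd red (a (L - i))" for i
    using red_not_dvd_small[OF \<phi>(1) deg[of "L - i"]] that(2) by (metis diff_le_self)
  have iff: "red \<phi> ^ k dvd red F \<longleftrightarrow> (\<forall>i\<le>L. i < k \<longrightarrow> red (a (L - i)) = 0)" for k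
    unfolding redF by (rule power_dvd_expansion_iff[OF nz small])
  have 1: "\<forall>i\<le>L. i < l \<longrightarrow> red (a (L - i)) = 0" using mult(1) by (simp only: iff)
  obtain i where i: "i \<le> L" "i < Suc l" "red (a (L - i)) \<noteq> 0"
    using mult(2)[unfolded iff, simplified not_all not_imp] by (elim exE conjE) (rule that)
  hence "i = l" using 1 by (metis less_Suc_eq)
  thus l: "l \<le> L" and s: "red (a (L - l)) \<noteq> 0" using i by auto
  show above: "red (a j) = 0" if "j \<le> L" "L - l < j" for j
    using 1[rule_format, of "L - j"] that l by simp
  show "exp_s p L a = L - l"
    unfolding exp_s_def
  proof (rule Max_eqI)
    fix j assume "j \<in> {j \<in> {0..L}. poly_val p (a j) = 0}"
    thus "j \<le> L - l" using above[of j] by (force simp: poly_val_eq_0_iff)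
  qed (use s in \<open>auto simp: poly_val_eq_0_iff\<close>)
qed

end

section \<open>The slope of the Newton polygon\<close>

locale valuation_of_root = mod_p p ty + integer_root F \<alpha>
  for p :: nat and ty :: "'p :: prime_card itself" and F :: "int poly" and \<alpha> :: complex +
  fixes w :: "complex \<Rightarrow> ereal"
  assumes w_extends: "w \<in> valuations_extending p (adjoin_root \<alpha>)"
begin

sublocale W: ext_valuation "adjoin_root \<alpha>" p w
proof -
  interpret complex_subfield "adjoin_root \<alpha>" by (rule adjoin_root_subfield)
  show "ext_valuation (adjoin_root \<alpha>) p w"
    by unfold_locales (rule prime_p, rule w_extends)
qed

abbreviation ev :: "int poly \<Rightarrow> complex" where
  "ev g \<equiv> poly (of_int_poly g) \<alpha>"

lemma ev_mem: "ev g \<in> adjoin_root \<alpha>"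
  by (rule W.poly_mem[OF root_mem_adjoin_root])

lemma ev_mult: "ev (f * g) = ev f * ev g"
  by (simp only: of_int_poly_hom.hom_mult poly_mult)

lemma ev_add: "ev (f + g) = ev f + ev g"
  by (simp only: of_int_poly_hom.hom_add poly_add)

lemma ev_power: "ev (f ^ n) = ev f ^ n"
  by (simp only: of_int_poly_hom.hom_power poly_power)

lemma ev_smult: "ev (Polynomial.smult c f) = of_int c * ev f"
proof -
  have "of_int_poly (Polynomial.smult c f) = Polynomial.smult (of_int c) (of_int_poly f :: complex poly)"
    by (intro poly_eqI) (simp only: coeff_map_poly of_int_0 coeff_smult of_int_mult)
  thus ?thesis by (simp only: poly_smult)
qed

lemma ev_1: "ev 1 = 1"
  by (simp only: of_int_poly_hom.hom_one poly_1)

lemma ev_sum: "ev (\<Sum>i\<in>I. f i) = (\<Sum>i\<in>I. ev (f i))"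
  by (simp only: of_int_poly_hom.hom_sum poly_sum)

text \<open>\<alpha> is integral: for w(\<alpha>) < 0, the lower terms in the equation for
  \<alpha>^N have value at least (N - 1) w(\<alpha>), which is greater than N w(\<alpha>).\<close>

lemma w_root_nonneg: "0 \<le> w \<alpha>"
proof (cases "\<alpha> = 0")
  case False
  note mem = root_mem_adjoin_root
  show ?thesis
  proof (rule ccontr)
    assume "\<not> 0 \<le> w \<alpha>"
    hence neg: "W.v \<alpha> < 0" using W.w_eq_v[OF mem False] by simp
    have "ereal (real (N - 1) * W.v \<alpha>) \<le> w (of_int (Polynomial.coeff F i) * \<alpha> ^ i)" if i: "i < N" for i
    proof -
      have "real (N - 1) * W.v \<alpha> \<le> real i * W.v \<alpha>" using i neg by (intro mult_right_mono_neg) auto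
      hence "ereal (real (N - 1) * W.v \<alpha>) \<le> w (\<alpha> ^ i)"
        using W.w_eq_v[of "\<alpha> ^ i"] W.v_power[OF mem False, of i] mem False by simp
      from add_mono[OF W.w_of_int_nonneg[of "Polynomial.coeff F i"] this]
      show ?thesis using mem by (simp add: W.w_mult)
    qed
    hence "ereal (real (N - 1) * W.v \<alpha>) \<le> w (\<Sum>i<N. of_int (Polynomial.coeff F i) * \<alpha> ^ i)"
      using mem by (intro W.w_sum_ge) auto
    also have "\<dots> = w (\<alpha> ^ N)"
      unfolding power_N using mem by (intro W.w_uminus[symmetric] W.sum_mem) simp
    also have "\<dots> = ereal (real N * W.v \<alpha>)"
      using W.w_eq_v[of "\<alpha> ^ N"] W.v_power[OF mem False, of N] mem False by simp
    finally have "real (N - 1) * W.v \<alpha> \<le> real N * W.v \<alpha>" by simp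
    hence "real N \<le> real (N - 1)" using neg by simp
    thus False using N_pos by simp
  qed
qed simp

lemma w_mult_nonneg: "x \<in> adjoin_root \<alpha> \<Longrightarrow> y \<in> adjoin_root \<alpha> \<Longrightarrow> 0 \<le> w x \<Longrightarrow> 0 \<le> w y \<Longrightarrow> 0 \<le> w (x * y)"
  by (simp add: W.w_mult)

lemma w_mult_pos: "x \<in> adjoin_root \<alpha> \<Longrightarrow> y \<in> adjoin_root \<alpha> \<Longrightarrow> 0 < w x \<Longrightarrow> 0 \<le> w y \<Longrightarrow> 0 < w (x * y)"
  by (metis W.w_mult add_pos_nonneg)

lemma w_ev_nonneg: "0 \<le> w (ev g)"
proof (induction g)
  case (pCons c g)
  have "ev (pCons c g) = of_int c + \<alpha> * ev g" by (simp only: of_int_hom.map_poly_pCons_hom poly_pCons)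
  moreover have "0 \<le> w (\<alpha> * ev g)"
    by (intro w_mult_nonneg root_mem_adjoin_root ev_mem w_root_nonneg pCons)
  ultimately show ?case
    using W.w_add_ge[of "of_int c" "\<alpha> * ev g" 0] W.w_of_int_nonneg[of c] root_mem_adjoin_root ev_mem by simp
qed simp

lemma w_smult_p_pos: "0 < w (ev (Polynomial.smult (int p) q))"
  unfolding ev_smult by (intro w_mult_pos ev_mem w_ev_nonneg) (simp_all add: W.w_p)

end

locale valuation_above = valuation_of_root p ty F \<alpha> w
  for p :: nat and ty :: "'p :: prime_card itself" and F :: "int poly" and \<alpha> :: complex
    and \<phi> :: "int poly" and w :: "complex \<Rightarrow> ereal" +
  assumes phi_monic: "Polynomial.lead_coeff \<phi> = 1"
    and phi_irreducible: "Factorial_Ring.irreducible (of_int_poly \<phi> :: 'p mod_ring poly)"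
    and phi_pos: "w (poly (of_int_poly \<phi>) \<alpha>) > 0"
begin

text \<open>The elements of Z[X] of positive value at \<alpha> form the ideal generated by p and
  \<phi>. A g outside it satisfies u g + v \<phi> = 1 + p q, so positive value of g(\<alpha>) would
  give 1 positive value.\<close>

lemma w_ev_pos_iff: "0 < w (ev g) \<longleftrightarrow> red \<phi> dvd red g"
proof
  assume "red \<phi> dvd red g"
  then obtain h where "red g = red \<phi> * h" ..
  moreover obtain h' where "red h' = h" using red_surj ..
  ultimately have "red g = red (\<phi> * h')" by (simp only: of_int_poly_hom.hom_mult)
  then obtain q where q: "g = \<phi> * h' + Polynomial.smult (int p) q" unfolding red_eq_iff ..
  have "0 < w (ev \<phi> * ev h')" by (intro w_mult_pos ev_mem phi_pos w_ev_nonneg)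
  thus "0 < w (ev g)" unfolding q ev_add ev_mult
    by (intro W.w_add_gt W.mult_mem ev_mem w_smult_p_pos)
next
  assume pos: "0 < w (ev g)"
  show "red \<phi> dvd red g"
  proof (rule ccontr)
    assume "\<not> red \<phi> dvd red g"
    from bezout_red[OF phi_irreducible this]
    obtain u v q where uvq: "u * g + v * \<phi> = 1 + Polynomial.smult (int p) q" by (elim exE)
    have "0 < w (ev g * ev u)" "0 < w (ev \<phi> * ev v)"
      by (intro w_mult_pos ev_mem pos phi_pos w_ev_nonneg)+
    hence "0 < w (ev (u * g + v * \<phi>))"
      unfolding ev_add ev_mult mult.commute[of "ev u"] mult.commute[of "ev v"]
      by (intro W.w_add_gt W.mult_mem ev_mem)
    hence "0 < w ((1 + ev (Polynomial.smult (int p) q)) - ev (Polynomial.smult (int p) q))"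
      unfolding uvq ev_add ev_1 by (intro W.w_diff_gt W.add_mem W.one_mem ev_mem w_smult_p_pos)
    thus False by simp
  qed
qed

lemma w_ev_eq_0: "\<not> red \<phi> dvd red g \<Longrightarrow> w (ev g) = 0"
  using w_ev_pos_iff[of g] w_ev_nonneg[of g] by (simp add: order.order_iff_strict)

lemma w_p_power: "w (of_nat p ^ k) = ereal (real k)"
  using W.w_eq_v[of "of_nat p ^ k"] W.of_nat_p_nonzero by (simp add: W.v_power)

text \<open>After extracting p^k, the reduction of the cofactor is nonzero of degree below that of
  \<phi>, hence not divisible by the reduction of \<phi> and of value 0 at \<alpha>. This translates
  the hypotheses on coefficient valuations into values of w.\<close>

lemma w_ev_small:
  assumes "Polynomial.degree g < Polynomial.degree \<phi>"
  shows "w (ev g) = ereal_of_enat (poly_val p g)"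
proof (cases "g = 0")
  case False
  obtain k f where kf: "g = Polynomial.smult (int p ^ k) f" "red f \<noteq> 0" "poly_val p g = enat k"
    using poly_val_decompose[OF False] .
  have "Polynomial.degree f < Polynomial.degree \<phi>" using assms W.p_pos unfolding kf(1) by simp
  hence "w (ev f) = 0" using kf(2) by (intro w_ev_eq_0 red_not_dvd_small phi_monic)
  moreover have "ev g = of_nat p ^ k * ev f" unfolding kf(1) ev_smult by simp
  ultimately show ?thesis using kf(3) ev_mem by (simp add: W.w_mult w_p_power)
qed simp

lemma phi_nonzero: "red \<phi> \<noteq> 0"
  using phi_irreducible by auto

lemma degree_phi_pos: "Polynomial.degree \<phi> > 0"
proof (rule ccontr)
  assume "\<not> Polynomial.degree \<phi> > 0"
  hence "Polynomial.degree (red \<phi>) = 0" using degree_red_le[of \<phi>] by simp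
  moreover note phi_nonzero
  moreover have "\<not> is_unit (red \<phi>)" by (rule irreducible_not_unit[OF phi_irreducible])
  ultimately show False by (simp only: is_unit_iff_degree simp_thms)
qed

end

locale residual_setup = valuation_above p ty F \<alpha> \<phi> w
  for p :: nat and ty :: "'p :: prime_card itself" and F :: "int poly" and \<alpha> :: complex
    and \<phi> :: "int poly" and w :: "complex \<Rightarrow> ereal" +
  fixes l L :: nat and a :: "nat \<Rightarrow> int poly"
  assumes expansion: "phi_adic_expansion \<phi> F L a"
    and multiplicity: "red \<phi> ^ l dvd red F" "\<not> red \<phi> ^ Suc l dvd red F"
    and l_ge_2: "l \<ge> 2"
    and L_prop: "L_property p L a (exp_lambda p L a)"
begin

abbreviation s :: nat where "s \<equiv> L - l"

lemma l_le_L: "l \<le> L" and exp_s_eq: "exp_s p L a = s" and a_s: "red (a s) \<noteq> 0"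
  using expansion_exp_s[OF phi_monic phi_irreducible expansion multiplicity] by auto

lemma degree_a: "j \<le> L \<Longrightarrow> Polynomial.degree (a j) < Polynomial.degree \<phi>"
  using expansion by (simp add: phi_adic_expansion_def)

lemma F_expansion: "F = (\<Sum>j\<in>{0..L}. a j * \<phi> ^ (L - j))"
  using expansion by (simp add: phi_adic_expansion_def)

text \<open>As l \<ge> 2, the degree of F is at least twice that of \<phi>. Consequently neither
  \<phi>(\<alpha>) nor the last coefficient of the expansion vanishes, and the slope is
  finite.\<close>

lemma not_F_dvd_phi: "\<not> F dvd \<phi>"
proof
  assume "F dvd \<phi>"
  hence "Polynomial.degree F \<le> Polynomial.degree \<phi>"
    using phi_monic by (intro dvd_imp_degree_le) auto
  moreover have "Polynomial.degree (red \<phi> ^ l) \<le> Polynomial.degree (red F)"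
    using multiplicity lead_coeff_red_monic[OF monic] by (intro dvd_imp_degree_le) auto
  hence "l * Polynomial.degree \<phi> \<le> Polynomial.degree F"
    using degree_power_eq[OF phi_nonzero, of l] degree_red_monic[OF phi_monic] degree_red_monic[OF monic]
    by (simp add: mult.commute)
  moreover have "2 * Polynomial.degree \<phi> \<le> l * Polynomial.degree \<phi>" using l_ge_2 by simp
  ultimately show False using degree_phi_pos by linarith
qed

lemma a_L_nonzero: "a L \<noteq> 0"
proof
  assume "a L = 0"
  have "\<phi> dvd F" unfolding F_expansion
  proof (intro dvd_sum)
    fix j assume "j \<in> {0..L}"
    show "\<phi> dvd a j * \<phi> ^ (L - j)"
    proof (cases "j = L")
      case False
      hence "L - j > 0" using \<open>j \<in> {0..L}\<close> by simp
      thus ?thesis by (intro dvd_mult dvd_power) simp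
    qed (simp add: \<open>a L = 0\<close>)
  qed
  moreover have "\<not> is_unit \<phi>"
  proof
    assume "is_unit \<phi>"
    then obtain c where "\<phi> = [:c:]" unfolding is_unit_poly_iff by (elim exE conjE)
    hence "Polynomial.degree \<phi> = 0" by simp
    with degree_phi_pos show False by simp
  qed
  ultimately have "F dvd \<phi>" using irred irreducibleD' by blast
  with not_F_dvd_phi show False ..
qed

definition vl :: nat where "vl = the_enat (poly_val p (a L))"

lemma poly_val_a_L: "poly_val p (a L) = enat vl"
  using poly_val_decompose[OF a_L_nonzero] unfolding vl_def by (metis the_enat.simps)

abbreviation \<theta> :: complex where "\<theta> \<equiv> ev \<phi>"

lemma theta_nonzero: "\<theta> \<noteq> 0"
  using dvd_if_root[of \<phi>] not_F_dvd_phi by blast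

lemma theta_mem: "\<theta> \<in> adjoin_root \<alpha>"
  by (rule ev_mem)

lemma v_theta_pos: "W.v \<theta> > 0"
  using phi_pos W.w_eq_v[OF theta_mem theta_nonzero] by simp

definition t :: "nat \<Rightarrow> complex" where "t j = ev (a j) * \<theta> ^ (L - j)"

lemma t_mem: "t j \<in> adjoin_root \<alpha>"
  unfolding t_def by (intro W.mult_mem W.power_mem ev_mem)

lemma sum_t: "(\<Sum>j\<in>{0..L}. t j) = 0"
proof -
  have "(\<Sum>j\<in>{0..L}. t j) = ev F"
    unfolding t_def by (subst F_expansion) (simp only: ev_sum ev_mult ev_power)
  thus ?thesis by (simp only: root)
qed

lemma w_theta_power: "w (\<theta> ^ k) = ereal (real k * W.v \<theta>)"
  using W.w_eq_v[of "\<theta> ^ k"] theta_mem theta_nonzero by (simp add: W.v_power)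

lemma w_t: "w (t j) = w (ev (a j)) + ereal (real (L - j) * W.v \<theta>)"
  unfolding t_def using ev_mem W.w_mult[OF ev_mem W.power_mem[OF ev_mem]] by (simp only: w_theta_power)

lemma w_t_ge: "ereal (real (L - j) * W.v \<theta>) \<le> w (t j)"
  using add_mono[OF w_ev_nonneg order_refl] unfolding w_t by (metis add.left_neutral)

text \<open>\<open>L_property\<close> read through \<open>w_ev_small\<close>: the points (j,
  w(a_j(\<alpha>))) lie on or above the line of slope vl/l that starts at (s, 0).\<close>

lemma w_a_ge:
  assumes "s \<le> j" "j \<le> L"
  shows "ereal (real (j - s) * (real vl / real l)) \<le> w (ev (a j))"
proof (cases "j = s")
  case False
  define i where "i = j - s"
  have i: "i \<in> {1..l}" "i + s = j" using assms False l_le_L by (auto simp: i_def)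
  have l_eq: "L - s = l" using l_le_L by simp
  have "ereal_of_enat (poly_val p (a L)) / ereal (real l) \<le> ereal_of_enat (poly_val p (a j)) / ereal (real i)"
    using L_prop i unfolding L_property_def exp_lambda_def exp_s_eq l_eq by auto
  hence "ereal (real vl / real l) \<le> w (ev (a j)) / ereal (real i)"
    using w_ev_small[OF degree_a[OF assms(2)]] l_ge_2 unfolding poly_val_a_L by simp
  hence "ereal (real i) * ereal (real vl / real l) \<le> w (ev (a j))"
    using i(1) by (subst (asm) ereal_le_divide_pos) auto
  thus ?thesis by (simp add: i_def)
qed (use w_ev_nonneg in \<open>simp flip: zero_ereal_def\<close>)

lemma w_a_s: "w (ev (a s)) = 0"
  using w_ev_small[OF degree_a[of s]] a_s by (simp flip: poly_val_eq_0_iff)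

lemma w_a_L: "w (ev (a L)) = ereal (real vl)"
  using w_ev_small[OF degree_a[of L]] by (simp add: poly_val_a_L)

text \<open>The Newton polygon of \<open>F\<close> at \<open>\<phi>\<close> has only one side of positive slope.\<close>

lemma v_theta: "W.v \<theta> = real vl / real l"
proof (rule linorder_cases)
  let ?lam = "real vl / real l"
  have l: "real l * ?lam = real vl" using l_ge_2 by simp
  \<comment> \<open>If \<theta> has too small a value, the term at s alone attains the least value l
    v(\<theta>), and the sum cannot vanish.\<close>
  assume less: "W.v \<theta> < ?lam"
  have gt: "ereal (real l * W.v \<theta>) < w (t j)" if j: "j \<in> {0..L} - {s}" for j
  proof (cases "j < s")
    case True
    hence "real l * W.v \<theta> < real (L - j) * W.v \<theta>" using l_le_L v_theta_pos by simp
    thus ?thesis using w_t_ge[of j] by (metis ereal_less_eq(3) less_ereal.simps(1) order_less_le_trans)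
  next
    case False
    hence ij: "s \<le> j" "j \<le> L" "j - s > 0" using j by auto
    have "real l * W.v \<theta> = real (j - s) * W.v \<theta> + real (L - j) * W.v \<theta>"
      unfolding distrib_right[symmetric] of_nat_add[symmetric] using ij l_le_L by simp
    also have "\<dots> < real (j - s) * ?lam + real (L - j) * W.v \<theta>"
      using ij(3) less by (intro add_strict_right_mono mult_strict_left_mono) auto
    finally have "ereal (real l * W.v \<theta>) < ereal (real (j - s) * ?lam) + ereal (real (L - j) * W.v \<theta>)"
      by simp
    also have "\<dots> \<le> w (t j)" unfolding w_t by (intro add_mono w_a_ge[OF ij(1,2)] order_refl)
    finally show ?thesis .
  qed
  have "ereal (real l * W.v \<theta>) < w (\<Sum>j\<in>{0..L} - {s}. t j)"
    by (intro W.w_sum_gt t_mem gt) auto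
  also have "(\<Sum>j\<in>{0..L} - {s}. t j) = - t s"
    using sum_t sum.remove[of "{0..L}" s t] by (simp add: eq_neg_iff_add_eq_0 add.commute)
  also have "w (- t s) = w (t s)" by (rule W.w_uminus[OF t_mem])
  also have "\<dots> = ereal (real l * W.v \<theta>)" unfolding w_t w_a_s using l_le_L by simp
  finally show ?thesis by simp
next
  let ?lam = "real vl / real l"
  have l: "real l * ?lam = real vl" using l_ge_2 by simp
  \<comment> \<open>If \<theta> has too large a value, the term at L is the only one of least value,
    namely vl.\<close>
  assume less: "?lam < W.v \<theta>"
  have gt: "ereal (real vl) < w (t j)" if j: "j \<in> {0..L} - {L}" for j
  proof (cases "j < s")
    case True
    have "real l * ?lam < real l * W.v \<theta>" using less l_ge_2 by (intro mult_strict_left_mono) auto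
    also have "real l * W.v \<theta> < real (L - j) * W.v \<theta>" using True l_le_L v_theta_pos by simp
    finally show ?thesis using w_t_ge[of j] unfolding l by (metis ereal_less_eq(3) less_ereal.simps(1) order_less_le_trans)
  next
    case False
    hence ij: "s \<le> j" "j \<le> L" "L - j > 0" using j by auto
    have "real vl = real l * ?lam" by (rule l[symmetric])
    also have "\<dots> = real (j - s) * ?lam + real (L - j) * ?lam"
      unfolding distrib_right[symmetric] of_nat_add[symmetric] using ij l_le_L by simp
    also have "\<dots> < real (j - s) * ?lam + real (L - j) * W.v \<theta>"
      using ij(3) less by (intro add_strict_left_mono mult_strict_left_mono) auto
    finally have "ereal (real vl) < ereal (real (j - s) * ?lam) + ereal (real (L - j) * W.v \<theta>)"
      by simp
    also have "\<dots> \<le> w (t j)" unfolding w_t by (intro add_mono w_a_ge[OF ij(1,2)] order_refl)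
    finally show ?thesis .
  qed
  have "ereal (real vl) < w (\<Sum>j\<in>{0..L} - {L}. t j)"
    by (intro W.w_sum_gt t_mem gt) auto
  also have "(\<Sum>j\<in>{0..L} - {L}. t j) = - t L"
    using sum_t sum.remove[of "{0..L}" L t] by (simp add: eq_neg_iff_add_eq_0 add.commute)
  also have "w (- t L) = w (t L)" by (rule W.w_uminus[OF t_mem])
  also have "\<dots> = ereal (real vl)" unfolding w_t w_a_L by simp
  finally show ?thesis by simp
qed

end

section \<open>The residual equation\<close>

context residual_setup
begin

abbreviation d :: nat where "d \<equiv> exp_d p L a"
abbreviation e :: nat where "e \<equiv> exp_e p L a"
abbreviation h :: nat where "h \<equiv> exp_h p L a"

lemma L_minus_s: "L - s = l"
  using l_le_L by simp

lemma d_eq: "d = gcd vl l"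
  by (simp add: exp_d_def poly_val_a_L exp_s_eq L_minus_s)

lemma d_pos: "d > 0"
  unfolding d_eq using l_ge_2 by simp

lemma e_times_d: "e * d = l"
  unfolding exp_e_def exp_s_eq L_minus_s d_eq by simp

lemma h_times_d: "h * d = vl"
  unfolding exp_h_def poly_val_a_L d_eq by simp

lemma e_pos: "e > 0"
  using e_times_d l_ge_2 by (cases e) auto

lemma coprime_e_h: "coprime e h"
proof -
  have "coprime (l div gcd l vl) (vl div gcd l vl)"
    using l_ge_2 by (intro div_gcd_coprime) simp
  thus ?thesis unfolding exp_e_def exp_h_def exp_s_eq L_minus_s poly_val_a_L d_eq
    by (simp add: gcd.commute)
qed

lemma slope_eq: "real vl / real l = real h / real e"
proof -
  have "real vl = real h * real d" "real l = real e * real d"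
    by (simp_all only: h_times_d e_times_d flip: of_nat_mult)
  thus ?thesis using d_pos by simp
qed

lemma v_theta_eq: "W.v \<theta> = real h / real e"
  unfolding v_theta by (rule slope_eq)

definition \<gamma> :: complex where "\<gamma> = \<theta> ^ e / of_nat p ^ h"

lemma gamma_mem: "\<gamma> \<in> adjoin_root \<alpha>"
  unfolding \<gamma>_def by (intro W.divide_mem W.power_mem theta_mem W.of_nat_mem)

lemma w_gamma: "w \<gamma> = 0"
proof -
  have pn: "of_nat p ^ h \<noteq> (0::complex)" using W.of_nat_p_nonzero by (rule power_not_zero)
  have gn: "\<gamma> \<noteq> 0" unfolding \<gamma>_def using pn theta_nonzero by simp
  have "W.v \<gamma> = real e * W.v \<theta> - real h"
    unfolding \<gamma>_def
    using W.v_divide[OF W.power_mem[OF theta_mem, of e] W.power_mem[OF W.of_nat_mem, of p h] power_not_zero[OF theta_nonzero] pn]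
      W.v_power[OF theta_mem theta_nonzero, of e] W.v_power[OF W.of_nat_mem W.of_nat_p_nonzero, of h] by simp
  also have "\<dots> = 0" unfolding v_theta_eq using e_pos by simp
  finally show ?thesis using W.w_eq_v[OF gamma_mem gn] by simp
qed

text \<open>Lifts to Z[X] of the coefficients of the residual polynomial.\<close>

definition b :: "nat \<Rightarrow> int poly" where
  "b k = a (k * e + s) div [:int p ^ (k * h):]"

lemma index_le: "k \<le> d \<Longrightarrow> k * e \<le> l"
  using mult_le_mono1[of k d e] unfolding e_times_d[symmetric] mult.commute[of e d] .

text \<open>At the index k e + s the line has the integral height k h, so the coefficient is
  divisible by p^(k h) and the division in \<open>b\<close> is exact.\<close>

lemma a_eq_smult_b:
  assumes k: "k \<le> d"
  shows "a (k * e + s) = Polynomial.smult (int p ^ (k * h)) (b k)"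
proof -
  let ?j = "k * e + s"
  have j: "s \<le> ?j" "?j \<le> L" using index_le[OF k] l_le_L by linarith+
  have "real (?j - s) * (real vl / real l) = real (k * h)"
    unfolding slope_eq using e_pos by simp
  hence "ereal (real (k * h)) \<le> ereal_of_enat (poly_val p (a ?j))"
    using w_a_ge[OF j] w_ev_small[OF degree_a[OF j(2)]] by simp
  hence "enat (k * h) \<le> poly_val p (a ?j)" by (cases "poly_val p (a ?j)") (simp_all del: of_nat_mult)
  from poly_val_ge_imp_dvd[OF this] obtain g where g: "a ?j = Polynomial.smult (int p ^ (k * h)) g" ..
  hence "a ?j = [:int p ^ (k * h):] * g" by simp
  moreover have "[:int p ^ (k * h):] \<noteq> 0" using W.p_pos by simp
  hence "[:int p ^ (k * h):] * g div [:int p ^ (k * h):] = g" by (rule nonzero_mult_div_cancel_left)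
  ultimately have "b k = g" unfolding b_def by (simp only:)
  thus ?thesis using g by simp
qed

text \<open>Every term on the side carries the same power of p: k h from the coefficient and h (d -
  k) from \<theta>^(e (d - k)) = p^(h (d - k)) \<gamma>^(d - k), altogether d h = vl.\<close>

lemma t_on_side:
  assumes k: "k \<le> d"
  shows "t (k * e + s) = of_nat p ^ vl * (ev (b k) * \<gamma> ^ (d - k))"
proof -
  have "L - (k * e + s) = l - k * e" using l_le_L by simp
  also have "\<dots> = e * (d - k)" unfolding e_times_d[symmetric] by (simp add: right_diff_distrib' mult.commute)
  finally have 1: "\<theta> ^ (L - (k * e + s)) = (\<theta> ^ e) ^ (d - k)" by (simp add: power_mult)
  have "\<theta> ^ e = of_nat p ^ h * \<gamma>" unfolding \<gamma>_def using W.of_nat_p_nonzero by simp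
  hence 2: "(\<theta> ^ e) ^ (d - k) = of_nat p ^ (h * (d - k)) * \<gamma> ^ (d - k)"
    by (simp add: power_mult_distrib power_mult)
  have "vl = k * h + h * (d - k)" unfolding h_times_d[symmetric] using k
    by (simp add: right_diff_distrib' mult.commute)
  hence 3: "of_nat p ^ vl = (of_nat p ^ (k * h) * of_nat p ^ (h * (d - k)) :: complex)"
    by (simp only: power_add)
  have "ev (a (k * e + s)) = of_nat p ^ (k * h) * ev (b k)"
    unfolding a_eq_smult_b[OF k] ev_smult by simp
  thus ?thesis unfolding t_def 1 2 3 by (simp only: mult_ac)
qed

text \<open>Before s, the higher power of \<theta> suffices. After s, an index with e not dividing j
  - s has non-integral height (j - s) h / e, as e and h are coprime, and the integral or infinite
  value of a_j lies strictly above the line.\<close>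

lemma w_t_off_side:
  assumes j: "j \<le> L" and off: "\<And>k. k \<le> d \<Longrightarrow> j \<noteq> k * e + s"
  shows "ereal (real vl) < w (t j)"
proof (cases "j < s")
  case True
  have "real vl = real l * W.v \<theta>" unfolding v_theta using l_ge_2 by simp
  also have "\<dots> < real (L - j) * W.v \<theta>" using True l_le_L v_theta_pos by simp
  finally show ?thesis using w_t_ge[of j] by (metis ereal_less_eq(3) less_ereal.simps(1) order_less_le_trans)
next
  case False
  define i where "i = j - s"
  have i: "i \<le> l" "j = i + s" "L - j = l - i" using False j l_le_L by (auto simp: i_def)
  have ndvd: "\<not> e dvd i"
  proof
    assume "e dvd i"
    then obtain k where k: "i = e * k" ..
    have "e * k \<le> e * d" using i(1) k e_times_d by simp
    hence "k \<le> d" using e_pos by simp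
    thus False using off[of k] i(2) k by (simp add: mult.commute)
  qed
  have "ereal (real i * (real vl / real l)) < w (ev (a j))"
  proof (cases "poly_val p (a j)")
    case (enat n)
    hence n: "w (ev (a j)) = ereal (real n)" using w_ev_small[OF degree_a[OF j]] by simp
    have "real i * (real vl / real l) \<le> real n"
      using w_a_ge[of j] False j i(2) unfolding n by simp
    moreover have "real i * (real vl / real l) \<noteq> real n"
    proof
      assume "real i * (real vl / real l) = real n"
      hence "real i * real h = real n * real e" unfolding slope_eq using e_pos by (simp add: field_simps)
      hence "i * h = n * e" by (simp flip: of_nat_mult)
      hence "e dvd i * h" by simp
      hence "e dvd i" using coprime_e_h by (simp add: coprime_dvd_mult_left_iff)
      with ndvd show False ..
    qed
    ultimately show ?thesis unfolding n by simp
  qed (use w_ev_small[OF degree_a[OF j]] in simp)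
  moreover have "ereal (real vl) = ereal (real i * (real vl / real l)) + ereal (real (L - j) * W.v \<theta>)"
  proof -
    have "real i * (real vl / real l) + real (L - j) * W.v \<theta> = real (i + (l - i)) * (real vl / real l)"
      unfolding v_theta i(3) by (simp only: of_nat_add distrib_right)
    also have "\<dots> = real vl" using i(1) l_ge_2 by simp
    finally show ?thesis by simp
  qed
  ultimately show ?thesis unfolding w_t
    by (cases "w (ev (a j))") auto
qed

text \<open>Division of F(\<alpha>) = 0 by p^vl: the terms on the side become the lifted residual
  polynomial at \<gamma>, and those off the side have positive value.\<close>

lemma residual_equation: "0 < w (\<Sum>k\<le>d. ev (b k) * \<gamma> ^ (d - k))"
proof -
  let ?S = "\<Sum>k\<le>d. ev (b k) * \<gamma> ^ (d - k)"
  define f where "f k = k * e + s" for k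
  have inj: "inj_on f {..d}" using e_pos by (auto simp: inj_on_def f_def)
  have sub: "f ` {..d} \<subseteq> {0..L}"
  proof
    fix j assume "j \<in> f ` {..d}"
    then obtain k where "k \<le> d" "j = k * e + s" by (auto simp: f_def)
    thus "j \<in> {0..L}" using index_le[of k] l_le_L by auto
  qed
  have mem: "?S \<in> adjoin_root \<alpha>"
    by (intro W.sum_mem W.mult_mem W.power_mem ev_mem gamma_mem)
  have "of_nat p ^ vl * ?S = (\<Sum>k\<le>d. t (f k))"
    unfolding sum_distrib_left f_def by (intro sum.cong refl t_on_side[symmetric]) simp
  also have "\<dots> = (\<Sum>j\<in>f ` {..d}. t j)" using inj by (simp add: sum.reindex)
  also have "\<dots> = - (\<Sum>j\<in>{0..L} - f ` {..d}. t j)"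
    using sum_t sum.subset_diff[OF sub, of t] by (simp add: eq_neg_iff_add_eq_0 add.commute)
  also have "w \<dots> = w (\<Sum>j\<in>{0..L} - f ` {..d}. t j)"
    by (intro W.w_uminus W.sum_mem t_mem)
  also have "ereal (real vl) < \<dots>"
  proof (intro W.w_sum_gt t_mem)
    fix j assume "j \<in> {0..L} - f ` {..d}"
    thus "ereal (real vl) < w (t j)" by (intro w_t_off_side) (auto simp: f_def)
  qed simp
  finally have "ereal (real vl) < w (of_nat p ^ vl) + w ?S"
    using W.w_mult[OF W.power_mem[OF W.of_nat_mem] mem, of p vl] by simp
  thus ?thesis unfolding w_p_power by (cases "w ?S") (auto simp: zero_ereal_def)
qed

end

section \<open>Residue fields\<close>

text \<open>P has coefficients in R, while x and its minimal polynomial live over the image of R in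
  S. The minimal polynomial divides the image of P; pulling both factors back along the injection
  shows by irreducibility that the cofactor is constant, so the degrees agree.\<close>

lemma (in ring_hom_ring) dimension_simple_extension_of_root:
  assumes R: "field R" and S: "field S" and inj: "inj_on h (carrier R)"
    and P: "P \<in> carrier (poly_ring R)" "pirreducible\<^bsub>R\<^esub> (carrier R) P"
    and x: "x \<in> carrier S" "eval (map h P) x = \<zero>\<^bsub>S\<^esub>"
  shows "S.dimension (length P - 1) (h ` carrier R) (S.simple_extension (h ` carrier R) x)"
proof -
  interpret R: field R by (rule R)
  interpret S: field S by (rule S)
  let ?K = "h ` carrier R"
  have K: "subfield ?K S"
    using img_is_subfield(2)[OF R.carrier_is_subfield] by simp
  note Ks = subfieldE(1)[OF K]
  have h0: "h a = \<zero>\<^bsub>S\<^esub> \<Longrightarrow> a = \<zero>\<^bsub>R\<^esub>" if "a \<in> carrier R" for a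
    using inj_onD[OF inj, of a "\<zero>\<^bsub>R\<^esub>"] that by simp
  have lift_poly: "polynomial\<^bsub>S\<^esub> ?K (map h u)" if u: "polynomial\<^bsub>R\<^esub> (carrier R) u" for u
    using u h0 by (cases u) (auto simp: polynomial_def)
  have P': "polynomial\<^bsub>R\<^esub> (carrier R) P" "P \<noteq> []"
    using P(1) R.pirreducibleE(1)[OF R.carrier_is_subring P] by (auto simp: univ_poly_carrier)
  have hP: "map h P \<in> carrier (?K[X]\<^bsub>S\<^esub>)" "map h P \<noteq> []"
    using lift_poly[OF P'(1)] P'(2) by (auto simp flip: univ_poly_carrier)
  have alg: "(S.algebraic over ?K) x" by (rule S.algebraicI[OF hP x(2)])
  let ?g = "S.Irr ?K x"
  note g = S.IrrE[OF K x(1) alg]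
  have "?g divides\<^bsub>?K[X]\<^bsub>S\<^esub>\<^esub> map h P"
    using S.Irr_minimal[OF K x(1) alg hP(1) x(2)] S.pdivides_iff_shell[OF K g(1) hP(1)] by simp
  then obtain q where q: "q \<in> carrier (?K[X]\<^bsub>S\<^esub>)" "map h P = S.poly_mult ?g q"
    unfolding factor_def univ_poly_mult by blast
  define pull where "pull u = map (inv_into (carrier R) h) u" for u
  have pull: "polynomial\<^bsub>R\<^esub> (carrier R) (pull u)" "map h (pull u) = u" "length (pull u) = length u"
    if u: "u \<in> carrier (?K[X]\<^bsub>S\<^esub>)" for u
  proof -
    have u': "set u \<subseteq> ?K" "u \<noteq> [] \<Longrightarrow> hd u \<noteq> \<zero>\<^bsub>S\<^esub>"
      using u by (auto simp: polynomial_def simp flip: univ_poly_carrier)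
    show "map h (pull u) = u" unfolding pull_def map_map
      by (rule map_idI) (use u'(1) in \<open>auto simp: f_inv_into_f\<close>)
    show "length (pull u) = length u" by (simp add: pull_def)
    show "polynomial\<^bsub>R\<^esub> (carrier R) (pull u)"
    proof (cases u)
      case (Cons c cs)
      have "inv_into (carrier R) h c \<noteq> \<zero>\<^bsub>R\<^esub>"
        using u' Cons f_inv_into_f[of c h "carrier R"] by auto
      moreover have "set (pull u) \<subseteq> carrier R"
        using u'(1) by (auto simp: pull_def intro: inv_into_into)
      ultimately show ?thesis using Cons by (simp add: polynomial_def pull_def)
    qed (simp add: pull_def polynomial_def)
  qed
  note g0 = pull[OF g(1)] and q0 = pull[OF q(1)]
  have carr: "set (pull ?g) \<subseteq> carrier R" "set (pull q) \<subseteq> carrier R"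
    using g0(1) q0(1) by (auto simp: polynomial_def)
  let ?m = "R.poly_mult (pull ?g) (pull q)"
  have m: "polynomial\<^bsub>R\<^esub> (carrier R) ?m"
    by (rule R.poly_mult_closed[OF R.carrier_is_subring g0(1) q0(1)])
  have "S.normalize (map h ?m) = map h P"
    using poly_mult_hom'[OF carr] unfolding g0(2) q0(2) q(2) .
  hence "map h ?m = map h P" using S.normalize_polynomial[OF lift_poly[OF m]] by simp
  moreover have "set ?m \<subseteq> carrier R" "set P \<subseteq> carrier R"
    using m P'(1) by (auto simp: polynomial_def)
  ultimately have m_eq: "?m = P"
    using inj by (metis inj_on_subset le_sup_iff map_inj_on)
  have "pull ?g \<in> Units (poly_ring R) \<or> pull q \<in> Units (poly_ring R)"
    using R.pirreducibleE(3)[OF R.carrier_is_subring P, of "pull ?g" "pull q"] g0(1) q0(1) m_eq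
    by (simp add: univ_poly_carrier univ_poly_mult)
  hence "length ?g - 1 = 0 \<or> length q - 1 = 0"
    using R.univ_poly_units'[OF R.carrier_is_subfield] g0(3) q0(3) by metis
  moreover have "length ?g - 1 \<ge> 1" by (rule S.pirreducible_degree[OF K g(1,2)])
  ultimately have "length q - 1 = 0" by linarith
  moreover have "length (map h P) - 1 = (if ?g = [] \<or> q = [] then 0 else (length ?g - 1) + (length q - 1))"
    unfolding q(2) using g(1) q(1) by (intro S.poly_mult_degree_eq[OF Ks]) (simp_all add: univ_poly_carrier)
  moreover have "set ?g \<subseteq> carrier S"
    using g(1) subringE(1)[OF Ks] by (auto simp: polynomial_def simp flip: univ_poly_carrier)
  hence "?g \<noteq> []" "q \<noteq> []" using hP(2) q(2) S.poly_mult_zero(2)[of ?g] by auto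
  ultimately have "length P - 1 = length ?g - 1" by simp
  thus ?thesis using S.dimension_simple_extension[OF K x(1) alg] by simp
qed

context ext_valuation
begin

abbreviation R :: "complex ring" where "R \<equiv> val_ring K w"
abbreviation I :: "complex set" where "I \<equiv> val_ideal K w"
abbreviation k :: "complex set ring" where "k \<equiv> val_residue_field K w"
abbreviation k0 :: "complex set set" where "k0 \<equiv> val_base_residue_field K w"
abbreviation res :: "complex \<Rightarrow> complex set" where "res x \<equiv> I +>\<^bsub>R\<^esub> x"

lemma R_simps: "carrier R = {x \<in> K. 0 \<le> w x}" "x \<otimes>\<^bsub>R\<^esub> y = x * y" "x \<oplus>\<^bsub>R\<^esub> y = x + y"
    "\<one>\<^bsub>R\<^esub> = 1" "\<zero>\<^bsub>R\<^esub> = 0"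
  by (simp_all add: val_ring_def ring_of_type_algebra_def)

lemma R_cring: "cring R"
proof (rule cringI[OF abelian_groupI comm_monoidI])
  show "\<exists>y\<in>carrier R. y \<oplus>\<^bsub>R\<^esub> x = \<zero>\<^bsub>R\<^esub>" if "x \<in> carrier R" for x
    using that by (intro bexI[of _ "- x"]) (auto simp: R_simps w_uminus)
qed (auto simp: R_simps w_mult algebra_simps intro: w_add_ge)

lemma R_minus: "x \<in> carrier R \<Longrightarrow> y \<in> carrier R \<Longrightarrow> x \<ominus>\<^bsub>R\<^esub> y = x - y"
proof -
  interpret R: cring R by (rule R_cring)
  assume xy: "x \<in> carrier R" "y \<in> carrier R"
  have "\<ominus>\<^bsub>R\<^esub> y = - y" using xy
    by (intro R.minus_equality) (auto simp: R_simps w_uminus)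
  thus ?thesis by (simp add: a_minus_def R_simps)
qed

lemma I_ideal: "ideal I R"
proof -
  interpret R: cring R by (rule R_cring)
  show ?thesis
  proof (rule idealI[OF R.ring_axioms])
    show "subgroup I (add_monoid R)"
    proof (rule R.add.subgroupI)
      show "I \<subseteq> carrier R" by (auto simp: val_ideal_def R_simps)
      show "I \<noteq> {}" by (auto simp: val_ideal_def intro: exI[of _ 0])
      fix x assume x: "x \<in> I"
      hence "x \<in> carrier R" by (auto simp: val_ideal_def R_simps)
      hence "\<ominus>\<^bsub>R\<^esub> x = - x" 
        by (intro R.minus_equality) (auto simp: R_simps w_uminus)
      thus "\<ominus>\<^bsub>R\<^esub> x \<in> I" using x by (simp add: val_ideal_def w_uminus)
      fix y assume "y \<in> I"
      thus "x \<oplus>\<^bsub>R\<^esub> y \<in> I" using x by (auto simp: R_simps val_ideal_def intro: w_add_gt)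
    qed
  next
    fix a x assume "a \<in> I" "x \<in> carrier R"
    hence "a \<in> K" "x \<in> K" "0 < w a" "0 \<le> w x" by (auto simp: val_ideal_def R_simps)
    hence "a * x \<in> I" by (auto simp: val_ideal_def w_mult add_pos_nonneg)
    thus "x \<otimes>\<^bsub>R\<^esub> a \<in> I" "a \<otimes>\<^bsub>R\<^esub> x \<in> I" by (simp_all add: R_simps mult.commute)
  qed
qed

text \<open>An element of J outside I has value 0, so its inverse lies in R and J contains
  1.\<close>

lemma I_maximal: "maximalideal I R"
proof (rule maximalidealI[OF I_ideal])
  have "1 \<in> carrier R" "1 \<notin> I" by (simp_all add: R_simps val_ideal_def)
  thus "carrier R \<noteq> I" by metis
next
  fix J assume J: "ideal J R" "I \<subseteq> J" "J \<subseteq> carrier R"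
  interpret J: ideal J R by (rule J(1))
  show "J = I \<or> J = carrier R"
  proof (cases "J = I")
    case False
    then obtain x where x: "x \<in> J" "x \<notin> I" using J(2) by blast
    hence xK: "x \<in> K" "w x = 0" using J(3) by (auto simp: R_simps val_ideal_def)
    hence x0: "x \<noteq> 0" by auto
    have "v x = 0" using w_eq_v[OF xK(1) x0] xK(2) by simp
    hence "w (inverse x) = 0" using w_eq_v[of "inverse x"] v_inverse[OF xK(1) x0] xK(1) x0 by simp
    hence x': "x \<in> K" "x \<noteq> 0" "w (inverse x) = 0" using xK(1) x0 by simp_all
    hence "x * inverse x \<in> J" using J.I_r_closed[OF x(1), of "inverse x"] by (simp add: R_simps)
    hence "\<one>\<^bsub>R\<^esub> \<in> J" using x' by (simp add: R_simps)
    thus ?thesis using J.one_imp_carrier by blast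
  qed simp
qed

lemma k_field: "field k"
  unfolding val_residue_field_def by (rule maximalideal.quotient_is_field[OF I_maximal R_cring])

lemma res_hom: "ring_hom_ring R k res"
  unfolding val_residue_field_def by (rule ideal.rcos_ring_hom_ring[OF I_ideal])

lemma carrier_k: "carrier k = res ` carrier R"
  unfolding val_residue_field_def FactRing_def A_RCOSETS_def' by auto

lemma res_eq_iff: "x \<in> carrier R \<Longrightarrow> y \<in> carrier R \<Longrightarrow> res x = res y \<longleftrightarrow> 0 < w (x - y)"
proof -
  interpret R: cring R by (rule R_cring)
  assume xy: "x \<in> carrier R" "y \<in> carrier R"
  have "res x = res y \<longleftrightarrow> x \<ominus>\<^bsub>R\<^esub> y \<in> I" using R.quotient_eq_iff_same_a_r_cos[OF I_ideal xy] by simp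
  thus ?thesis using xy by (simp add: R_minus val_ideal_def R_simps)
qed

lemma res_in_k: "x \<in> carrier R \<Longrightarrow> res x \<in> carrier k"
  by (simp add: carrier_k)

lemma res_zero: "res 0 = \<zero>\<^bsub>k\<^esub>"
proof -
  interpret h: ring_hom_ring R k res by (rule res_hom)
  show ?thesis using h.hom_zero by (simp add: R_simps)
qed

lemma res_one: "res 1 = \<one>\<^bsub>k\<^esub>"
  using ring_hom_one[OF ring_hom_ring.homh[OF res_hom]] by (simp add: R_simps)

lemma res_eq_zero_iff: "x \<in> carrier R \<Longrightarrow> res x = \<zero>\<^bsub>k\<^esub> \<longleftrightarrow> 0 < w x"
  using res_eq_iff[of x 0] res_zero by (simp add: R_simps)

lemma res_add: "x \<in> carrier R \<Longrightarrow> y \<in> carrier R \<Longrightarrow> res (x + y) = res x \<oplus>\<^bsub>k\<^esub> res y"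
  using ring_hom_add[OF ring_hom_ring.homh[OF res_hom], of x y] by (simp add: R_simps)

lemma res_mult: "x \<in> carrier R \<Longrightarrow> y \<in> carrier R \<Longrightarrow> res (x * y) = res x \<otimes>\<^bsub>k\<^esub> res y"
  using ring_hom_mult[OF ring_hom_ring.homh[OF res_hom], of x y] by (simp add: R_simps)

lemma of_int_in_R: "of_int c \<in> carrier R"
  by (simp add: R_simps w_of_int_nonneg)

lemma R_mult_mem: "x \<in> carrier R \<Longrightarrow> y \<in> carrier R \<Longrightarrow> x * y \<in> carrier R"
  by (simp add: R_simps w_mult)

lemma R_add_mem: "x \<in> carrier R \<Longrightarrow> y \<in> carrier R \<Longrightarrow> x + y \<in> carrier R"
  by (simp add: R_simps w_add_ge)

lemma inverse_mod_p:
  assumes "\<not> int p dvd c"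
  shows "\<exists>c' q. c * c' = 1 + int p * q"
proof -
  have "coprime (int p) c" using assms prime_int_p by (intro prime_imp_coprime)
  hence "gcd c (int p) = 1" by (simp add: coprime_iff_gcd_eq_1 gcd.commute)
  then obtain u v where "u * c + v * int p = 1" by (metis bezout_int)
  hence "c * u = 1 + int p * (- v)" by (simp add: algebra_simps)
  thus ?thesis by (intro exI)
qed

text \<open>A fraction m/n in lowest terms of nonnegative value has n prime to p, and m n' has the
  same residue when n' inverts n modulo p. So integers suffice as coefficients over the prime
  field.\<close>

lemma k0_eq: "k0 = res ` range of_int"
proof
  show "res ` range of_int \<subseteq> k0"
    unfolding val_base_residue_field_def val_ring_def using w_of_int_nonneg
    by (auto intro!: imageI simp: Rats_of_int)
  show "k0 \<subseteq> res ` range of_int"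
  proof
    fix y assume "y \<in> k0"
    then obtain x where x: "x \<in> \<rat>" "0 \<le> w x" "y = res x"
      by (auto simp: val_base_residue_field_def val_ring_def)
    obtain q where q: "x = of_rat q" using x(1) by (auto simp: Rats_def)
    obtain m n where mn: "quotient_of q = (m, n)" by (cases "quotient_of q")
    have n: "n > 0" "q = of_int m / of_int n" "coprime m n"
      using quotient_of_denom_pos[OF mn] quotient_of_div[OF mn] quotient_of_coprime[OF mn] .
    have xn: "x * of_int n = of_int m" unfolding q n(2) using n(1) by (simp add: of_rat_divide)
    have xK: "x \<in> K" by (simp add: q)
    have "\<not> int p dvd n"
    proof
      assume pn: "int p dvd n"
      hence "0 < w (of_int n)" by (simp add: w_of_int_pos_iff)
      hence "0 < w (of_int m)" unfolding xn[symmetric] using x(2) xK by (simp add: w_mult add_nonneg_pos)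
      hence "int p dvd m" by (simp add: w_of_int_pos_iff)
      with pn n(3) have "is_unit (int p)" by (rule coprime_common_divisor[rotated 2])
      thus False using prime_int_p by auto
    qed
    then obtain n' c where nc: "n * n' = 1 + int p * c" using inverse_mod_p by blast
    have "x - of_int (m * n') = x * (1 - of_int (n * n'))"
      unfolding of_int_mult xn[symmetric] by (simp add: algebra_simps)
    also have "\<dots> = x * of_int (- (int p * c))" unfolding nc by simp
    finally have "w (x - of_int (m * n')) = w x + w (of_int (- (int p * c)))"
      by (simp only: w_mult[OF xK of_int_mem])
    moreover have "0 < w (of_int (- (int p * c)))" unfolding w_of_int_pos_iff by simp
    ultimately have "0 < w (x - of_int (m * n'))" using x(2) by (simp only: add_nonneg_pos)
    hence "res x = res (of_int (m * n'))"
      using res_eq_iff[OF _ of_int_in_R, of x "m * n'"] x(2) xK by (simp add: R_simps)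
    hence "y = res (of_int (m * n'))" by (simp only: x(3))
    thus "y \<in> res ` range of_int" by (rule image_eqI[OF _ rangeI])
  qed
qed

lemma k0_memI: "res (of_int c) \<in> k0"
  unfolding k0_eq by (intro imageI rangeI)

lemma k0_memE: "x \<in> k0 \<Longrightarrow> (\<And>c. x = res (of_int c) \<Longrightarrow> thesis) \<Longrightarrow> thesis"
  unfolding k0_eq by auto

lemma k0_subfield: "subfield k0 k"
proof -
  interpret k: field k by (rule k_field)
  have sub: "k0 \<subseteq> carrier k" using res_in_k[OF of_int_in_R] by (auto elim!: k0_memE)
  show ?thesis
  proof (rule k.subfieldI')
    show "subring k0 k"
    proof (rule k.subringI[OF sub])
      show "\<one>\<^bsub>k\<^esub> \<in> k0" using k0_memI[of 1] res_one by simp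
    next
      fix x assume "x \<in> k0"
      then obtain c where c: "x = res (of_int c)" by (auto elim: k0_memE)
      have "res (of_int (- c)) \<oplus>\<^bsub>k\<^esub> res (of_int c) = res (of_int (- c) + of_int c)"
        by (rule res_add[OF of_int_in_R of_int_in_R, symmetric])
      also have "\<dots> = \<zero>\<^bsub>k\<^esub>" by (simp add: res_zero)
      finally have "\<ominus>\<^bsub>k\<^esub> x = res (of_int (- c))"
        unfolding c by (intro k.minus_equality res_in_k of_int_in_R)
      thus "\<ominus>\<^bsub>k\<^esub> x \<in> k0" by (simp only: k0_memI)
      fix y assume "y \<in> k0"
      then obtain c' where c': "y = res (of_int c')" by (rule k0_memE)
      have "x \<otimes>\<^bsub>k\<^esub> y = res (of_int (c * c'))" "x \<oplus>\<^bsub>k\<^esub> y = res (of_int (c + c'))"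
        unfolding c c' of_int_mult of_int_add by (simp_all only: res_mult res_add of_int_in_R)
      thus "x \<otimes>\<^bsub>k\<^esub> y \<in> k0" "x \<oplus>\<^bsub>k\<^esub> y \<in> k0" by (simp_all only: k0_memI)
    qed
  next
    fix x assume x: "x \<in> k0 - {\<zero>\<^bsub>k\<^esub>}"
    then obtain c where c: "x = res (of_int c)" by (auto elim: k0_memE)
    hence "\<not> int p dvd c" using x res_eq_zero_iff[OF of_int_in_R, of c] by (simp add: w_of_int_pos_iff)
    from inverse_mod_p[OF this] obtain c' q where q: "c * c' = 1 + int p * q" by (elim exE)
    have "(of_int c * of_int c' - 1 :: complex) = of_int (c * c' - 1)" by simp
    also have "0 < w \<dots>" unfolding w_of_int_pos_iff q by simp
    finally have "res (of_int c * of_int c') = res 1"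
      using res_eq_iff[of "of_int c * of_int c'" 1] R_mult_mem[OF of_int_in_R of_int_in_R] of_int_in_R[of 1] by simp
    hence "x \<otimes>\<^bsub>k\<^esub> res (of_int c') = \<one>\<^bsub>k\<^esub>"
      unfolding c using res_mult[OF of_int_in_R of_int_in_R] res_one by simp
    hence "inv\<^bsub>k\<^esub> x = res (of_int c')"
      unfolding c by (intro k.comm_inv_char res_in_k of_int_in_R)
    thus "inv\<^bsub>k\<^esub> x \<in> k0" by (simp only: k0_memI)
  qed
qed

lemma sum_list_in_R: "set xs \<subseteq> carrier R \<Longrightarrow> sum_list xs \<in> carrier R"
  using of_int_in_R[of 0] by (induction xs) (simp_all add: R_add_mem)

lemma sum_in_R: "(\<And>i. i \<in> A \<Longrightarrow> f i \<in> carrier R) \<Longrightarrow> sum f A \<in> carrier R"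
  using of_int_in_R[of 0] by (induction A rule: infinite_finite_induct) (simp_all add: R_add_mem)

lemma map2_mult_in_R: "set xs \<subseteq> carrier R \<Longrightarrow> set ys \<subseteq> carrier R \<Longrightarrow> set (map2 (*) xs ys) \<subseteq> carrier R"
proof
  fix z assume *: "set xs \<subseteq> carrier R" "set ys \<subseteq> carrier R" "z \<in> set (map2 (*) xs ys)"
  then obtain x y where "z = x * y" "(x, y) \<in> set (zip xs ys)" by auto
  moreover from this(2) have "x \<in> set xs" "y \<in> set ys" by (auto dest: set_zip_leftD set_zip_rightD)
  ultimately show "z \<in> carrier R" using * by (metis R_mult_mem subsetD)
qed

lemma combine_res:
  "set xs \<subseteq> carrier R \<Longrightarrow> set ys \<subseteq> carrier R \<Longrightarrow>
    ring.combine k (map res xs) (map res ys) = res (sum_list (map2 (*) xs ys))"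
proof (induction xs arbitrary: ys)
  case Nil
  interpret k: field k by (rule k_field)
  show ?case by (simp add: res_zero)
next
  case (Cons x xs)
  interpret k: field k by (rule k_field)
  show ?case
  proof (cases ys)
    case (Cons y ys')
    have "x * y \<in> carrier R" using Cons.prems Cons by (simp add: R_mult_mem)
    moreover have "sum_list (map2 (*) xs ys') \<in> carrier R"
      using Cons.prems Cons by (intro sum_list_in_R map2_mult_in_R) simp_all
    ultimately show ?thesis using Cons Cons.prems Cons.IH[of ys'] by (simp add: res_add res_mult)
  qed (simp add: res_zero)
qed

lemma eval_res:
  assumes "set xs \<subseteq> carrier R" "y \<in> carrier R"
  shows "ring.eval k (map res xs) (res y) = res (\<Sum>i<length xs. xs ! i * y ^ (length xs - Suc i))"
  using assms(1)
proof (induction xs)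
  case Nil
  interpret k: field k by (rule k_field)
  show ?case by (simp add: res_zero)
next
  case (Cons x xs)
  interpret k: field k by (rule k_field)
  have pow: "y ^ n \<in> carrier R \<and> res (y ^ n) = res y [^]\<^bsub>k\<^esub> n" for n
  proof (induction n)
    case (Suc n)
    thus ?case using res_mult[of "y ^ n" y] R_mult_mem[of "y ^ n" y] assms(2) by (simp add: mult.commute)
  qed (use of_int_in_R[of 1] res_one in simp)
  have "(\<Sum>i<length xs. xs ! i * y ^ (length xs - Suc i)) \<in> carrier R"
  proof (intro sum_in_R R_mult_mem)
    fix i assume "i \<in> {..<length xs}"
    hence "xs ! i \<in> set xs" by simp
    thus "xs ! i \<in> carrier R" using Cons.prems by (meson list.set_intros(2) subsetD)
    show "y ^ (length xs - Suc i) \<in> carrier R" using pow by blast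
  qed
  moreover have "(\<Sum>i<length (x # xs). (x # xs) ! i * y ^ (length (x # xs) - Suc i))
      = x * y ^ length xs + (\<Sum>i<length xs. xs ! i * y ^ (length xs - Suc i))"
    by (subst length_Cons, subst sum.lessThan_Suc_shift) simp
  ultimately show ?case using Cons pow R_mult_mem[of x "y ^ length xs"]
    by (simp add: res_add res_mult)
qed

end

section \<open>Residually independent elements\<close>

text \<open>Independence of the residues over the prime field, expressed by integer combinations in
  K as in \<open>free_family\<close>. For elements of the valuation ring it is equivalent to
  independence in the residue field.\<close>

definition residually_independent :: "nat \<Rightarrow> (complex \<Rightarrow> ereal) \<Rightarrow> complex list \<Rightarrow> bool" where
  "residually_independent p w ys \<longleftrightarrow> (\<forall>c::nat \<Rightarrow> int. (\<exists>i<length ys. \<not> int p dvd c i) \<longrightarrow>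
     w (\<Sum>i<length ys. of_int (c i) * ys ! i) \<le> 0)"

lemma sum_list_map2_mult:
  fixes xs ys :: "'a :: comm_semiring_0 list"
  assumes "length xs = length ys"
  shows "sum_list (map2 (*) xs ys) = (\<Sum>i<length ys. xs ! i * ys ! i)"
  using assms by (simp add: sum_list_sum_nth lessThan_atLeast0)

context ext_valuation
begin

lemma carrier_k_lift:
  assumes "set us \<subseteq> carrier k"
  shows "\<exists>ys. set ys \<subseteq> carrier R \<and> us = map res ys"
  using assms
proof (induction us)
  case (Cons u us)
  then obtain ys where "set ys \<subseteq> carrier R" "us = map res ys" by auto
  moreover obtain y where "y \<in> carrier R" "u = res y" using Cons.prems by (auto simp: carrier_k)
  ultimately show ?case by (intro exI[of _ "y # ys"]) simp
qed simp

lemma independent_imp_residually_independent: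
  assumes indep: "ring.independent k k0 (map res ys)" and ys: "set ys \<subseteq> carrier R"
  shows "residually_independent p w ys"
  unfolding residually_independent_def
proof (intro allI impI)
  interpret k: field k by (rule k_field)
  fix c :: "nat \<Rightarrow> int" assume c: "\<exists>i<length ys. \<not> int p dvd c i"
  let ?S = "\<Sum>i<length ys. of_int (c i) * ys ! i"
  show "w ?S \<le> 0"
  proof (rule ccontr)
    assume "\<not> w ?S \<le> 0"
    define xs where "xs = map (\<lambda>i. of_int (c i) :: complex) [0..<length ys]"
    have xs: "length xs = length ys" "set xs \<subseteq> carrier R" using of_int_in_R by (auto simp: xs_def)
    have S: "sum_list (map2 (*) xs ys) = ?S"
      unfolding sum_list_map2_mult[OF xs(1)] by (intro sum.cong) (simp_all add: xs_def)
    have SR: "?S \<in> carrier R" unfolding S[symmetric] using xs ys by (intro sum_list_in_R map2_mult_in_R)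
    have "k.combine (map res xs) (map res ys) = \<zero>\<^bsub>k\<^esub>"
      unfolding combine_res[OF xs(2) ys] S using res_eq_zero_iff[OF SR] \<open>\<not> w ?S \<le> 0\<close> by simp
    moreover have "set (map res xs) \<subseteq> k0" using k0_memI by (auto simp: xs_def)
    ultimately have "set (take (length (map res ys)) (map res xs)) \<subseteq> {\<zero>\<^bsub>k\<^esub>}"
      using k.independent_imp_trivial_combine[OF k0_subfield indep] by blast
    hence zero: "set (map res xs) \<subseteq> {\<zero>\<^bsub>k\<^esub>}" using xs(1) by simp
    have "int p dvd c i" if "i < length ys" for i
    proof -
      have "res (of_int (c i)) \<in> set (map res xs)" using that by (auto simp: xs_def)
      hence "res (of_int (c i)) = \<zero>\<^bsub>k\<^esub>" using zero by blast
      thus ?thesis using res_eq_zero_iff[OF of_int_in_R] by (simp add: w_of_int_pos_iff)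
    qed
    thus False using c by blast
  qed
qed

lemma residually_independent_imp_independent:
  assumes indep: "residually_independent p w ys" and ys: "set ys \<subseteq> carrier R"
  shows "ring.independent k k0 (map res ys)"
proof -
  interpret k: field k by (rule k_field)
  show ?thesis
  proof (rule k.trivial_combine_imp_independent[OF k0_subfield])
    show "set (map res ys) \<subseteq> carrier k" using ys res_in_k by auto
    fix Ks assume Ks: "set Ks \<subseteq> k0" "k.combine Ks (map res ys) = \<zero>\<^bsub>k\<^esub>"
    have "set Ks \<subseteq> carrier k" using Ks(1) k.subring_props(1)[OF k0_subfield] by blast
    \<comment> \<open>\<open>combine\<close> truncates to the shorter list, so the coefficients are
      first cut or padded with zeros to the length of \<open>ys\<close>.\<close>
    then obtain Ks' where Ks': "set (take (length ys) Ks) \<subseteq> set Ks'"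
        "set Ks' \<subseteq> set (take (length ys) Ks) \<union> {\<zero>\<^bsub>k\<^esub>}"
        "length Ks' = length ys" "k.combine Ks' (map res ys) = \<zero>\<^bsub>k\<^esub>"
      by (rule k.combine_normalize[OF _ \<open>set (map res ys) \<subseteq> carrier k\<close> Ks(2), unfolded length_map])
    have "set Ks' \<subseteq> k0"
      using Ks'(2) Ks(1) set_take_subset[of "length ys" Ks] k.subring_props(2)[OF k0_subfield] by blast
    have "\<exists>c. Ks' ! i = res (of_int c)" if "i \<in> {..<length ys}" for i
    proof -
      have "Ks' ! i \<in> set Ks'" using that Ks'(3) by simp
      hence "Ks' ! i \<in> k0" using \<open>set Ks' \<subseteq> k0\<close> by (rule rev_subsetD)
      thus ?thesis by (rule k0_memE) (rule exI)
    qed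
    hence "\<forall>i\<in>{..<length ys}. \<exists>c. Ks' ! i = res (of_int c)" by (rule ballI)
    from bchoice[OF this] obtain c where c: "\<And>i. i < length ys \<Longrightarrow> Ks' ! i = res (of_int (c i))" by auto
    define xs where "xs = map (\<lambda>i. of_int (c i) :: complex) [0..<length ys]"
    have xs: "length xs = length ys" "set xs \<subseteq> carrier R" "Ks' = map res xs"
      using of_int_in_R c Ks'(3) by (auto simp: xs_def intro!: nth_equalityI)
    have S: "sum_list (map2 (*) xs ys) = (\<Sum>i<length ys. of_int (c i) * ys ! i)"
      unfolding sum_list_map2_mult[OF xs(1)] by (intro sum.cong) (simp_all add: xs_def)
    have pos: "0 < w (\<Sum>i<length ys. of_int (c i) * ys ! i)"
      using Ks'(4) res_eq_zero_iff[OF sum_list_in_R[OF map2_mult_in_R[OF xs(2) ys]]]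
      unfolding xs(3) combine_res[OF xs(2) ys] S by simp
    have "int p dvd c i" if "i < length ys" for i
    proof (rule ccontr)
      assume "\<not> int p dvd c i"
      hence "\<exists>i<length ys. \<not> int p dvd c i" using that by (intro exI conjI)
      hence "w (\<Sum>i<length ys. of_int (c i) * ys ! i) \<le> 0"
        using indep unfolding residually_independent_def by (elim allE[of _ c] impE)
      with pos show False by simp
    qed
    hence "\<forall>i<length ys. Ks' ! i = \<zero>\<^bsub>k\<^esub>"
      using c res_eq_zero_iff[OF of_int_in_R] by (simp add: w_of_int_pos_iff)
    hence "set Ks' \<subseteq> {\<zero>\<^bsub>k\<^esub>}" using Ks'(3) by (auto simp: in_set_conv_nth)
    thus "set (take (length (map res ys)) Ks) \<subseteq> {\<zero>\<^bsub>k\<^esub>}" using Ks'(1) by simp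
  qed
qed

text \<open>By residual independence each inner sum S_i is 0 or a power of p times an element of
  value 0, so a nonzero S_i has integral value. The nonzero x_i S_i therefore have different values,
  and their sum has at most the value of any one; for a coefficient prime to p at i0, S_i0 has value
  at most 0.\<close>

lemma free_family_product:
  fixes E :: nat and x :: "nat \<Rightarrow> complex"
  assumes x: "\<And>i. i < E \<Longrightarrow> x i \<in> K" "\<And>i. i < E \<Longrightarrow> x i \<noteq> 0"
    and dist: "\<And>i j. i < E \<Longrightarrow> j < E \<Longrightarrow> v (x i) - v (x j) \<in> \<int> \<Longrightarrow> i = j"
    and ys: "set ys \<subseteq> carrier R" and indep: "residually_independent p w ys"
  shows "free_family p w ({..<E} \<times> {..<length ys}) (\<lambda>(i, j). x i * ys ! j)"
proof -
  define B where "B = (\<Sum>i<E. \<bar>v (x i)\<bar>)"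
  have ysj: "ys ! j \<in> K" "0 \<le> w (ys ! j)" if "j < length ys" for j
    using ys nth_mem[OF that] by (auto simp: R_simps)
  have "w (\<Sum>ij\<in>{..<E} \<times> {..<length ys}. of_int (c ij) * (case ij of (i, j) \<Rightarrow> x i * ys ! j)) \<le> ereal B"
    if c: "\<exists>ij\<in>{..<E} \<times> {..<length ys}. \<not> int p dvd c ij" for c :: "nat \<times> nat \<Rightarrow> int"
  proof -
    obtain i0 j0 where ij0: "i0 < E" "j0 < length ys" "\<not> int p dvd c (i0, j0)" using c by auto
    define S where "S i = (\<Sum>j<length ys. of_int (c (i, j)) * ys ! j)" for i
    have SK: "S i \<in> K" for i unfolding S_def using ysj by (intro sum_mem) auto
    have S_ge: "0 \<le> w (\<Sum>j<length ys. of_int (c' j) * ys ! j)" for c' :: "nat \<Rightarrow> int"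
      using ysj w_of_int_nonneg by (intro w_sum_ge) (auto simp: w_mult)
    have S_val: "\<exists>\<mu>::nat. w (S i) = ereal (real \<mu>)" if "S i \<noteq> 0" for i
    proof -
      have "\<exists>j\<in>{..<length ys}. c (i, j) \<noteq> 0"
        using that unfolding S_def by (metis (no_types, lifting) mult_zero_left of_int_0 sum.neutral)
      from factor_out_prime_power[OF prime_p this] obtain \<mu> c' where
        c': "\<And>j. j < length ys \<Longrightarrow> c (i, j) = int p ^ \<mu> * c' j" "\<exists>j<length ys. \<not> int p dvd c' j" by auto
      let ?T = "\<Sum>j<length ys. of_int (c' j) * ys ! j"
      have TK: "?T \<in> K" using ysj by (intro sum_mem) auto
      have "w ?T = 0" using S_ge[of c'] indep c'(2) unfolding residually_independent_def by (intro antisym) auto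
      moreover have "S i = of_nat p ^ \<mu> * ?T"
        unfolding S_def sum_distrib_left by (intro sum.cong) (simp_all add: c'(1))
      moreover have "w (of_nat p ^ \<mu>) = ereal (real \<mu>)"
        using w_eq_v[of "of_nat p ^ \<mu>"] of_nat_p_nonzero by (simp add: v_power)
      ultimately have "w (S i) = ereal (real \<mu>)" using TK by (simp add: w_mult)
      thus ?thesis ..
    qed
    have val: "w (x i * S i) = ereal (v (x i)) + w (S i)" if "i < E" for i
      using x[OF that] SK w_eq_v[OF x(1)[OF that]] by (simp add: w_mult)
    have "w (\<Sum>i<E. x i * S i) \<le> w (x i0 * S i0)"
    proof (rule w_sum_le_of_distinct)
      fix i j assume ij: "i \<in> {..<E}" "j \<in> {..<E}" "i \<noteq> j" "x i * S i \<noteq> 0"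
      show "w (x i * S i) \<noteq> w (x j * S j)"
      proof
        assume eq: "w (x i * S i) = w (x j * S j)"
        obtain \<mu> where \<mu>: "w (S i) = ereal (real \<mu>)" using S_val[of i] ij(4) by auto
        have "S j \<noteq> 0"
        proof
          assume "S j = 0"
          hence "w (x i * S i) = \<infinity>" using eq by simp
          thus False using val[of i] \<mu> ij(1) by simp
        qed
        then obtain \<nu> where \<nu>: "w (S j) = ereal (real \<nu>)" using S_val by blast
        have "v (x i) - v (x j) = of_int (int \<nu> - int \<mu>)"
          using eq val[of i] val[of j] \<mu> \<nu> ij(1,2) by simp
        hence "v (x i) - v (x j) \<in> \<int>" by (simp only: Ints_of_int)
        thus False using dist[of i j] ij by simp
      qed
    qed (use x SK ij0 in auto)
    also have "\<dots> = ereal (v (x i0)) + w (S i0)" by (rule val[OF ij0(1)])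
    also have "\<dots> \<le> ereal (v (x i0)) + 0"
    proof (intro add_mono order_refl)
      have "\<exists>j<length ys. \<not> int p dvd c (i0, j)" using ij0(2,3) by (intro exI conjI)
      thus "w (S i0) \<le> 0"
        using indep unfolding residually_independent_def S_def by (elim allE[of _ "\<lambda>j. c (i0, j)"] impE)
    qed
    also have "ereal (v (x i0)) + 0 \<le> ereal B"
      using member_le_sum[of i0 "{..<E}" "\<lambda>i. \<bar>v (x i)\<bar>"] ij0(1) unfolding B_def by auto
    also have "(\<Sum>i<E. x i * S i) = (\<Sum>ij\<in>{..<E} \<times> {..<length ys}. of_int (c ij) * (case ij of (i, j) \<Rightarrow> x i * ys ! j))"
      unfolding S_def sum_distrib_left sum.cartesian_product by (intro sum.cong) (auto simp: mult_ac)
    finally show ?thesis .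
  qed
  thus ?thesis unfolding free_family_def by (intro exI[of _ B] allI impI)
qed

end

context valuation_above
begin

lemma ev_in_R: "ev g \<in> carrier W.R"
  by (simp only: W.R_simps mem_Collect_eq ev_mem w_ev_nonneg simp_thms)

text \<open>A combination of these powers is g(\<alpha>) with deg g < deg \<phi>; a coefficient
  prime to p makes the reduction of g nonzero, so not divisible by that of \<phi>.\<close>

lemma powers_residually_independent:
  "residually_independent p w (map (\<lambda>i. \<alpha> ^ i) [0..<Polynomial.degree \<phi>])"
  unfolding residually_independent_def
proof (intro allI impI)
  let ?m = "Polynomial.degree \<phi>"
  fix c :: "nat \<Rightarrow> int"
  assume c: "\<exists>i<length (map (\<lambda>i. \<alpha> ^ i) [0..<?m]). \<not> int p dvd c i"
  define g where "g = (\<Sum>i<?m. Polynomial.monom (c i) i)"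
  have coeff_g: "Polynomial.coeff g i = (if i < ?m then c i else 0)" for i
    unfolding g_def coeff_sum by (simp add: sum.delta)
  have deg: "Polynomial.degree g < ?m"
    using degree_phi_pos by (intro degree_lessI) (auto simp: coeff_g)
  have "red g \<noteq> 0" using c by (auto simp: red_eq_0_iff coeff_g)
  hence "\<not> red \<phi> dvd red g" by (rule red_not_dvd_small[OF phi_monic deg])
  hence "w (ev g) = 0" by (rule w_ev_eq_0)
  moreover have "ev g = (\<Sum>i<?m. of_int (c i) * \<alpha> ^ i)"
    unfolding g_def ev_sum by (intro sum.cong refl) (simp add: map_poly_monom poly_monom)
  ultimately show "w (\<Sum>i<length (map (\<lambda>i. \<alpha> ^ i) [0..<?m]). of_int (c i) * map (\<lambda>i. \<alpha> ^ i) [0..<?m] ! i) \<le> 0"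
    by simp
qed

lemma root_power_in_R: "\<alpha> ^ i \<in> carrier W.R"
  using ev_in_R[of "Polynomial.monom 1 i"] by (simp add: map_poly_monom poly_monom)

end

section \<open>The residue field generated by the root\<close>

lemma monic_int_poly_division:
  fixes f g :: "int poly"
  assumes "Polynomial.lead_coeff g = 1" "Polynomial.degree g > 0"
  obtains q r where "f = g * q + r" "Polynomial.degree r < Polynomial.degree g"
proof -
  have g0: "g \<noteq> 0" using assms(1) by auto
  obtain q r where qr: "pseudo_divmod f g = (q, r)" by (cases "pseudo_divmod f g")
  have "f = g * q + r" using pseudo_divmod(1)[OF g0 qr] assms(1) by simp
  moreover have "Polynomial.degree r < Polynomial.degree g" using pseudo_divmod(2)[OF g0 qr] assms(2) by auto
  ultimately show ?thesis by (rule that)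
qed

context valuation_above
begin

abbreviation A :: "int poly ring" where "A \<equiv> ring_of_type_algebra"

lemma A_simps: "carrier A = UNIV" "f \<otimes>\<^bsub>A\<^esub> g = f * g" "f \<oplus>\<^bsub>A\<^esub> g = f + g"
    "\<one>\<^bsub>A\<^esub> = 1" "\<zero>\<^bsub>A\<^esub> = 0"
  by (simp_all add: ring_of_type_algebra_def)

abbreviation evres :: "int poly \<Rightarrow> complex set" where "evres f \<equiv> W.res (ev f)"

lemma evres_mult: "evres (f * g) = evres f \<otimes>\<^bsub>W.k\<^esub> evres g"
  unfolding ev_mult by (rule W.res_mult[OF ev_in_R ev_in_R])

lemma evres_add: "evres (f + g) = evres f \<oplus>\<^bsub>W.k\<^esub> evres g"
  unfolding ev_add by (rule W.res_add[OF ev_in_R ev_in_R])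

lemma evres_one: "evres 1 = \<one>\<^bsub>W.k\<^esub>"
  unfolding ev_1 by (rule W.res_one)

lemma evres_in_k: "evres f \<in> carrier W.k"
  by (rule W.res_in_k[OF ev_in_R])

lemma evres_zero_iff: "evres f = \<zero>\<^bsub>W.k\<^esub> \<longleftrightarrow> red \<phi> dvd red f"
  unfolding W.res_eq_zero_iff[OF ev_in_R] by (rule w_ev_pos_iff)

lemma evres_hom: "ring_hom_ring A W.k evres"
proof (rule ring_hom_ringI2)
  interpret k: field W.k by (rule W.k_field)
  show "ring A" by (rule ring_from_type_algebra)
  show "ring W.k" by (rule k.ring_axioms)
  show "evres \<in> Ring.ring_hom A W.k"
    by (rule ring_hom_memI) (simp_all only: A_simps evres_mult evres_add evres_one evres_in_k)
qed

text \<open>Identifies Z[X]/(p,\<phi>) with a subring of the residue field, by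
  \<open>w_ev_pos_iff\<close> and lifting of divisibility modulo p.\<close>

lemma evres_kernel: "a_kernel A W.k evres = phi_ideal p \<phi>"
proof
  interpret A: cring A by (rule cring_from_type_algebra)
  interpret h: ring_hom_ring A W.k evres by (rule evres_hom)
  have red_p: "red [:int p:] = 0" unfolding red_eq_0_iff
  proof
    show "int p dvd Polynomial.coeff [:int p:] i" for i by (cases i) simp_all
  qed
  show "phi_ideal p \<phi> \<subseteq> a_kernel A W.k evres"
    unfolding phi_ideal_def
  proof (rule A.genideal_minimal[OF h.kernel_is_ideal])
    have "evres [:int p:] = \<zero>\<^bsub>W.k\<^esub>" "evres \<phi> = \<zero>\<^bsub>W.k\<^esub>"
      unfolding evres_zero_iff red_p by (rule dvd_0_right, rule dvd_refl)
    thus "{[:int p:], \<phi>} \<subseteq> a_kernel A W.k evres"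
      by (simp only: a_kernel_def' A_simps mem_Collect_eq insert_subset empty_subsetI UNIV_I simp_thms)
  qed
  show "a_kernel A W.k evres \<subseteq> phi_ideal p \<phi>"
  proof
    have sub: "{[:int p:], \<phi>} \<subseteq> carrier A" by (simp add: A_simps)
    interpret J: ideal "phi_ideal p \<phi>" A unfolding phi_ideal_def by (rule A.genideal_ideal[OF sub])
    have gen: "[:int p:] \<in> phi_ideal p \<phi>" "\<phi> \<in> phi_ideal p \<phi>"
      using A.genideal_self[OF sub] unfolding phi_ideal_def by auto
    fix f assume "f \<in> a_kernel A W.k evres"
    hence "red \<phi> dvd red f" unfolding a_kernel_def' evres_zero_iff by simp
    then obtain h where "red f = red \<phi> * h" ..
    moreover obtain h' where "red h' = h" using red_surj ..
    ultimately have "red f = red (\<phi> * h')" by (simp only: of_int_poly_hom.hom_mult)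
    then obtain q where "f = \<phi> * h' + Polynomial.smult (int p) q" unfolding red_eq_iff ..
    hence f: "f = (\<phi> \<otimes>\<^bsub>A\<^esub> h') \<oplus>\<^bsub>A\<^esub> ([:int p:] \<otimes>\<^bsub>A\<^esub> q)" by (simp add: A_simps)
    show "f \<in> phi_ideal p \<phi>"
      unfolding f by (intro J.a_closed J.I_r_closed gen) (simp_all add: A_simps)
  qed
qed

abbreviation K' :: "complex set set" where "K' \<equiv> range evres"

lemma K'_subfield: "subfield K' W.k"
proof -
  interpret k: field W.k by (rule W.k_field)
  interpret A: cring A by (rule cring_from_type_algebra)
  interpret h: ring_hom_ring A W.k evres by (rule evres_hom)
  show ?thesis
  proof (rule k.subfieldI')
    show "subring K' W.k" using h.img_is_subring[OF A.carrier_is_subring] by (simp only: A_simps)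
    fix x assume x: "x \<in> K' - {\<zero>\<^bsub>W.k\<^esub>}"
    then obtain f where f: "x = evres f" by (elim DiffE imageE)
    hence "\<not> red \<phi> dvd red f" using x by (simp add: evres_zero_iff[symmetric])
    from bezout_red[OF phi_irreducible this] obtain u t q where
      utq: "u * f + t * \<phi> = 1 + Polynomial.smult (int p) q" by (elim exE)
    have "evres (f * u) = evres 1"
    proof -
      have "f * u - 1 = \<phi> * (- t) + Polynomial.smult (int p) q" using utq by (simp add: algebra_simps)
      hence "red (f * u - 1) = red (\<phi> * (- t))" unfolding red_eq_iff by (rule exI)
      hence "red \<phi> dvd red (f * u - 1)" by (simp only: of_int_poly_hom.hom_mult dvd_triv_left)
      hence "0 < w (ev (f * u - 1))" by (simp only: w_ev_pos_iff)
      moreover have "ev (f * u - 1) = ev (f * u) - ev 1" by (simp only: of_int_poly_hom.hom_minus poly_diff)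
      ultimately have "0 < w (ev (f * u) - ev 1)" by (simp only:)
      thus ?thesis by (rule W.res_eq_iff[OF ev_in_R ev_in_R, THEN iffD2])
    qed
    hence "x \<otimes>\<^bsub>W.k\<^esub> evres u = \<one>\<^bsub>W.k\<^esub>" by (simp only: f evres_mult evres_one)
    hence "inv\<^bsub>W.k\<^esub> x = evres u" unfolding f by (intro k.comm_inv_char evres_in_k)
    thus "inv\<^bsub>W.k\<^esub> x \<in> K'" by (rule range_eqI)
  qed
qed

text \<open>Independence comes from \<open>powers_residually_independent\<close>. For spanning,
  division by the monic \<phi> replaces f by a remainder of degree below deg \<phi> with the same
  residue.\<close>

lemma dimension_K': "ring.dimension W.k (Polynomial.degree \<phi>) W.k0 K'"
proof -
  interpret k: field W.k by (rule W.k_field)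
  interpret A: cring A by (rule cring_from_type_algebra)
  let ?m = "Polynomial.degree \<phi>"
  let ?ys = "map (\<lambda>i. \<alpha> ^ i) [0..<?m]"
  let ?Us = "map W.res ?ys"
  have ys: "set ?ys \<subseteq> carrier W.R" using root_power_in_R by auto
  have indep: "k.independent W.k0 ?Us"
    by (rule W.residually_independent_imp_independent[OF powers_residually_independent ys])
  note Us = k.independent_in_carrier[OF indep]
  have "k.Span W.k0 ?Us = K'"
  proof
    have sg: "subgroup K' (add_monoid W.k)"
      by (rule subring.axioms(1)[OF subfieldE(1)[OF K'_subfield]])
    show "k.Span W.k0 ?Us \<subseteq> K'"
    proof (rule k.Span_min[OF W.k0_subfield Us sg])
      show "W.k0 <#>\<^bsub>W.k\<^esub> set ?Us \<subseteq> K'"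
      proof (rule subsetI)
        fix z assume "z \<in> W.k0 <#>\<^bsub>W.k\<^esub> set ?Us"
        then obtain x y where xy: "x \<in> W.k0" "y \<in> set ?Us" "z = x \<otimes>\<^bsub>W.k\<^esub> y"
          unfolding set_mult_def by auto
        obtain c where c: "x = W.res (of_int c)" using xy(1) by (rule W.k0_memE)
        obtain i where i: "y = W.res (\<alpha> ^ i)" using xy(2) by auto
        have "z = W.res (of_int c * \<alpha> ^ i)"
          unfolding xy(3) c i by (rule W.res_mult[OF W.of_int_in_R root_power_in_R, symmetric])
        also have "of_int c * \<alpha> ^ i = ev (Polynomial.monom c i)" by (simp add: map_poly_monom poly_monom)
        finally show "z \<in> K'" by (rule range_eqI)
      qed
    qed
    show "K' \<subseteq> k.Span W.k0 ?Us"
    proof (rule subsetI)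
      fix z assume "z \<in> K'"
      then obtain f where f: "z = evres f" by (rule imageE)
      obtain q r where qr: "f = \<phi> * q + r" "Polynomial.degree r < ?m"
        by (rule monic_int_poly_division[OF phi_monic degree_phi_pos])
      have "evres \<phi> = \<zero>\<^bsub>W.k\<^esub>" unfolding evres_zero_iff by simp
      hence z: "z = evres r" unfolding f qr(1) evres_add evres_mult using evres_in_k by simp
      define xs where "xs = map (\<lambda>i. of_int (Polynomial.coeff r i) :: complex) [0..<?m]"
      have xs: "length xs = length ?ys" "set xs \<subseteq> carrier W.R" using W.of_int_in_R by (auto simp: xs_def)
      have "ev r = (\<Sum>i\<le>Polynomial.degree r. of_int (Polynomial.coeff r i) * \<alpha> ^ i)"
        by (simp add: poly_altdef degree_map_poly coeff_map_poly)
      also have "\<dots> = (\<Sum>i<?m. of_int (Polynomial.coeff r i) * \<alpha> ^ i)"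
        using qr(2) by (intro sum.mono_neutral_left) (auto simp: coeff_eq_0)
      also have "\<dots> = sum_list (map2 (*) xs ?ys)"
        unfolding sum_list_map2_mult[OF xs(1)] by (simp add: xs_def)
      finally have "z = k.combine (map W.res xs) ?Us" unfolding z W.combine_res[OF xs(2) ys] by simp
      moreover have "set (map W.res xs) \<subseteq> W.k0" using W.k0_memI by (auto simp: xs_def)
      ultimately show "z \<in> k.Span W.k0 ?Us"
        unfolding k.Span_eq_combine_set[OF W.k0_subfield Us] by (intro CollectI exI conjI)
    qed
  qed
  thus ?thesis using k.dimension_independent[OF indep] by simp
qed

section \<open>The field F_\<phi> and its embedding into the residue field\<close>

abbreviation Fphi :: "int poly set ring" where "Fphi \<equiv> phi_field p \<phi>"

text \<open>\<open>evres\<close> is constant on the cosets of its kernel, so the image of each coset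
  is a singleton.\<close>

definition psi :: "int poly set \<Rightarrow> complex set" where "psi C = the_elem (evres ` C)"

lemma psi_iso: "psi \<in> ring_iso Fphi (W.k \<lparr>carrier := K'\<rparr>)"
proof -
  interpret h: ring_hom_ring A W.k evres by (rule evres_hom)
  show ?thesis
    using h.FactRing_iso_set_aux unfolding evres_kernel psi_def[abs_def] phi_field_def by (simp add: A_simps)
qed

lemma psi_red: "psi (phi_red p \<phi> f) = evres f"
proof -
  interpret h: ring_hom_ring A W.k evres by (rule evres_hom)
  show ?thesis
    using h.the_elem_simp[of f] unfolding evres_kernel psi_def phi_red_def by (simp add: A_simps)
qed

lemma phi_red_in_Fphi: "phi_red p \<phi> f \<in> carrier Fphi"
  by (auto simp: phi_red_def phi_field_def FactRing_def A_RCOSETS_def' A_simps)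

lemma psi_inj: "inj_on psi (carrier Fphi)" and psi_image: "psi ` carrier Fphi = K'"
  using ring_iso_memE(5)[OF psi_iso] by (auto simp: bij_betw_def)

lemma Fphi_cring: "cring Fphi"
proof -
  interpret A: cring A by (rule cring_from_type_algebra)
  have "ideal (phi_ideal p \<phi>) A"
    unfolding phi_ideal_def by (rule A.genideal_ideal) (simp add: A_simps)
  from ideal.quotient_is_cring[OF this A.cring_axioms] show ?thesis by (simp only: phi_field_def)
qed

lemma psi_hom: "ring_hom_ring Fphi W.k psi"
proof (rule ring_hom_ringI2)
  show "ring Fphi" using Fphi_cring by (rule cring.axioms(1))
  interpret k: field W.k by (rule W.k_field)
  show "ring W.k" by (rule k.ring_axioms)
  interpret h: ring_hom_ring A W.k evres by (rule evres_hom)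
  show "psi \<in> Ring.ring_hom Fphi W.k"
    using h.the_elem_hom unfolding evres_kernel psi_def[abs_def] phi_field_def .
qed

text \<open>An inverse is found in the image K', already known to be a field, and brought back by
  injectivity.\<close>

lemma Fphi_field: "field Fphi"
proof -
  interpret F: cring Fphi by (rule Fphi_cring)
  interpret k: field W.k by (rule W.k_field)
  interpret h: ring_hom_ring Fphi W.k psi by (rule psi_hom)
  show ?thesis
  proof (rule F.cring_fieldI2)
    show "\<zero>\<^bsub>Fphi\<^esub> \<noteq> \<one>\<^bsub>Fphi\<^esub>" using h.hom_zero h.hom_one k.one_not_zero by metis
    fix x assume x: "x \<in> carrier Fphi" "x \<noteq> \<zero>\<^bsub>Fphi\<^esub>"
    have "psi x \<noteq> \<zero>\<^bsub>W.k\<^esub>" using inj_onD[OF psi_inj _ x(1) F.zero_closed] x(2) h.hom_zero by metis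
    moreover have "psi x \<in> K'" unfolding psi_image[symmetric] by (rule imageI[OF x(1)])
    ultimately have px: "psi x \<in> K' - {\<zero>\<^bsub>W.k\<^esub>}" by (simp only: Diff_iff singleton_iff simp_thms)
    note z = k.subfield_m_inv[OF K'_subfield px]
    have "inv\<^bsub>W.k\<^esub> (psi x) \<in> psi ` carrier Fphi" unfolding psi_image using z(1) by (rule DiffD1)
    then obtain y where y: "inv\<^bsub>W.k\<^esub> (psi x) = psi y" "y \<in> carrier Fphi" by (rule imageE)
    have "psi (x \<otimes>\<^bsub>Fphi\<^esub> y) = psi \<one>\<^bsub>Fphi\<^esub>"
      using z(2) h.hom_mult[OF x(1) y(2)] h.hom_one unfolding y(1) by (simp only:)
    hence "x \<otimes>\<^bsub>Fphi\<^esub> y = \<one>\<^bsub>Fphi\<^esub>" by (rule inj_onD[OF psi_inj]) (use x(1) y(2) in simp_all)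
    thus "\<exists>y\<in>carrier Fphi. x \<otimes>\<^bsub>Fphi\<^esub> y = \<one>\<^bsub>Fphi\<^esub>" using y(2) by (rule bexI)
  qed
qed

end

context residual_setup
begin

text \<open>In the tower consisting of the prime field, K' and the extension of K' by the residue of
  \<gamma>, the steps have degrees deg \<phi> and d, the latter since the residual polynomial is
  irreducible with that residue as a root. A basis of the top field lifts to the valuation
  ring.\<close>

lemma residually_independent_exists:
  assumes irr: "pirreducible\<^bsub>Fphi\<^esub> (carrier Fphi) (residual_poly p \<phi> L a)"
  shows "\<exists>ys. set ys \<subseteq> carrier W.R \<and> residually_independent p w ys \<and> length ys = Polynomial.degree \<phi> * d"
proof -
  interpret k: field W.k by (rule W.k_field)
  interpret F: field Fphi by (rule Fphi_field)
  interpret h: ring_hom_ring Fphi W.k psi by (rule psi_hom)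
  let ?P = "map (\<lambda>i. phi_red p \<phi> (b i)) [0..<Suc d]"
  have P_hd: "hd ?P = phi_red p \<phi> (b 0)" by (simp add: hd_map hd_upt del: upt_Suc)
  \<comment> \<open>b 0 = a_s is nonzero modulo p, so the leading coefficient survives:
    \<open>normalize\<close> changes nothing and the degree is exactly d.\<close>
  have b0_small: "\<not> red \<phi> dvd red (b 0)"
  proof -
    have "a s = b 0" using a_eq_smult_b[of 0] by simp
    thus ?thesis using red_not_dvd_small[OF phi_monic degree_a[of s] a_s] by simp
  qed
  have "phi_red p \<phi> (b 0) \<noteq> \<zero>\<^bsub>Fphi\<^esub>"
  proof
    assume "phi_red p \<phi> (b 0) = \<zero>\<^bsub>Fphi\<^esub>"
    hence "evres (b 0) = \<zero>\<^bsub>W.k\<^esub>" using psi_red[of "b 0"] h.hom_zero by simp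
    thus False using b0_small by (simp add: evres_zero_iff)
  qed
  hence poly: "polynomial\<^bsub>Fphi\<^esub> (carrier Fphi) ?P"
    unfolding polynomial_def P_hd using phi_red_in_Fphi by auto
  have res_eq: "residual_poly p \<phi> L a = ?P"
    unfolding residual_poly_def exp_s_eq b_def[symmetric] by (rule F.normalize_polynomial[OF poly])
  have P: "?P \<in> carrier (poly_ring Fphi)" using poly by (simp only: univ_poly_carrier)
  have gR: "\<gamma> \<in> carrier W.R" using gamma_mem w_gamma by (simp add: W.R_simps)
  let ?xs = "map (\<lambda>i. ev (b i)) [0..<Suc d]"
  have xs: "set ?xs \<subseteq> carrier W.R" using ev_in_R by auto
  have "map psi ?P = map W.res ?xs" by (simp add: psi_red)
  hence "k.eval (map psi ?P) (W.res \<gamma>) = W.res (\<Sum>i<length ?xs. ?xs ! i * \<gamma> ^ (length ?xs - Suc i))"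
    using W.eval_res[OF xs gR] by (simp only:)
  also have "(\<Sum>i<length ?xs. ?xs ! i * \<gamma> ^ (length ?xs - Suc i)) = (\<Sum>i\<le>d. ev (b i) * \<gamma> ^ (d - i))"
    by (rule sum.cong) (auto simp del: upt_Suc simp: nth_map_upt)
  also have "W.res \<dots> = \<zero>\<^bsub>W.k\<^esub>"
  proof -
    have "(\<Sum>i\<le>d. ev (b i) * \<gamma> ^ (d - i)) \<in> carrier W.R"
      using residual_equation by (auto simp: W.R_simps intro!: W.sum_mem W.mult_mem ev_mem W.power_mem gamma_mem)
    from W.res_eq_zero_iff[OF this] show ?thesis using residual_equation by simp
  qed
  finally have root: "k.eval (map psi ?P) (W.res \<gamma>) = \<zero>\<^bsub>W.k\<^esub>" .
  have "k.dimension (length ?P - 1) K' (k.simple_extension K' (W.res \<gamma>))"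
    using h.dimension_simple_extension_of_root[OF Fphi_field W.k_field psi_inj P irr[unfolded res_eq]
        W.res_in_k[OF gR] root] unfolding psi_image .
  moreover have "length ?P - 1 = d" by simp
  ultimately have "k.dimension d K' (k.simple_extension K' (W.res \<gamma>))" by (simp only:)
  from k.telescopic_base[OF W.k0_subfield K'_subfield dimension_K' this]
  obtain Vs where Vs: "set Vs \<subseteq> carrier W.k" "k.independent W.k0 Vs" "length Vs = Polynomial.degree \<phi> * d"
    by (auto dest: k.exists_base[OF W.k0_subfield])
  from W.carrier_k_lift[OF Vs(1)] obtain ys where ys: "set ys \<subseteq> carrier W.R" "Vs = map W.res ys"
    by (elim exE conjE)
  have "residually_independent p w ys"
    using W.independent_imp_residually_independent[of ys] Vs(2) ys by simp
  thus ?thesis using ys Vs(3) by (intro exI[of _ ys]) simp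
qed

end

section \<open>Ramification index and residue degree\<close>

context ext_valuation
begin

text \<open>\<int> is the value group of \<rat>, so the x_i represent different cosets and n is a
  lower bound for the index of the value groups.\<close>

definition value_distinct :: "nat \<Rightarrow> (nat \<Rightarrow> complex) \<Rightarrow> bool" where
  "value_distinct n x \<longleftrightarrow> (\<forall>i<n. x i \<in> K \<and> x i \<noteq> 0) \<and> (\<forall>i<n. \<forall>j<n. v (x i) - v (x j) \<in> \<int> \<longrightarrow> i = j)"

definition residue_list :: "complex list \<Rightarrow> bool" where
  "residue_list ys \<longleftrightarrow> set ys \<subseteq> carrier R \<and> residually_independent p w ys"

lemma free_family_of_lists:
  assumes x: "value_distinct n x" and ys: "residue_list ys"
  shows "free_family p w ({..<n} \<times> {..<length ys}) (\<lambda>(i, j). x i * ys ! j)"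
  using x ys unfolding value_distinct_def residue_list_def
  by (intro free_family_product) auto

lemma Ints_image_rat: "(\<lambda>x. real_of_ereal (w x)) ` (\<rat> - {0}) = \<int>"
proof
  show "(\<lambda>x. real_of_ereal (w x)) ` (\<rat> - {0}) \<subseteq> \<int>"
  proof
    fix y assume "y \<in> (\<lambda>x. real_of_ereal (w x)) ` (\<rat> - {0})"
    then obtain q where q: "y = real_of_ereal (w (of_rat q))" by (auto simp: Rats_def)
    have "w (of_rat q) = rat_val p q" using w_ext by (simp add: valuations_extending_def)
    thus "y \<in> \<int>" unfolding q by (auto simp: rat_val_def split: prod.split)
  qed
  show "\<int> \<subseteq> (\<lambda>x. real_of_ereal (w x)) ` (\<rat> - {0})"
  proof
    fix y :: real assume "y \<in> \<int>"
    then obtain n where n: "y = of_int n" by (rule Ints_cases)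
    have "v (of_nat p powi n) = of_int n" using of_nat_p_nonzero by (simp add: v_powi)
    moreover have "(of_nat p powi n :: complex) \<in> \<rat>"
      unfolding power_int_def by (auto intro!: Rats_power Rats_inverse)
    ultimately show "y \<in> (\<lambda>x. real_of_ereal (w x)) ` (\<rat> - {0})"
      using of_nat_p_nonzero unfolding n v_def by (intro image_eqI[of _ _ "of_nat p powi n"]) auto
  qed
qed

abbreviation coset :: "real \<Rightarrow> real set" where "coset y \<equiv> (\<lambda>h. h + y) ` \<int>"

lemma coset_eq_iff: "coset y = coset z \<longleftrightarrow> y - z \<in> \<int>"
proof
  assume "coset y = coset z"
  moreover have "y \<in> coset y" by (intro image_eqI[of _ _ 0]) auto
  ultimately obtain h where "h \<in> \<int>" "y = h + z" by auto
  thus "y - z \<in> \<int>" by simp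
next
  assume *: "y - z \<in> \<int>"
  have sub: "coset y \<subseteq> coset z" if "y - z \<in> \<int>" for y z :: real
  proof
    fix u assume "u \<in> coset y"
    then obtain h where "h \<in> \<int>" "u = h + y" by auto
    thus "u \<in> coset z" using that by (intro image_eqI[of _ _ "h + (y - z)"]) auto
  qed
  have "z - y \<in> \<int>" using Ints_minus[OF *] by simp
  thus "coset y = coset z" using sub[OF *] sub[of z y] by blast
qed

lemma rcosets_eq: "rcosets\<^bsub>val_group K w\<^esub> carrier (val_group \<rat> w) = (\<lambda>x. coset (v x)) ` (K - {0})"
proof -
  have "carrier (val_group \<rat> w) #>\<^bsub>val_group K w\<^esub> y = coset y" for y
    unfolding r_coset_def val_group_def by (simp only: partial_object.simps monoid.simps Ints_image_rat) auto
  thus ?thesis unfolding RCOSETS_def by (auto simp: val_group_def v_def)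
qed

text \<open>Compatible with the convention of index 0 for infinitely many cosets: n + 1 distinct
  cosets, which an infinite set also contains, would give a longer family.\<close>

lemma ramification_index_eqI:
  assumes x: "value_distinct n x" and max: "\<And>n' x'. value_distinct n' x' \<Longrightarrow> n' \<le> n"
  shows "ramification_index K w = n"
proof -
  define C where "C = (\<lambda>x. coset (v x)) ` (K - {0})"
  have "inj_on (\<lambda>i. coset (v (x i))) {..<n}"
    using x unfolding inj_on_def coset_eq_iff value_distinct_def by auto
  moreover have "(\<lambda>i. coset (v (x i))) ` {..<n} \<subseteq> C"
    using x unfolding C_def value_distinct_def by auto
  ultimately have lower: "finite C \<Longrightarrow> n \<le> card C" using card_inj_on_le[of _ "{..<n}" C] by auto
  have "card C = n"
  proof (rule ccontr)
    assume "card C \<noteq> n"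
    have "\<exists>D\<subseteq>C. finite D \<and> card D = Suc n"
    proof (cases "finite C")
      case True
      hence "Suc n \<le> card C" using lower \<open>card C \<noteq> n\<close> by simp
      from obtain_subset_with_card_n[OF this] obtain D where "D \<subseteq> C" "card D = Suc n" "finite D" .
      thus ?thesis by (intro exI[of _ D] conjI)
    next
      case False
      from infinite_arbitrarily_large[OF this, of "Suc n"] obtain D where "finite D" "card D = Suc n" "D \<subseteq> C"
        by (elim exE conjE)
      thus ?thesis by (intro exI[of _ D] conjI)
    qed
    then obtain D where D: "D \<subseteq> C" "finite D" "card D = Suc n" by (elim exE conjE)
    obtain g where g: "bij_betw g {..<Suc n} D"
      using ex_bij_betw_nat_finite[OF D(2)] unfolding D(3) atLeast0LessThan by (elim exE)
    have "\<exists>y. y \<in> K - {0} \<and> g i = coset (v y)" if "i \<in> {..<Suc n}" for i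
    proof -
      have "g i \<in> C" using bij_betwE[OF g] that D(1) by blast
      thus ?thesis unfolding C_def by auto
    qed
    hence "\<forall>i\<in>{..<Suc n}. \<exists>y. y \<in> K - {0} \<and> g i = coset (v y)" by (rule ballI)
    from bchoice[OF this] obtain x' where x': "\<And>i. i < Suc n \<Longrightarrow> x' i \<in> K - {0} \<and> g i = coset (v (x' i))"
      by auto
    have "value_distinct (Suc n) x'"
      unfolding value_distinct_def
    proof (intro conjI allI impI)
      fix i j assume ij: "i < Suc n" "j < Suc n" "v (x' i) - v (x' j) \<in> \<int>"
      hence "g i = g j" using x'[OF ij(1)] x'[OF ij(2)] coset_eq_iff by simp
      thus "i = j" using g ij(1,2) by (auto simp: bij_betw_def inj_on_def)
    qed (use x' in auto)
    from max[OF this] show False by simp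
  qed
  thus ?thesis unfolding ramification_index_def rcosets_eq C_def .
qed

text \<open>A list of maximal length spans the residue field, since a residue outside the span could
  be prepended. This includes finite dimension, on which \<open>residue_degree\<close>
  branches.\<close>

lemma residue_degree_eqI:
  assumes ys: "residue_list ys" and max: "\<And>ys'. residue_list ys' \<Longrightarrow> length ys' \<le> length ys"
  shows "residue_degree K w = length ys"
proof -
  interpret k: field k by (rule k_field)
  have ys': "set ys \<subseteq> carrier R" "residually_independent p w ys" using ys by (auto simp: residue_list_def)
  let ?Us = "map res ys"
  have indep: "k.independent k0 ?Us"
    by (rule residually_independent_imp_independent[OF ys'(2,1)])
  have "k.Span k0 ?Us = carrier k"
  proof (rule ccontr)
    assume "k.Span k0 ?Us \<noteq> carrier k"
    moreover have "k.Span k0 ?Us \<subseteq> carrier k"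
      by (rule k.Span_subgroup_props(1)[OF k0_subfield k.independent_in_carrier[OF indep]])
    ultimately obtain u where u: "u \<in> carrier k" "u \<notin> k.Span k0 ?Us" by blast
    obtain y where y: "y \<in> carrier R" "u = res y" using u(1) unfolding carrier_k by auto
    have "k.independent k0 (map res (y # ys))"
      using k.li_Cons[OF u indep] y(2) by simp
    hence "residue_list (y # ys)"
      unfolding residue_list_def using y(1) ys'(1)
      by (intro conjI independent_imp_residually_independent) simp_all
    from max[OF this] show False by simp
  qed
  hence dim: "k.dimension (length ys) k0 (carrier k)" using k.dimension_independent[OF indep] by simp
  have "k.dim k0 (carrier k) = length ys" using k.dimI[OF k0_subfield dim] unfolding over_def .
  thus ?thesis unfolding residue_degree_def Let_def using k.finite_dimensionI[OF dim] by simp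
qed

end

context residual_setup
begin

text \<open>v(\<theta>) = h/e with e and h coprime, so (j - i) h/e is an integer only if e divides j
  - i < e.\<close>

lemma theta_powers_value_distinct: "W.value_distinct e (\<lambda>i. \<theta> ^ i)"
  unfolding W.value_distinct_def
proof (intro conjI allI impI)
  fix i show "\<theta> ^ i \<in> adjoin_root \<alpha>" by (intro W.power_mem theta_mem)
  show "\<theta> ^ i \<noteq> 0" using theta_nonzero by simp
next
  have v: "W.v (\<theta> ^ i) = real i * (real h / real e)" for i
    unfolding W.v_power[OF theta_mem theta_nonzero] v_theta_eq ..
  have wlog: "i = j" if ij: "i \<le> j" "j < e" "W.v (\<theta> ^ j) - W.v (\<theta> ^ i) \<in> \<int>" for i j
  proof -
    obtain n where n: "W.v (\<theta> ^ j) - W.v (\<theta> ^ i) = of_int n" using ij(3) by (rule Ints_cases)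
    have "real (j - i) * real h = of_int n * real e"
      using n e_pos ij(1) unfolding v by (simp add: field_simps of_nat_diff)
    hence "of_int (int (j - i) * int h) = (of_int (n * int e) :: real)" by simp
    hence "int (j - i) * int h = n * int e" by (simp only: of_int_eq_iff)
    hence "int e dvd int (j - i) * int h" by simp
    hence "e dvd (j - i) * h" by (simp flip: of_nat_mult add: int_dvd_int_iff)
    hence "e dvd j - i" using coprime_e_h by (simp add: coprime_dvd_mult_left_iff)
    hence "j - i = 0" using ij(2) by (metis dvd_imp_le less_imp_diff_less not_gr0 not_less)
    thus ?thesis using ij(1) by simp
  qed
  fix i j assume "i < e" "j < e" "W.v (\<theta> ^ i) - W.v (\<theta> ^ j) \<in> \<int>"
  moreover from this(3) have "W.v (\<theta> ^ j) - W.v (\<theta> ^ i) \<in> \<int>" using Ints_minus by fastforce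
  ultimately show "i = j" using wlog[of i j] wlog[of j i] by (cases "i \<le> j") auto
qed

end

context valuation_above
begin

text \<open>For l = 1 the families consist of 1 and the powers of \<alpha>. Here L - s = 1, so d = 1
  whatever the valuation of a_L is, including infinity.\<close>

lemma families_exist:
  assumes expansion: "phi_adic_expansion \<phi> F L a"
    and mult: "red \<phi> ^ l dvd red F" "\<not> red \<phi> ^ Suc l dvd red F"
    and cases: "l = 1 \<or>
      (l \<ge> 2 \<and> L_property p L a (exp_lambda p L a) \<and>
       pirreducible\<^bsub>Fphi\<^esub> (carrier Fphi) (residual_poly p \<phi> L a))"
  shows "\<exists>n x ys. W.value_distinct n x \<and> W.residue_list ys \<and>
    n * exp_d p L a = l \<and> length ys = Polynomial.degree \<phi> * exp_d p L a"
proof (cases "l = 1")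
  case True
  have "exp_s p L a = L - 1" "1 \<le> L"
    using expansion_exp_s[OF phi_monic phi_irreducible expansion mult] True by auto
  hence d: "exp_d p L a = 1" by (simp add: exp_d_def split: enat.split)
  have "W.value_distinct 1 (\<lambda>_. 1)" by (simp add: W.value_distinct_def)
  moreover have "W.residue_list (map (\<lambda>i. \<alpha> ^ i) [0..<Polynomial.degree \<phi>])"
    unfolding W.residue_list_def using powers_residually_independent root_power_in_R by auto
  ultimately show ?thesis using True unfolding d
    by (intro exI[of _ 1] exI[of _ "\<lambda>_. 1"] exI[of _ "map (\<lambda>i. \<alpha> ^ i) [0..<Polynomial.degree \<phi>]"] conjI) simp_all
next
  case False
  interpret residual_setup p ty F \<alpha> \<phi> w l L a
    by unfold_locales (use False expansion mult cases in auto)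
  obtain ys where ys: "set ys \<subseteq> carrier W.R" "residually_independent p w ys" "length ys = Polynomial.degree \<phi> * d"
    using residually_independent_exists False cases by auto
  have "W.residue_list ys" using ys by (simp add: W.residue_list_def)
  thus ?thesis using theta_powers_value_distinct e_times_d ys(3)
    by (intro exI[of _ e] exI[of _ "\<lambda>i. \<theta> ^ i"] exI[of _ ys] conjI)
qed

end

section \<open>Counting the valuations over all factors\<close>

lemma prime_elem_dvd_prodE:
  assumes q: "prime_elem q" and A: "finite A" and dvd: "q dvd prod f A"
  obtains x where "x \<in> A" "q dvd f x"
proof -
  have "\<exists>x\<in>A. q dvd f x"
    using A dvd
  proof (induction A rule: finite_induct)
    case empty
    thus ?case using q by (simp add: prime_elem_def)
  next
    case (insert x A)
    hence "q dvd f x * prod f A" by simp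
    hence "q dvd f x \<or> q dvd prod f A" by (rule prime_elem_dvd_multD[OF q])
    thus ?case using insert.IH by auto
  qed
  thus ?thesis using that by (elim bexE)
qed

locale ore_setup = mod_p p ty + integer_root F \<alpha>
  for p :: nat and ty :: "'p :: prime_card itself" and F :: "int poly" and \<alpha> :: complex +
  fixes r :: nat and \<phi> :: "nat \<Rightarrow> int poly" and l L :: "nat \<Rightarrow> nat" and a :: "nat \<Rightarrow> nat \<Rightarrow> int poly"
  assumes factorization: "red F = (\<Prod>i\<in>{1..r}. red (\<phi> i) ^ l i)"
    and l_pos: "\<And>i. i \<in> {1..r} \<Longrightarrow> l i \<ge> 1"
    and phi_monic: "\<And>i. i \<in> {1..r} \<Longrightarrow> Polynomial.lead_coeff (\<phi> i) = 1"
    and phi_irreducible: "\<And>i. i \<in> {1..r} \<Longrightarrow> Factorial_Ring.irreducible (red (\<phi> i))"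
    and phi_distinct: "inj_on (\<lambda>i. red (\<phi> i)) {1..r}"
    and expansion: "\<And>i. i \<in> {1..r} \<Longrightarrow> phi_adic_expansion (\<phi> i) F (L i) (a i)"
    and cases: "\<And>i. i \<in> {1..r} \<Longrightarrow> l i = 1 \<or>
      (l i \<ge> 2 \<and> L_property p (L i) (a i) (exp_lambda p (L i) (a i)) \<and>
       pirreducible\<^bsub>phi_field p (\<phi> i)\<^esub> (carrier (phi_field p (\<phi> i))) (residual_poly p (\<phi> i) (L i) (a i)))"
begin

abbreviation K :: "complex set" where "K \<equiv> adjoin_root \<alpha>"
abbreviation m :: "nat \<Rightarrow> nat" where "m i \<equiv> Polynomial.degree (\<phi> i)"
abbreviation d :: "nat \<Rightarrow> nat" where "d i \<equiv> exp_d p (L i) (a i)"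
abbreviation eval_root :: "int poly \<Rightarrow> complex" where "eval_root g \<equiv> poly (of_int_poly g) \<alpha>"

sublocale PS: prime_subfield K p
proof -
  interpret complex_subfield K by (rule adjoin_root_subfield)
  show "prime_subfield K p" by unfold_locales (rule prime_p)
qed

lemma red_dvd_imp_eq:
  assumes "i \<in> {1..r}" "j \<in> {1..r}" "red (\<phi> i) dvd red (\<phi> j)"
  shows "i = j"
proof -
  have "red (\<phi> j) dvd red (\<phi> i)"
    using irreducibleD'[OF phi_irreducible[OF assms(2)] assms(3)] irreducible_not_unit[OF phi_irreducible[OF assms(1)]]
    by (simp only: simp_thms)
  hence "red (\<phi> i) = red (\<phi> j)"
    using assms(3) lead_coeff_red_monic[OF phi_monic[OF assms(1)]] lead_coeff_red_monic[OF phi_monic[OF assms(2)]]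
    by (intro poly_dvd_antisym) simp_all
  thus ?thesis by (rule inj_onD[OF phi_distinct _ assms(1,2)])
qed

lemma multiplicity_l:
  assumes i: "i \<in> {1..r}"
  shows "red (\<phi> i) ^ l i dvd red F" "\<not> red (\<phi> i) ^ Suc (l i) dvd red F"
proof -
  let ?P = "\<Prod>j\<in>{1..r} - {i}. red (\<phi> j) ^ l j"
  have F: "red F = red (\<phi> i) ^ l i * ?P"
    unfolding factorization using i by (simp add: prod.remove)
  thus "red (\<phi> i) ^ l i dvd red F" by (simp only: dvd_triv_left)
  have prime: "prime_elem (red (\<phi> i))" using phi_irreducible[OF i] by (rule irreducible_imp_prime_elem)
  have "\<not> red (\<phi> i) dvd ?P"
  proof
    assume "red (\<phi> i) dvd ?P"
    then obtain j where j: "j \<in> {1..r} - {i}" "red (\<phi> i) dvd red (\<phi> j) ^ l j"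
      by (rule prime_elem_dvd_prodE[OF prime finite_Diff[OF finite_atLeastAtMost]])
    hence "red (\<phi> i) dvd red (\<phi> j)" using prime_elem_dvd_power[OF prime] by (simp only:)
    thus False using red_dvd_imp_eq[OF i, of j] j(1) by simp
  qed
  moreover have "red (\<phi> i) ^ l i \<noteq> 0" using prime by (simp add: prime_elem_def)
  ultimately show "\<not> red (\<phi> i) ^ Suc (l i) dvd red F"
    unfolding F power_Suc2 by (simp only: dvd_mult_cancel_left simp_thms)
qed

lemma sum_l_m: "(\<Sum>i\<in>{1..r}. l i * m i) = N"
proof -
  have nz: "red (\<phi> i) \<noteq> 0" if "i \<in> {1..r}" for i using phi_irreducible[OF that] by auto
  have "N = Polynomial.degree (red F)" by (rule degree_red_monic[OF monic, symmetric])
  also have "\<dots> = (\<Sum>i\<in>{1..r}. Polynomial.degree (red (\<phi> i) ^ l i))"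
    unfolding factorization using nz by (intro degree_prod_sum_eq) simp
  also have "\<dots> = (\<Sum>i\<in>{1..r}. l i * m i)"
    using nz degree_red_monic[OF phi_monic] by (intro sum.cong) (simp_all add: degree_power_eq)
  finally show ?thesis ..
qed

text \<open>For i in 1..r, the center of w on Z[\<alpha>] is then the maximal ideal generated by p
  and \<phi>_i(\<alpha>).\<close>

definition lies_over :: "nat \<Rightarrow> (complex \<Rightarrow> ereal) \<Rightarrow> bool" where
  "lies_over i w \<longleftrightarrow> w \<in> valuations_extending p K \<and> 0 < w (eval_root (\<phi> i))"

text \<open>Chevalley's theorem for the ring Z[\<alpha>]. The ideal generated by p and
  \<phi>_i(\<alpha>) is proper: if it contained 1, F would divide some 1 - p f - \<phi>_i g, and the
  reduction of \<phi>_i, a factor of that of F, would divide 1.\<close>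

lemma lies_over_exists:
  assumes i: "i \<in> {1..r}"
  shows "\<exists>w. lies_over i w"
proof -
  have A: "complex_subring (range eval_root)"
  proof
    show "1 \<in> range eval_root" by (rule range_eqI[of _ _ 1]) (simp only: of_int_poly_hom.hom_one poly_1)
    fix x y assume "x \<in> range eval_root" "y \<in> range eval_root"
    then obtain f g where fg: "x = eval_root f" "y = eval_root g" by (elim imageE)
    show "x + y \<in> range eval_root" unfolding fg
      by (rule range_eqI[of _ _ "f + g"]) (simp only: of_int_poly_hom.hom_add poly_add)
    show "x * y \<in> range eval_root" unfolding fg
      by (rule range_eqI[of _ _ "f * g"]) (simp only: of_int_poly_hom.hom_mult poly_mult)
    show "- x \<in> range eval_root" unfolding fg
      by (rule range_eqI[of _ _ "- f"]) (simp only: of_int_poly_hom.hom_uminus poly_minus)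
  qed
  have sub: "range eval_root \<subseteq> K" using PS.poly_mem[OF root_mem_adjoin_root] by auto
  have proper: "1 \<notin> ideal2 (range eval_root) (of_nat p) (eval_root (\<phi> i))"
  proof
    assume "1 \<in> ideal2 (range eval_root) (of_nat p) (eval_root (\<phi> i))"
    then obtain f g where fg: "1 = of_nat p * eval_root f + eval_root (\<phi> i) * eval_root g"
      by (auto simp: ideal2_def)
    let ?q = "Polynomial.smult (int p) f"
    have "eval_root ?q = of_nat p * eval_root f"
    proof -
      have "of_int_poly ?q = Polynomial.smult (of_nat p) (of_int_poly f :: complex poly)"
        by (intro poly_eqI) (simp add: coeff_map_poly)
      thus ?thesis by (simp only: poly_smult)
    qed
    hence "eval_root (1 - (?q + \<phi> i * g)) = 0"
      using fg by (simp only: of_int_poly_hom.hom_minus of_int_poly_hom.hom_add of_int_poly_hom.hom_mult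
          of_int_poly_hom.hom_one poly_diff poly_add poly_mult poly_1) simp
    hence "F dvd 1 - (?q + \<phi> i * g)" by (rule dvd_if_root)
    hence "red F dvd red (1 - (?q + \<phi> i * g))" by (rule of_int_poly_hom.hom_dvd)
    moreover have "red (\<phi> i) dvd red F"
      using multiplicity_l(1)[OF i] l_pos[OF i] by (meson dvd_power dvd_trans less_le_trans zero_less_one)
    ultimately have "red (\<phi> i) dvd red (1 - (?q + \<phi> i * g))" by (rule dvd_trans[rotated])
    moreover have "red (1 - (?q + \<phi> i * g)) = red (1 - \<phi> i * g)"
      unfolding red_eq_iff by (rule exI[of _ "- f"]) simp
    ultimately have "red (\<phi> i) dvd 1 - red (\<phi> i) * red g"
      by (simp only: of_int_poly_hom.hom_minus of_int_poly_hom.hom_mult of_int_poly_hom.hom_one)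
    hence "red (\<phi> i) dvd (1 - red (\<phi> i) * red g) + red (\<phi> i) * red g" by (intro dvd_add dvd_triv_left)
    hence "red (\<phi> i) dvd 1" by simp
    thus False using irreducible_not_unit[OF phi_irreducible[OF i]] by blast
  qed
  have "\<exists>w\<in>valuations_extending p K. 0 < w (eval_root (\<phi> i))"
    by (rule PS.extending_valuation_exists[OF A sub rangeI proper rank_le_adjoin_root])
  thus ?thesis unfolding lies_over_def by (elim bexE) (intro exI conjI)
qed

text \<open>The product of the \<phi>_i^l_i is congruent to F modulo p, so its value at \<alpha> is
  p times some q(\<alpha>). Not all factors can have value 0.\<close>

lemma lies_over_exists_index:
  assumes w: "w \<in> valuations_extending p K"
  shows "\<exists>i\<in>{1..r}. lies_over i w"
proof (rule ccontr)
  interpret V: valuation_of_root p ty F \<alpha> w by unfold_locales (rule w)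
  assume none: "\<not> (\<exists>i\<in>{1..r}. lies_over i w)"
  have zero: "w (eval_root (\<phi> i)) = 0" if "i \<in> {1..r}" for i
    using V.w_ev_nonneg[of "\<phi> i"] none that w unfolding lies_over_def by (auto simp: order.order_iff_strict)
  let ?P = "\<Prod>i\<in>{1..r}. \<phi> i ^ l i"
  have "red ?P = red F"
    unfolding factorization by (simp only: of_int_poly_hom.hom_prod of_int_poly_hom.hom_power)
  then obtain q where "?P = F + Polynomial.smult (int p) q" unfolding red_eq_iff by (elim exE)
  hence "eval_root ?P = eval_root (Polynomial.smult (int p) q)"
    using root by (simp only: of_int_poly_hom.hom_add poly_add) simp
  hence pos: "0 < w (eval_root ?P)" using V.w_smult_p_pos[of q] by (simp only:)
  have "w (eval_root (\<Prod>i\<in>A. \<phi> i ^ l i)) = 0" if "finite A" "A \<subseteq> {1..r}" for A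
    using that
  proof (induction A rule: finite_induct)
    case (insert i A)
    have pow: "w (eval_root (\<phi> i) ^ n) = 0" for n
    proof (induction n)
      case (Suc n)
      thus ?case using zero[of i] insert.prems V.ev_mem
        by (simp add: V.W.w_mult)
    qed simp
    have IH: "w (eval_root (\<Prod>i\<in>A. \<phi> i ^ l i)) = 0" using insert.IH insert.prems by simp
    have "(\<Prod>i\<in>insert i A. \<phi> i ^ l i) = \<phi> i ^ l i * (\<Prod>i\<in>A. \<phi> i ^ l i)"
      using insert.hyps by (rule prod.insert)
    thus ?case
      using pow[of "l i"] IH V.W.w_mult[OF PS.power_mem[OF V.ev_mem] V.ev_mem]
      by (simp only: V.ev_mult V.ev_power) simp
  qed (simp only: prod.empty V.ev_1 V.W.w_1)
  from this[of "{1..r}"] pos show False by simp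
qed

text \<open>At a valuation over i, \<phi>_j(\<alpha>) has positive value only if the reduction of
  \<phi>_i divides that of \<phi>_j.\<close>

lemma lies_over_unique_index:
  assumes "i \<in> {1..r}" "j \<in> {1..r}" "lies_over i w" "lies_over j w"
  shows "i = j"
proof -
  interpret V: valuation_above p ty F \<alpha> "\<phi> i" w
    by unfold_locales (use assms phi_monic phi_irreducible in \<open>auto simp: lies_over_def\<close>)
  have "red (\<phi> i) dvd red (\<phi> j)" using assms(4) V.w_ev_pos_iff unfolding lies_over_def by blast
  thus ?thesis by (rule red_dvd_imp_eq[OF assms(1,2)])
qed

definition families :: "(complex \<Rightarrow> ereal) \<Rightarrow> nat \<Rightarrow> (nat \<Rightarrow> complex) \<Rightarrow> complex list \<Rightarrow> bool" where
  "families w n x ys \<longleftrightarrow> ext_valuation.value_distinct K w n x \<and> ext_valuation.residue_list K p w ys"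

lemma families_exist:
  assumes i: "i \<in> {1..r}" and w: "lies_over i w"
  shows "\<exists>n x ys. families w n x ys \<and> n * d i = l i \<and> length ys = m i * d i"
proof -
  interpret V: valuation_above p ty F \<alpha> "\<phi> i" w
    by unfold_locales (use i w phi_monic phi_irreducible in \<open>auto simp: lies_over_def\<close>)
  show ?thesis
    using V.families_exist[OF expansion[OF i] multiplicity_l[OF i] cases[OF i]]
    unfolding families_def by (simp only: conj_assoc)
qed

text \<open>n d_i = l_i for families at any valuation over i, and l_i is positive.\<close>

lemma d_pos: "i \<in> {1..r} \<Longrightarrow> d i > 0"
proof -
  assume i: "i \<in> {1..r}"
  obtain w where "lies_over i w" using lies_over_exists[OF i] ..
  from families_exist[OF i this] obtain n where "n * d i = l i" by (elim exE conjE)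
  thus "d i > 0" using l_pos[OF i] by (cases "d i") simp_all
qed

lemma m_pos: "i \<in> {1..r} \<Longrightarrow> m i > 0"
proof -
  assume i: "i \<in> {1..r}"
  obtain w where "lies_over i w" using lies_over_exists[OF i] ..
  then interpret V: valuation_above p ty F \<alpha> "\<phi> i" w
    by unfold_locales (use i phi_monic phi_irreducible in \<open>auto simp: lies_over_def\<close>)
  show "m i > 0" by (rule V.degree_phi_pos)
qed

text \<open>The fundamental inequality, with e(w) f(w) replaced by sizes of arbitrary families at
  w.\<close>

lemma sum_families_le:
  assumes T: "finite T" "T \<subseteq> valuations_extending p K"
    and fam: "\<And>w. w \<in> T \<Longrightarrow> families w (n w) (x w) (ys w)"
  shows "(\<Sum>w\<in>T. n w * length (ys w)) \<le> N"
proof -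
  have ext: "ext_valuation K p w" if "w \<in> T" for w using PS.ext_val T(2) that by blast
  have "(\<Sum>w\<in>T. card ({..<n w} \<times> {..<length (ys w)})) \<le> N"
  proof (rule PS.sum_card_free_families_le[OF rank_le_adjoin_root T, where z = "\<lambda>w (i, j). x w i * ys w ! j"])
    fix w assume w: "w \<in> T"
    interpret E: ext_valuation K p w by (rule ext[OF w])
    have *: "E.value_distinct (n w) (x w)" "E.residue_list (ys w)" using fam[OF w] by (simp_all only: families_def)
    show "free_family p w ({..<n w} \<times> {..<length (ys w)}) (\<lambda>(i, j). x w i * ys w ! j)"
      by (rule E.free_family_of_lists[OF *])
    fix k assume "k \<in> {..<n w} \<times> {..<length (ys w)}"
    then obtain i j where ij: "k = (i, j)" "i < n w" "j < length (ys w)" by auto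
    have "x w i \<in> K" using *(1) ij(2) by (simp add: E.value_distinct_def)
    moreover have "ys w ! j \<in> K" using *(2) nth_mem[OF ij(3)] by (auto simp: E.residue_list_def E.R_simps)
    ultimately show "(case k of (i, j) \<Rightarrow> x w i * ys w ! j) \<in> K" by (simp add: ij(1))
  qed simp
  thus ?thesis by (simp add: card_cartesian_product)
qed

text \<open>At first an arbitrary choice; \<open>eq_omega\<close> shows that there is only one
  valuation over i.\<close>

definition \<omega> :: "nat \<Rightarrow> complex \<Rightarrow> ereal" where "\<omega> i = (SOME w. lies_over i w)"

lemma lies_over_omega: "i \<in> {1..r} \<Longrightarrow> lies_over i (\<omega> i)"
  unfolding \<omega>_def by (rule someI_ex[OF lies_over_exists])

lemma omega_inj: "inj_on \<omega> {1..r}"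
proof (rule inj_onI)
  fix i j assume ij: "i \<in> {1..r}" "j \<in> {1..r}" "\<omega> i = \<omega> j"
  show "i = j" using lies_over_omega[OF ij(2)] unfolding ij(3)[symmetric]
    by (rule lies_over_unique_index[OF ij(1,2) lies_over_omega[OF ij(1)]])
qed

lemma size_eq: "n * d i = l i \<Longrightarrow> length ys = m i * d i \<Longrightarrow> n * length ys = l i * m i"
  by (metis mult.assoc mult.commute)

text \<open>Arbitrary families at w compete with those at the chosen valuations of U, each of which
  takes up l_j m_j. All indices as U give uniqueness over i; all indices but i give maximality of
  the families at \<omega> i.\<close>

lemma families_bound:
  assumes w: "w \<in> valuations_extending p K" and fam: "families w n x ys"
    and U: "U \<subseteq> {1..r}" "w \<notin> \<omega> ` U"
  shows "n * length ys + (\<Sum>j\<in>U. l j * m j) \<le> N"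
proof -
  have "\<exists>t. families (\<omega> j) (fst t) (fst (snd t)) (snd (snd t)) \<and> fst t * length (snd (snd t)) = l j * m j"
    if j: "j \<in> {1..r}" for j
  proof -
    from families_exist[OF j lies_over_omega[OF j]] obtain n x ys where
      *: "families (\<omega> j) n x ys" "n * d j = l j" "length ys = m j * d j" by (elim exE conjE)
    show ?thesis using *(1) size_eq[OF *(2,3)] by (intro exI[of _ "(n, x, ys)"]) simp
  qed
  hence "\<forall>j\<in>{1..r}. \<exists>t. families (\<omega> j) (fst t) (fst (snd t)) (snd (snd t)) \<and> fst t * length (snd (snd t)) = l j * m j"
    by (rule ballI)
  from bchoice[OF this] obtain t where "\<forall>j\<in>{1..r}.
      families (\<omega> j) (fst (t j)) (fst (snd (t j))) (snd (snd (t j))) \<and> fst (t j) * length (snd (snd (t j))) = l j * m j"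
    by (elim exE)
  note t = bspec[OF this]
  \<comment> \<open>Families at all valuations involved: the given ones at w, and chosen ones at
    each \<omega> j, whose index is recovered by injectivity.\<close>
  define g where "g u = (if u = w then (n, x, ys) else t (inv_into {1..r} \<omega> u))" for u
  have inj: "inj_on \<omega> U" by (rule inj_on_subset[OF omega_inj U(1)])
  have fin: "finite U" using U(1) by (rule finite_subset) simp
  have g_omega: "g (\<omega> j) = t j" if j: "j \<in> U" for j
  proof -
    have "\<omega> j \<noteq> w" using U(2) imageI[OF j, of \<omega>] by metis
    moreover have "inv_into {1..r} \<omega> (\<omega> j) = j" using omega_inj U(1) j by (intro inv_into_f_f) auto
    ultimately show ?thesis by (simp add: g_def)
  qed
  have "(\<Sum>u\<in>insert w (\<omega> ` U). fst (g u) * length (snd (snd (g u)))) \<le> N"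
  proof (rule sum_families_le)
    show "insert w (\<omega> ` U) \<subseteq> valuations_extending p K"
      using w U(1) lies_over_omega by (auto simp: lies_over_def)
    fix u assume "u \<in> insert w (\<omega> ` U)"
    thus "families u (fst (g u)) (fst (snd (g u))) (snd (snd (g u)))"
    proof
      assume "u = w"
      thus ?thesis using fam by (simp add: g_def)
    next
      assume "u \<in> \<omega> ` U"
      then obtain j where j: "u = \<omega> j" "j \<in> U" by (rule imageE)
      show ?thesis unfolding j(1) g_omega[OF j(2)] using t U(1) j(2) by blast
    qed
  qed (use fin in simp)
  also have "(\<Sum>u\<in>insert w (\<omega> ` U). fst (g u) * length (snd (snd (g u))))
      = n * length ys + (\<Sum>u\<in>\<omega> ` U. fst (g u) * length (snd (snd (g u))))"
    using fin U(2) by (subst sum.insert) (simp_all add: g_def)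
  also have "(\<Sum>u\<in>\<omega> ` U. fst (g u) * length (snd (snd (g u)))) = (\<Sum>j\<in>U. l j * m j)"
    unfolding sum.reindex[OF inj] o_def
    by (intro sum.cong refl) (use g_omega t U(1) in auto)
  finally show ?thesis .
qed

text \<open>A second valuation over i would add l_i m_i > 0 to contributions that already exhaust
  N.\<close>

lemma eq_omega:
  assumes i: "i \<in> {1..r}" and w: "lies_over i w"
  shows "w = \<omega> i"
proof (rule ccontr)
  assume ne: "w \<noteq> \<omega> i"
  have notin: "w \<notin> \<omega> ` {1..r}"
  proof
    assume "w \<in> \<omega> ` {1..r}"
    then obtain j where j: "w = \<omega> j" "j \<in> {1..r}" by (rule imageE)
    have "i = j" using w lies_over_omega[OF j(2)] unfolding j(1) by (rule lies_over_unique_index[OF i j(2)])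
    thus False using ne j(1) by simp
  qed
  from families_exist[OF i w] obtain n x ys where
    *: "families w n x ys" "n * d i = l i" "length ys = m i * d i" by (elim exE conjE)
  have "w \<in> valuations_extending p K" using w by (simp add: lies_over_def)
  from families_bound[OF this *(1) order_refl notin] have "n * length ys = 0" unfolding sum_l_m by simp
  hence "l i * m i = 0" using size_eq[OF *(2,3)] by simp
  thus False using l_pos[OF i] m_pos[OF i] by simp
qed

text \<open>The other chosen valuations already take up N - l_i m_i.\<close>

lemma families_max:
  assumes i: "i \<in> {1..r}" and fam: "families (\<omega> i) n x ys"
  shows "n * length ys \<le> l i * m i"
proof -
  have "\<omega> i \<notin> \<omega> ` ({1..r} - {i})"
  proof
    assume "\<omega> i \<in> \<omega> ` ({1..r} - {i})"
    then obtain j where j: "\<omega> i = \<omega> j" "j \<in> {1..r} - {i}" by (rule imageE)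
    have "i = j" using j(2) by (intro inj_onD[OF omega_inj j(1) i]) simp
    thus False using j(2) by simp
  qed
  moreover have "\<omega> i \<in> valuations_extending p K" using lies_over_omega[OF i] by (simp add: lies_over_def)
  ultimately have "n * length ys + (\<Sum>j\<in>{1..r} - {i}. l j * m j) \<le> N"
    using fam by (intro families_bound) auto
  also have "N = l i * m i + (\<Sum>j\<in>{1..r} - {i}. l j * m j)"
    unfolding sum_l_m[symmetric] using i by (intro sum.remove) auto
  finally show ?thesis by simp
qed

text \<open>The bound concerns the product of the two sizes, so one of the two families is kept
  fixed, nonempty, while the other varies; this gives maximality of each separately.\<close>

lemma omega_invariants:
  assumes i: "i \<in> {1..r}"
  shows "ramification_index K (\<omega> i) * d i = l i" "residue_degree K (\<omega> i) = m i * d i"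
proof -
  note over_i = lies_over_omega[OF i]
  interpret E: ext_valuation K p "\<omega> i" using over_i by (intro PS.ext_val) (simp add: lies_over_def)
  from families_exist[OF i over_i] obtain n x ys where
    *: "families (\<omega> i) n x ys" "n * d i = l i" "length ys = m i * d i" by (elim exE conjE)
  have fam: "E.value_distinct n x" "E.residue_list ys" using *(1) by (simp_all only: families_def)
  have n: "n > 0" using *(2) l_pos[OF i] by (cases n) simp_all
  have len: "length ys > 0" using *(3) m_pos[OF i] d_pos[OF i] by simp
  have "ramification_index K (\<omega> i) = n"
  proof (rule E.ramification_index_eqI[OF fam(1)])
    fix n' x' assume "E.value_distinct n' x'"
    hence "families (\<omega> i) n' x' ys" using fam(2) by (simp only: families_def simp_thms)
    from families_max[OF i this] have "n' * length ys \<le> n * length ys" unfolding size_eq[OF *(2,3)] .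
    thus "n' \<le> n" using len by simp
  qed
  thus "ramification_index K (\<omega> i) * d i = l i" using *(2) by simp
  have "residue_degree K (\<omega> i) = length ys"
  proof (rule E.residue_degree_eqI[OF fam(2)])
    fix ys' assume "E.residue_list ys'"
    hence "families (\<omega> i) n x ys'" using fam(1) by (simp only: families_def simp_thms)
    from families_max[OF i this] have "n * length ys' \<le> n * length ys" unfolding size_eq[OF *(2,3)] .
    thus "length ys' \<le> length ys" using n by simp
  qed
  thus "residue_degree K (\<omega> i) = m i * d i" using *(3) by simp
qed

lemma omega_bij: "bij_betw \<omega> {1..r} (valuations_extending p K)"
  unfolding bij_betw_def
proof
  show "inj_on \<omega> {1..r}" by (rule omega_inj)
  show "\<omega> ` {1..r} = valuations_extending p K"
  proof
    show "\<omega> ` {1..r} \<subseteq> valuations_extending p K" using lies_over_omega by (auto simp: lies_over_def)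
    show "valuations_extending p K \<subseteq> \<omega> ` {1..r}"
    proof
      fix w assume "w \<in> valuations_extending p K"
      from lies_over_exists_index[OF this] obtain i where i: "i \<in> {1..r}" "lies_over i w" by (rule bexE)
      show "w \<in> \<omega> ` {1..r}" using eq_omega[OF i] i(1) by (rule image_eqI)
    qed
  qed
qed

end

theorem theorem2p1:
  fixes p r :: nat
    and F :: "int poly" and \<alpha> :: complex
    and \<phi> :: "nat \<Rightarrow> int poly" and l L :: "nat \<Rightarrow> nat"
    and a :: "nat \<Rightarrow> nat \<Rightarrow> int poly"
  assumes p: "p = CARD('p :: prime_card)"
    and F: "Polynomial.lead_coeff F = 1" "Factorial_Ring.irreducible F"
    and \<alpha>: "poly (of_int_poly F) \<alpha> = 0"
    and factorization:
      "(of_int_poly F :: 'p mod_ring poly) = (\<Prod>i\<in>{1..r}. of_int_poly (\<phi> i) ^ l i)"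
    and l: "\<And>i. i \<in> {1..r} \<Longrightarrow> l i \<ge> 1"
    and \<phi>_monic: "\<And>i. i \<in> {1..r} \<Longrightarrow> Polynomial.lead_coeff (\<phi> i) = 1"
    and \<phi>_irreducible:
      "\<And>i. i \<in> {1..r} \<Longrightarrow> Factorial_Ring.irreducible (of_int_poly (\<phi> i) :: 'p mod_ring poly)"
    and \<phi>_distinct: "inj_on (\<lambda>i. of_int_poly (\<phi> i) :: 'p mod_ring poly) {1..r}"
    and expansion: "\<And>i. i \<in> {1..r} \<Longrightarrow> phi_adic_expansion (\<phi> i) F (L i) (a i)"
    and cases: "\<And>i. i \<in> {1..r} \<Longrightarrow>
      l i = 1 \<or>
      (l i \<ge> 2 \<and> L_property p (L i) (a i) (exp_lambda p (L i) (a i)) \<and>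
       pirreducible\<^bsub>phi_field p (\<phi> i)\<^esub> (carrier (phi_field p (\<phi> i)))
         (residual_poly p (\<phi> i) (L i) (a i)))"
  shows "\<exists>w. bij_betw w {1..r} (valuations_extending p (adjoin_root \<alpha>)) \<and>
    (\<forall>i\<in>{1..r}.
       real (ramification_index (adjoin_root \<alpha>) (w i)) = real (l i) / real (exp_d p (L i) (a i)) \<and>
       residue_degree (adjoin_root \<alpha>) (w i) = Polynomial.degree (\<phi> i) * exp_d p (L i) (a i))"
proof -
  interpret ore_setup p "TYPE('p)" F \<alpha> r \<phi> l L a
    by unfold_locales (fact p F \<alpha> factorization l \<phi>_monic \<phi>_irreducible \<phi>_distinct expansion cases)+
  have "real (ramification_index (adjoin_root \<alpha>) (\<omega> i)) = real (l i) / real (exp_d p (L i) (a i))"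
    if i: "i \<in> {1..r}" for i
  proof -
    have "real (ramification_index K (\<omega> i)) * real (d i) = real (l i)"
      by (simp only: omega_invariants(1)[OF i] flip: of_nat_mult)
    thus ?thesis using d_pos[OF i] by (simp add: field_simps)
  qed
  thus ?thesis using omega_bij omega_invariants(2) by (intro exI[of _ \<omega>] conjI ballI) simp_all
qed

end
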